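(* Let $f\in L^2(\Omega)$, let $u\in V$ be the weak solution of $-\operatorname{div}(\kappa\nabla u)=f$ in $\Omega$, $u=0$ on $\partial\Omega$, and let $u_{H,\infty}^{\mathrm{ms}}\in V_{H,\infty}$ be the multiscale solution obtained from the global multiscale space $V_{H,\infty}$. Then $$\|u-u_{H,\infty}^{\mathrm{ms}}\|_a\le\frac{1}{\sqrt{\Lambda}}\,\|f\|_{s^*}.$$
   Context: $\Omega\subset\mathbb{R}^d$, $d\in\{2,3\}$, is a bounded Lipschitz domain; $\kappa$ is a measurable coefficient on $\Omega$ with $0<\kappa_{\min}\le\kappa\le\kappa_{\max}<\infty$ a.e.; $V:=H^1_0(\Omega)$. Coarse partition: $\mathcal{T}_H=\{K_j\}_j$ is a finite partition of $\Omega$ into (connected, Lipschitz) coarse elements, $H:=\max_j\operatorname{diam}(K_j)$. Bilinear forms: $\tilde\kappa:=C_{\mathrm{msh}}H^{-2}\kappa$ with a constant $C_{\mathrm{msh}}>0$ determined by the regularity of the coarse mesh; $a(v,w)=\int_\Omega\kappa\nabla v\cdot\nabla w\,dx$, $s(v,w)=\int_\Omega\tilde\kappa vw\,dx$, and $a_j,s_j$ are the same forms with integration over $K_j$. Norms: $\|v\|_a^2=a(v,v)$, $\|v\|_s^2=s(v,v)$. The dual norm is $\|f\|_{s^*}=\sup_{0\ne v\in L^2(\Omega)}\int_\Omega fv\,dx/\|v\|_s$. Auxiliary space: for each $j$ let $(\lambda_{j,i},\Phi_{j,i})_{i\ge1}$ be the eigenpairs of $a_j(\Phi_{j,i},v)=\lambda_{j,i}s_j(\Phi_{j,i},v)$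 for all $v\in H^1(K_j)$, with $0=\lambda_{j,1}\le\lambda_{j,2}\le\cdots$. For a fixed $k\ge1$, $V_j^{\mathrm{aux}}=\operatorname{span}\{\Phi_{j,1},\dots,\Phi_{j,k}\}$, $\pi_j:L^2(K_j)\to L^2(K_j)$ is the $s_j$-orthogonal projection onto $V_j^{\mathrm{aux}}$, and $\pi$ acts on $L^2(\Omega)$ by $(\pi v)|_{K_j}=\pi_j(v|_{K_j})$. $\Lambda:=\min_j\lambda_{j,k+1}$. Global multiscale space: for $v\in L^2(K_j)$ (extended by zero to $\Omega$), $\mathcal{G}_{j,\infty}v\in V$ is the solution of $a(\mathcal{G}_{j,\infty}v,w)+s(\pi\mathcal{G}_{j,\infty}v,\pi w)=s(\pi v,\pi w)$ for all $w\in V$. For $v\in L^2(\Omega)$, $\mathcal{G}_\infty v:=\sum_j\mathcal{G}_{j,\infty}(v|_{K_j})$, and $V_{H,\infty}:=\operatorname{im}(\mathcal{G}_\infty)\subset V$. The multiscale solution $u_{H,\infty}^{\mathrm{ms}}\in V_{H,\infty}$ is the Galerkin solution: $a(u_{H,\infty}^{\mathrm{ms}},v)=\int_\Omega fv\,dx$ for all $v\in V_{H,\infty}$. *)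

theory Defs
  imports "HOL-Analysis.Analysis"
begin

section \<open>Lipschitz domains\<close>

text \<open>Near each boundary point the set is the strict epigraph of a Lipschitz function
  \<open>\<gamma>\<close> over the hyperplane orthogonal to a unit vector \<open>e\<close>. The neighbourhood
  \<open>U\<close> is an arbitrary open set; it can always be shrunk to a cylinder with axis \<open>e\<close>.\<close>

definition lipschitz_boundary :: "(real^'d) set \<Rightarrow> bool" where
  "lipschitz_boundary S \<longleftrightarrow>
     (\<forall>p\<in>frontier S. \<exists>U e \<gamma> L. open U \<and> p \<in> U \<and> norm e = 1 \<and>
        L-lipschitz_on {z. z \<bullet> e = 0} \<gamma> \<and>
        U \<inter> S = {x\<in>U. \<gamma> (x - (x \<bullet> e) *\<^sub>R e) < x \<bullet> e})"

definition bounded_lipschitz_domain :: "(real^'d) set \<Rightarrow> bool" where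
  "bounded_lipschitz_domain S \<longleftrightarrow>
     open S \<and> connected S \<and> S \<noteq> {} \<and> bounded S \<and> lipschitz_boundary S"


section \<open>Sobolev spaces\<close>

text \<open>Elements of \<open>L\<^sup>2(S)\<close> are represented by functions on the whole space of which only the
  values on \<open>S\<close> matter, up to null sets.\<close>

definition L2 :: "(real^'d) set \<Rightarrow> (real^'d \<Rightarrow> real) set" where
  "L2 S = {v. v \<in> borel_measurable (lebesgue_on S) \<and> integrable (lebesgue_on S) (\<lambda>x. (v x)\<^sup>2)}"

definition gradient :: "(real^'d \<Rightarrow> real) \<Rightarrow> real^'d \<Rightarrow> real^'d" where
  "gradient \<phi> x = (\<chi> i. frechet_derivative \<phi> (at x) (axis i 1))"

primrec cont_diff :: "nat \<Rightarrow> (real^'d \<Rightarrow> real) \<Rightarrow> bool" where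
  "cont_diff 0 \<phi> \<longleftrightarrow> continuous_on UNIV \<phi>"
| "cont_diff (Suc m) \<phi> \<longleftrightarrow>
     (\<forall>x. \<phi> differentiable (at x)) \<and> (\<forall>i. cont_diff m (\<lambda>x. gradient \<phi> x $ i))"

definition test_functions :: "(real^'d) set \<Rightarrow> (real^'d \<Rightarrow> real) set" where
  "test_functions S =
     {\<phi>. (\<forall>m. cont_diff m \<phi>) \<and> compact (closure {x. \<phi> x \<noteq> 0}) \<and> closure {x. \<phi> x \<noteq> 0} \<subseteq> S}"

definition has_weak_gradient ::
  "(real^'d) set \<Rightarrow> (real^'d \<Rightarrow> real) \<Rightarrow> (real^'d \<Rightarrow> real^'d) \<Rightarrow> bool" where
  "has_weak_gradient S v g \<longleftrightarrow>
     v \<in> L2 S \<and> (\<forall>i. (\<lambda>x. g x $ i) \<in> L2 S) \<and>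
     (\<forall>\<phi>\<in>test_functions S. \<forall>i.
        (LINT x|lebesgue_on S. v x * gradient \<phi> x $ i) = - (LINT x|lebesgue_on S. g x $ i * \<phi> x))"

definition H1 :: "(real^'d) set \<Rightarrow> (real^'d \<Rightarrow> real) set" where
  "H1 S = {v. \<exists>g. has_weak_gradient S v g}"

text \<open>Unique up to null sets for \<open>v \<in> H1 S\<close> and open \<open>S\<close>.\<close>

definition weak_gradient :: "(real^'d) set \<Rightarrow> (real^'d \<Rightarrow> real) \<Rightarrow> real^'d \<Rightarrow> real^'d" where
  "weak_gradient S v = (SOME g. has_weak_gradient S v g)"

text \<open>The closure of the test functions in the norm of \<open>H1 S\<close>.\<close>

definition H10 :: "(real^'d) set \<Rightarrow> (real^'d \<Rightarrow> real) set" where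
  "H10 S = {v \<in> H1 S. \<exists>\<phi>. (\<forall>n. \<phi> n \<in> test_functions S) \<and>
     (\<lambda>n. LINT x|lebesgue_on S. (v x - \<phi> n x)\<^sup>2) \<longlonglongrightarrow> 0 \<and>
     (\<lambda>n. LINT x|lebesgue_on S. (norm (weak_gradient S v x - gradient (\<phi> n) x))\<^sup>2) \<longlonglongrightarrow> 0}"


section \<open>Bilinear forms and norms\<close>

text \<open>The form \<open>a\<close> is \<open>grad_form \<kappa> \<Omega>\<close> and \<open>s\<close> is \<open>mass_form \<kappa>' \<Omega>\<close>
  with the scaled coefficient \<open>\<kappa>'\<close>; the local forms have \<open>K j\<close> in place of \<open>\<Omega>\<close>.\<close>

definition grad_form ::
  "(real^'d \<Rightarrow> real) \<Rightarrow> (real^'d) set \<Rightarrow> (real^'d \<Rightarrow> real) \<Rightarrow> (real^'d \<Rightarrow> real) \<Rightarrow> real" where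
  "grad_form \<kappa> S v w = (LINT x|lebesgue_on S. \<kappa> x * (weak_gradient S v x \<bullet> weak_gradient S w x))"

definition mass_form ::
  "(real^'d \<Rightarrow> real) \<Rightarrow> (real^'d) set \<Rightarrow> (real^'d \<Rightarrow> real) \<Rightarrow> (real^'d \<Rightarrow> real) \<Rightarrow> real" where
  "mass_form \<kappa>' S v w = (LINT x|lebesgue_on S. \<kappa>' x * v x * w x)"

definition energy_norm :: "(real^'d \<Rightarrow> real) \<Rightarrow> (real^'d) set \<Rightarrow> (real^'d \<Rightarrow> real) \<Rightarrow> real" where
  "energy_norm \<kappa> S v = sqrt (grad_form \<kappa> S v v)"

definition mass_norm :: "(real^'d \<Rightarrow> real) \<Rightarrow> (real^'d) set \<Rightarrow> (real^'d \<Rightarrow> real) \<Rightarrow> real" where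
  "mass_norm \<kappa>' S v = sqrt (mass_form \<kappa>' S v v)"

definition dual_mass_norm :: "(real^'d \<Rightarrow> real) \<Rightarrow> (real^'d) set \<Rightarrow> (real^'d \<Rightarrow> real) \<Rightarrow> real" where
  "dual_mass_norm \<kappa>' S f =
     (SUP v\<in>{v \<in> L2 S. \<not> (AE x in lebesgue_on S. v x = 0)}.
        (LINT x|lebesgue_on S. f x * v x) / mass_norm \<kappa>' S v)"


section \<open>Coarse mesh\<close>

text \<open>The elements are open, so they can cover \<open>\<Omega>\<close> only up to a null set (the skeleton).\<close>

definition coarse_mesh :: "(real^'d) set \<Rightarrow> 'j set \<Rightarrow> ('j \<Rightarrow> (real^'d) set) \<Rightarrow> bool" where
  "coarse_mesh \<Omega> J K \<longleftrightarrow>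
     finite J \<and> (\<forall>j\<in>J. bounded_lipschitz_domain (K j) \<and> K j \<subseteq> \<Omega>) \<and>
     disjoint_family_on K J \<and> negligible (\<Omega> - (\<Union>j\<in>J. K j))"

definition mesh_size :: "'j set \<Rightarrow> ('j \<Rightarrow> (real^'d) set) \<Rightarrow> real" where
  "mesh_size J K = (MAX j\<in>J. diameter (K j))"

definition scaled_coeff :: "real \<Rightarrow> real \<Rightarrow> (real^'d \<Rightarrow> real) \<Rightarrow> real^'d \<Rightarrow> real" where
  "scaled_coeff C H \<kappa> x = C * H powi (-2) * \<kappa> x"


section \<open>Auxiliary space\<close>

definition eigenpair ::
  "(real^'d \<Rightarrow> real) \<Rightarrow> (real^'d \<Rightarrow> real) \<Rightarrow> (real^'d) set \<Rightarrow> real \<Rightarrow> (real^'d \<Rightarrow> real) \<Rightarrow> bool" where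
  "eigenpair \<kappa> \<kappa>' S \<mu> \<phi> \<longleftrightarrow>
     \<phi> \<in> H1 S \<and> \<not> (AE x in lebesgue_on S. \<phi> x = 0) \<and>
     (\<forall>v\<in>H1 S. grad_form \<kappa> S \<phi> v = \<mu> * mass_form \<kappa>' S \<phi> v)"

text \<open>The list of all eigenpairs in nondecreasing order, counted with multiplicity: for every
  eigenvalue \<open>\<mu>\<close> the functions \<open>\<Phi> i\<close> with \<open>lam i = \<mu>\<close> form a basis of the eigenspace.
  Indices start at 1; the values at 0 are irrelevant. Neither a normalisation nor completeness of
  the eigenfunctions in \<open>L\<^sup>2\<close> is part of the definition.\<close>

definition eigensystem ::
  "(real^'d \<Rightarrow> real) \<Rightarrow> (real^'d \<Rightarrow> real) \<Rightarrow> (real^'d) set \<Rightarrow> (nat \<Rightarrow> real) \<Rightarrow>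
   (nat \<Rightarrow> real^'d \<Rightarrow> real) \<Rightarrow> bool" where
  "eigensystem \<kappa> \<kappa>' S lam \<Phi> \<longleftrightarrow>
     (\<forall>i\<ge>1. eigenpair \<kappa> \<kappa>' S (lam i) (\<Phi> i)) \<and>
     lam 1 = 0 \<and> (\<forall>i\<ge>1. lam i \<le> lam (Suc i)) \<and>
     (\<forall>n c. (AE x in lebesgue_on S. (\<Sum>i=1..n. c i * \<Phi> i x) = 0) \<longrightarrow> (\<forall>i\<in>{1..n}. c i = 0)) \<and>
     (\<forall>\<mu> \<phi>. eigenpair \<kappa> \<kappa>' S \<mu> \<phi> \<longrightarrow>
        (\<exists>n c. AE x in lebesgue_on S. \<phi> x = (\<Sum>i\<in>{i\<in>{1..n}. lam i = \<mu>}. c i * \<Phi> i x)))"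

definition aux_space :: "(nat \<Rightarrow> real^'d \<Rightarrow> real) \<Rightarrow> nat \<Rightarrow> (real^'d \<Rightarrow> real) set" where
  "aux_space \<Phi> k = {\<lambda>x. \<Sum>i=1..k. c i * \<Phi> i x | c. True}"

definition local_proj ::
  "(real^'d \<Rightarrow> real) \<Rightarrow> (real^'d) set \<Rightarrow> (nat \<Rightarrow> real^'d \<Rightarrow> real) \<Rightarrow> nat \<Rightarrow>
   (real^'d \<Rightarrow> real) \<Rightarrow> real^'d \<Rightarrow> real" where
  "local_proj \<kappa>' S \<Phi> k v =
     (THE p. p \<in> aux_space \<Phi> k \<and> (\<forall>q\<in>aux_space \<Phi> k. mass_form \<kappa>' S (\<lambda>x. v x - p x) q = 0))"

definition aux_proj ::
  "(real^'d \<Rightarrow> real) \<Rightarrow> 'j set \<Rightarrow> ('j \<Rightarrow> (real^'d) set) \<Rightarrow> ('j \<Rightarrow> nat \<Rightarrow> real^'d \<Rightarrow> real) \<Rightarrow> nat \<Rightarrow>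
   (real^'d \<Rightarrow> real) \<Rightarrow> real^'d \<Rightarrow> real" where
  "aux_proj \<kappa>' J K \<Phi> k v x = (\<Sum>j\<in>J. if x \<in> K j then local_proj \<kappa>' (K j) (\<Phi> j) k v x else 0)"


section \<open>Global multiscale space\<close>

definition corrector_problem ::
  "(real^'d \<Rightarrow> real) \<Rightarrow> (real^'d \<Rightarrow> real) \<Rightarrow> (real^'d) set \<Rightarrow>
   ((real^'d \<Rightarrow> real) \<Rightarrow> real^'d \<Rightarrow> real) \<Rightarrow> (real^'d \<Rightarrow> real) \<Rightarrow> (real^'d \<Rightarrow> real) \<Rightarrow> bool" where
  "corrector_problem \<kappa> \<kappa>' \<Omega> \<pi> v g \<longleftrightarrow>
     g \<in> H10 \<Omega> \<and>
     (\<forall>w\<in>H10 \<Omega>. grad_form \<kappa> \<Omega> g w + mass_form \<kappa>' \<Omega> (\<pi> g) (\<pi> w) = mass_form \<kappa>' \<Omega> (\<pi> v) (\<pi> w))"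

text \<open>The solution of the corrector problem is unique up to null sets; \<open>SOME\<close> selects a
  representative. The restriction of \<open>v\<close> to \<open>K j\<close> is extended by zero.\<close>

definition local_corrector ::
  "(real^'d \<Rightarrow> real) \<Rightarrow> (real^'d \<Rightarrow> real) \<Rightarrow> (real^'d) set \<Rightarrow>
   ((real^'d \<Rightarrow> real) \<Rightarrow> real^'d \<Rightarrow> real) \<Rightarrow> (real^'d) set \<Rightarrow> (real^'d \<Rightarrow> real) \<Rightarrow> real^'d \<Rightarrow> real" where
  "local_corrector \<kappa> \<kappa>' \<Omega> \<pi> Kj v =
     (SOME g. corrector_problem \<kappa> \<kappa>' \<Omega> \<pi> (\<lambda>x. if x \<in> Kj then v x else 0) g)"

definition global_corrector ::
  "(real^'d \<Rightarrow> real) \<Rightarrow> (real^'d \<Rightarrow> real) \<Rightarrow> (real^'d) set \<Rightarrow>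
   ((real^'d \<Rightarrow> real) \<Rightarrow> real^'d \<Rightarrow> real) \<Rightarrow> 'j set \<Rightarrow> ('j \<Rightarrow> (real^'d) set) \<Rightarrow>
   (real^'d \<Rightarrow> real) \<Rightarrow> real^'d \<Rightarrow> real" where
  "global_corrector \<kappa> \<kappa>' \<Omega> \<pi> J K v x = (\<Sum>j\<in>J. local_corrector \<kappa> \<kappa>' \<Omega> \<pi> (K j) v x)"

text \<open>The image of the corrector as a set of classes modulo null sets: it contains every
  representative, and in particular does not depend on the choice made above.\<close>

definition multiscale_space ::
  "(real^'d \<Rightarrow> real) \<Rightarrow> (real^'d \<Rightarrow> real) \<Rightarrow> (real^'d) set \<Rightarrow>
   ((real^'d \<Rightarrow> real) \<Rightarrow> real^'d \<Rightarrow> real) \<Rightarrow> 'j set \<Rightarrow> ('j \<Rightarrow> (real^'d) set) \<Rightarrow>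
   (real^'d \<Rightarrow> real) set" where
  "multiscale_space \<kappa> \<kappa>' \<Omega> \<pi> J K =
     {w. \<exists>v\<in>L2 \<Omega>. AE x in lebesgue_on \<Omega>. w x = global_corrector \<kappa> \<kappa>' \<Omega> \<pi> J K v x}"

text \<open>With \<open>X = H10 \<Omega>\<close> this is the weak solution of the Dirichlet problem, with
  \<open>X\<close> the multiscale space it is the Galerkin solution.\<close>

definition solves_variational ::
  "(real^'d \<Rightarrow> real) \<Rightarrow> (real^'d) set \<Rightarrow> (real^'d \<Rightarrow> real) set \<Rightarrow> (real^'d \<Rightarrow> real) \<Rightarrow>
   (real^'d \<Rightarrow> real) \<Rightarrow> bool" where
  "solves_variational \<kappa> \<Omega> X f u \<longleftrightarrow>
     u \<in> X \<and> (\<forall>v\<in>X. grad_form \<kappa> \<Omega> u v = (LINT x|lebesgue_on \<Omega>. f x * v x))"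

end

theory Submission
  imports Defs "HOL-Computational_Algebra.Polynomial" "HOL-Library.Diagonal_Subsequence"
begin

text \<open>
  Let \<open>e\<close> be the error and \<open>w\<close> the global corrector of \<open>e\<close>. Galerkin orthogonality gives
  \<open>a(w, e) = 0\<close>, and testing the corrector equation with \<open>e\<close> and with \<open>w\<close> yields
  \<open>s(\<pi>w - \<pi>e, \<pi>w - \<pi>e) = - a(w, w)\<close>; hence \<open>w = 0\<close> and \<open>\<pi>e = 0\<close>. Then the multiscale solution is
  \<open>a\<close>-orthogonal to \<open>e\<close>, so \<open>a(e, e) = \<integral> f e\<close>, and \<open>\<Lambda> s(e, e) \<le> a(e, e)\<close> follows from the local spectral
  gaps.

  Since completeness of the eigenfunctions is not assumed, the spectral gap is obtained by minimizing
  the Rayleigh quotient on the orthogonal complement of the first \<open>k\<close> eigenfunctions, which needs the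
  Rellich theorem on Lipschitz domains. Everything rests on one estimate for weakly differentiable
  functions, \<open>\<parallel>v(\<cdot> + z) - v\<parallel> \<le> \<bar>z\<bar> \<parallel>\<nabla>v\<parallel>\<close>: averaged over \<open>z\<close> it gives the Poincare inequality on convex
  sets, with \<open>z\<close> leaving the domain it gives the Friedrichs inequality, and with \<open>z\<close> transversal to the
  boundary it reduces compactness to compact subsets, which are covered by small cubes.\<close>

section \<open>Smooth functions\<close>

text \<open>The error is \<open>a\<close>-orthogonal to the multiscale space, and the decisive fact
  is that inside \<open>H10\<close> this orthogonal complement is the kernel of
  \<open>\<pi>\<close>. The corrector equation says a(G v, z) = s(\<pi> v - \<pi> (G v), \<pi> z),
  so each corrector is orthogonal to the kernel; the corrector of the error itself yields the other
  inclusion, and it is an admissible test function because \<open>G\<close> acts on all of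
  \<open>L2\<close>. On the kernel of \<open>\<pi>\<close> a function is, on each element,
  orthogonal to the first \<open>k\<close> eigenfunctions; hence the constant \<Lambda>.

  Three points of form shape the rest. Correctors are selected by \<open>SOME\<close>, so their
  problem must be shown solvable, by Riesz representation in a complete space. The minimum \<Lambda>
  must be shown positive, since 1 / sqrt 0 is 0 by convention and the bound would then claim a
  vanishing error; positivity comes from connectedness of the elements. And the functions on an
  element satisfy no boundary condition, so compactness has to hold up to the boundary, which is
  where the boundary graphs enter.\<close>

lemma gradient_eq:
  assumes "(\<phi> has_derivative D) (at x)"
  shows "gradient \<phi> x $ i = D (axis i 1)"
  using frechet_derivative_at[OF assms] by (simp add: gradient_def)

lemma has_derivative_gradient:
  assumes "\<phi> differentiable (at x)"
  shows "(\<phi> has_derivative (\<lambda>h. gradient \<phi> x \<bullet> h)) (at x)"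
proof -
  have D: "(\<phi> has_derivative frechet_derivative \<phi> (at x)) (at x)"
    using assms frechet_derivative_works by blast
  interpret linear "frechet_derivative \<phi> (at x)"
    using D has_derivative_linear by blast
  have "frechet_derivative \<phi> (at x) h = gradient \<phi> x \<bullet> h" for h
  proof -
    have "frechet_derivative \<phi> (at x) h = frechet_derivative \<phi> (at x) (\<Sum>i\<in>UNIV. (h $ i) *\<^sub>R axis i 1)"
      by (simp add: basis_expansion flip: scalar_mult_eq_scaleR)
    also have "\<dots> = gradient \<phi> x \<bullet> h"
      by (simp add: sum scale inner_vec_def gradient_def mult.commute)
    finally show ?thesis .
  qed
  then show ?thesis using D by presburger
qed

lemma cont_diff_continuous: "cont_diff m \<phi> \<Longrightarrow> continuous_on UNIV \<phi>"
  by (cases m) (auto simp: differentiable_imp_continuous_on differentiable_on_def)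

lemma cont_diff_Suc: "cont_diff (Suc m) \<phi> \<Longrightarrow> cont_diff m \<phi>"
proof (induction m arbitrary: \<phi>)
  case 0
  then show ?case using cont_diff_continuous[OF 0] by simp
qed auto

lemma cont_diff_const: "cont_diff m (\<lambda>x. c)"
proof (induction m arbitrary: c)
  case (Suc m)
  have "gradient (\<lambda>x::real^'a. c) x $ i = 0" for x i
    by (rule gradient_eq) (rule has_derivative_const)
  then show ?case using Suc[of 0] by simp
qed auto

lemma cont_diff_add:
  "cont_diff m f \<Longrightarrow> cont_diff m g \<Longrightarrow> cont_diff m (\<lambda>x. f x + g x)"
proof (induction m arbitrary: f g)
  case 0
  then show ?case using continuous_on_add by simp
next
  case (Suc m)
  have "gradient (\<lambda>x. f x + g x) x $ i = gradient f x $ i + gradient g x $ i" for x i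
    using Suc.prems gradient_eq[OF has_derivative_add[OF has_derivative_gradient has_derivative_gradient, of f x g]]
    by (simp add: inner_axis)
  then show ?case using Suc by simp
qed

lemma cont_diff_mult:
  "cont_diff m f \<Longrightarrow> cont_diff m g \<Longrightarrow> cont_diff m (\<lambda>x. f x * g x)"
proof (induction m arbitrary: f g)
  case 0
  then show ?case using continuous_on_mult by simp
next
  case (Suc m)
  have "gradient (\<lambda>x. f x * g x) x $ i = f x * gradient g x $ i + gradient f x $ i * g x" for x i
    using Suc.prems gradient_eq[OF has_derivative_mult[OF has_derivative_gradient has_derivative_gradient, of f x g]]
    by (simp add: inner_axis)
  then show ?case using Suc.prems Suc.IH cont_diff_Suc[OF Suc.prems(1)] cont_diff_Suc[OF Suc.prems(2)]
    by (simp add: cont_diff_add)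
qed

lemma cont_diff_sum: "(\<And>a. a \<in> A \<Longrightarrow> cont_diff m (f a)) \<Longrightarrow> cont_diff m (\<lambda>x. \<Sum>a\<in>A. f a x)"
  by (induction A rule: infinite_finite_induct) (auto intro: cont_diff_const cont_diff_add)

lemma cont_diff_component: "cont_diff m (\<lambda>x. x $ i)"
proof (cases m)
  case (Suc n)
  have d: "((\<lambda>x::real^'a. x $ i) has_derivative (\<lambda>h. h $ i)) (at x)" for x
    by (intro bounded_linear_imp_has_derivative bounded_linear_vec_nth)
  have "gradient (\<lambda>x::real^'a. x $ i) x $ j = (axis j 1 :: real^'a) $ i" for x j
    by (rule gradient_eq[OF d])
  then show ?thesis using d cont_diff_const Suc by (auto simp: differentiable_def)
qed (simp add: continuous_intros)

lemma cont_diff_exp: "cont_diff m f \<Longrightarrow> cont_diff m (\<lambda>x. exp (f x))"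
proof (induction m arbitrary: f)
  case (Suc m)
  have d: "((\<lambda>x. exp (f x)) has_derivative (\<lambda>h. exp (f x) * (gradient f x \<bullet> h))) (at x)" for x
    using has_derivative_compose[OF has_derivative_gradient, of f x exp] Suc.prems
      DERIV_exp[unfolded has_field_derivative_def] by (auto simp: mult.commute)
  have "gradient (\<lambda>x. exp (f x)) x $ i = exp (f x) * gradient f x $ i" for x i
    using gradient_eq[OF d] by (simp add: inner_axis)
  then show ?case using d Suc cont_diff_Suc[OF Suc.prems]
    by (auto simp: differentiable_def intro!: cont_diff_mult)
qed (simp add: continuous_intros)

lemma cont_diff_translate: "cont_diff m f \<Longrightarrow> cont_diff m (\<lambda>x. f (x + z))"
proof (induction m arbitrary: f)
  case (Suc m)
  have d: "((\<lambda>x. f (x + z)) has_derivative (\<lambda>h. gradient f (x + z) \<bullet> h)) (at x)" for x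
    using Suc.prems
    by (intro has_derivative_compose[of "\<lambda>x. x + z" "\<lambda>h. h" x UNIV f] has_derivative_gradient)
       (auto intro!: derivative_eq_intros)
  have "gradient (\<lambda>x. f (x + z)) x $ i = gradient f (x + z) $ i" for x i
    using gradient_eq[OF d] by (simp add: inner_axis)
  moreover have "cont_diff m (\<lambda>x. gradient f (x + z) $ i)" for i
    using Suc.IH[of "\<lambda>x. gradient f x $ i"] Suc.prems by simp
  moreover have "(\<lambda>x. f (x + z)) differentiable (at x)" for x
    using d by (auto simp only: differentiable_def)
  ultimately show ?case by simp
next
  case 0
  then have "continuous_on UNIV f" by simp
  from continuous_on_compose2[OF this, of UNIV "\<lambda>x. x + z"]
  show ?case by (simp add: continuous_on_add)
qed

text \<open>The functions \<open>p(1/t) exp(-1/t)\<close> for polynomials \<open>p\<close>, extended by zero, form a family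
  closed under differentiation.\<close>

definition flat :: "real poly \<Rightarrow> real \<Rightarrow> real" where
  "flat p t = (if t > 0 then poly p (1 / t) * exp (- (1 / t)) else 0)"

text \<open>The substitution x = 1 / t turns the claim into the decay of x^n exp (-x) at infinity,
  taken for each monomial of \<open>p\<close>.\<close>

lemma flat_tendsto_0: "((\<lambda>t. flat p t) \<longlongrightarrow> 0) (at_right 0)"
proof -
  have *: "((\<lambda>x::real. x ^ n * exp (- x)) \<longlongrightarrow> 0) at_top" for n :: nat
    using tendsto_power_div_exp_0[of n] by (simp add: exp_minus divide_inverse)
  have "((\<lambda>x. \<Sum>i\<le>degree p. coeff p i * (x ^ i * exp (- x))) \<longlongrightarrow> (\<Sum>i\<le>degree p. coeff p i * 0)) at_top"
    by (intro tendsto_intros *)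
  then have "((\<lambda>x. poly p x * exp (- x)) \<longlongrightarrow> 0) at_top"
    by (simp add: poly_altdef sum_distrib_right mult.assoc)
  from filterlim_compose[OF this filterlim_inverse_at_top_right]
  show ?thesis
    by (rule tendsto_cong[THEN iffD1, rotated])
       (auto simp: flat_def eventually_at_filter field_simps)
qed

text \<open>Differentiating p(1/t) exp (-1/t) produces the factor 1 / t^2 and the combination p -
  p'; in the variable 1/t the factor is the polynomial x^2, that is \<open>[:0,0,1:]\<close>. Away
  from 0 this is calculus on an open half line; only the point 0 needs a limit.\<close>

lemma DERIV_flat: "(flat p has_real_derivative flat ([:0,0,1:] * (p - pderiv p)) t) (at t)"
proof (cases "t > 0")
  case True
  have "((\<lambda>t. poly p (1 / t) * exp (- (1 / t))) has_real_derivative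
      flat ([:0,0,1:] * (p - pderiv p)) t) (at t)"
    using True
    by (auto intro!: derivative_eq_intros DERIV_chain'[of "\<lambda>t. 1 / t" _ t UNIV "poly p"] poly_DERIV
          simp: flat_def field_simps power2_eq_square)
  then show ?thesis
    by (rule has_field_derivative_transform_within_open[of _ _ _ "{0<..}"])
       (use True in \<open>auto simp: flat_def\<close>)
next
  case False
  show ?thesis
  proof (cases "t = 0")
    case True
    \<comment> \<open>Dividing by \<open>h\<close> multiplies the polynomial by its variable 1 / h,
      so the difference quotient at 0 is again a flat function, for
      \<open>[:0,1:] * p\<close>.\<close>
    have r: "((\<lambda>h. flat p h / h) \<longlongrightarrow> 0) (at_right 0)"
      using flat_tendsto_0[of "[:0,1:] * p"]
      by (rule tendsto_cong[THEN iffD1, rotated])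
         (auto simp: flat_def eventually_at_right field_simps intro!: exI[of _ 1])
    have "flat p h / h = 0" if "h < 0" for h
      using that by (simp add: flat_def)
    then have l: "((\<lambda>h. flat p h / h) \<longlongrightarrow> 0) (at_left 0)"
      by (intro tendsto_eventually) (auto simp: eventually_at_filter)
    have "((\<lambda>h. flat p h / h) \<longlongrightarrow> 0) (at 0)"
      using r l by (simp add: filterlim_split_at)
    then show ?thesis using True by (simp add: DERIV_def flat_def)
  next
    case F: False
    have "((\<lambda>t. 0) has_real_derivative flat ([:0,0,1:] * (p - pderiv p)) t) (at t)"
      using False by (simp add: flat_def)
    then show ?thesis
      by (rule has_field_derivative_transform_within_open[of _ _ _ "{..<0}"])
         (use F False in \<open>auto simp: flat_def\<close>)
  qed
qed

text \<open>The polynomial is generalised in the induction because every derivative replaces it by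
  another one.\<close>

lemma cont_diff_flat: "(\<And>m. cont_diff m f) \<Longrightarrow> cont_diff m (\<lambda>x. flat p (f x))"
proof (induction m arbitrary: p)
  case 0
  have "continuous_on UNIV (flat p)"
    using DERIV_flat[of p] by (meson DERIV_continuous_on UNIV_I has_field_derivative_at_within)
  then show ?case using 0[of 0] continuous_on_compose2[of UNIV "flat p" UNIV f] by simp
next
  case (Suc m)
  let ?q = "[:0,0,1:] * (p - pderiv p)"
  have "cont_diff (Suc 0) f" by fact
  then have d: "((\<lambda>x. flat p (f x)) has_derivative (\<lambda>h. flat ?q (f x) * (gradient f x \<bullet> h))) (at x)" for x
    using has_derivative_compose[OF has_derivative_gradient, of f x "flat p"]
      DERIV_flat[of p, unfolded has_field_derivative_def] by auto
  have "gradient (\<lambda>x. flat p (f x)) x $ i = flat ?q (f x) * gradient f x $ i" for x i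
    using gradient_eq[OF d] by (simp add: inner_axis)
  moreover have "cont_diff m (\<lambda>x. gradient f x $ i)" for i
    using Suc.prems[of "Suc m"] by simp
  moreover have "(\<lambda>x. flat p (f x)) differentiable (at x)" for x
    using d by (auto simp only: differentiable_def)
  ultimately show ?case using Suc by (simp add: cont_diff_mult)
qed

section \<open>Bump functions and test functions\<close>

text \<open>The classical profile exp (-1 / (r^2 - |x - a|^2)), cut off to 0 where the denominator
  is not positive. Differences are written as sums, with \<open>-1\<close> as a factor, so that the
  closure rules of \<open>cont_diff\<close> for constants, sums and products match directly.\<close>

definition bump :: "real^'d \<Rightarrow> real \<Rightarrow> real^'d \<Rightarrow> real" where
  "bump a r x = flat 1 (r\<^sup>2 + (-1) * (\<Sum>i\<in>UNIV. (x $ i + - a $ i) * (x $ i + - a $ i)))"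

lemma cont_diff_bump: "cont_diff m (bump a r)"
  unfolding bump_def[abs_def]
  by (intro cont_diff_flat cont_diff_add cont_diff_mult cont_diff_const cont_diff_sum cont_diff_component)

lemma bump_nonneg: "bump a r x \<ge> 0"
  by (simp add: bump_def flat_def)

lemma bump_pos_iff:
  assumes "r > 0"
  shows "bump a r x > 0 \<longleftrightarrow> x \<in> ball a r"
proof -
  have "(\<Sum>i\<in>UNIV. (x $ i + - a $ i) * (x $ i + - a $ i)) = (dist a x)\<^sup>2"
    by (simp add: dist_norm power2_norm_eq_inner inner_vec_def norm_minus_commute[of a x])
  moreover have "(dist a x)\<^sup>2 < r\<^sup>2 \<longleftrightarrow> dist a x < r"
    using assms power_mono_iff[of r "dist a x" 2] by (simp flip: not_le)
  ultimately show ?thesis by (auto simp: bump_def flat_def)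
qed

lemma test_functions_add_scale:
  assumes "\<phi> \<in> test_functions S" "\<psi> \<in> test_functions S"
  shows "(\<lambda>x. \<phi> x + c * \<psi> x) \<in> test_functions S"
proof -
  let ?A = "closure {x. \<phi> x \<noteq> 0}" and ?B = "closure {x. \<psi> x \<noteq> 0}"
  have "{x. \<phi> x + c * \<psi> x \<noteq> 0} \<subseteq> {x. \<phi> x \<noteq> 0} \<union> {x. \<psi> x \<noteq> 0}" by auto
  then have sub: "closure {x. \<phi> x + c * \<psi> x \<noteq> 0} \<subseteq> ?A \<union> ?B"
    using closure_mono[of "{x. \<phi> x + c * \<psi> x \<noteq> 0}" "{x. \<phi> x \<noteq> 0} \<union> {x. \<psi> x \<noteq> 0}"] by (simp add: closure_Un)
  have "compact (?A \<union> ?B)" using assms by (auto simp: test_functions_def)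
  then have "compact (closure {x. \<phi> x + c * \<psi> x \<noteq> 0})"
    using sub by (meson bounded_subset compact_eq_bounded_closed closed_closure)
  then show ?thesis using assms sub
    by (auto simp: test_functions_def intro!: cont_diff_add cont_diff_mult cont_diff_const)
qed

lemma test_functions_zero: "(\<lambda>x. 0) \<in> test_functions S"
  by (simp add: test_functions_def cont_diff_const)

lemma test_functions_mono: "S \<subseteq> T \<Longrightarrow> test_functions S \<subseteq> test_functions T"
  by (auto simp: test_functions_def)

lemma test_functions_zero_outside:
  assumes "\<phi> \<in> test_functions S" "x \<notin> S"
  shows "\<phi> x = 0"
  using assms closure_subset[of "{x. \<phi> x \<noteq> 0}"] by (auto simp: test_functions_def)

lemma gradient_zero_outside_support:
  assumes "x \<notin> closure {x. \<phi> x \<noteq> 0}"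
  shows "gradient \<phi> x = 0"
proof -
  have "(\<phi> has_derivative (\<lambda>h. 0)) (at x)"
    by (rule has_derivative_transform_within_open[OF has_derivative_const[of 0], of "- closure {x. \<phi> x \<noteq> 0}"])
       (use assms closure_subset[of "{x. \<phi> x \<noteq> 0}"] in auto)
  from gradient_eq[OF this] show ?thesis by (simp add: vec_eq_iff)
qed

lemma gradient_zero_outside:
  assumes "\<phi> \<in> test_functions S" "x \<notin> S"
  shows "gradient \<phi> x = 0"
  using assms by (auto simp: test_functions_def intro!: gradient_zero_outside_support)

lemma test_functions_continuous:
  assumes "\<phi> \<in> test_functions S"
  shows "continuous_on UNIV \<phi>" "\<phi> differentiable (at x)" "continuous_on UNIV (\<lambda>x. gradient \<phi> x $ i)"
    "continuous_on UNIV (gradient \<phi>)"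
proof -
  have c: "cont_diff (Suc 0) \<phi>" using assms unfolding test_functions_def by blast
  from cont_diff_continuous[OF this] show "continuous_on UNIV \<phi>" .
  from c show "\<phi> differentiable (at x)" "\<And>i. continuous_on UNIV (\<lambda>x. gradient \<phi> x $ i)" by auto
  then have "continuous_on UNIV (\<lambda>x. \<chi> i. gradient \<phi> x $ i)" by (intro continuous_on_vec_lambda)
  then show "continuous_on UNIV (gradient \<phi>)" by simp
qed

lemma gradient_test_add_scale:
  assumes "\<phi> \<in> test_functions S" "\<psi> \<in> test_functions S"
  shows "gradient (\<lambda>x. \<phi> x + c * \<psi> x) x = gradient \<phi> x + c *\<^sub>R gradient \<psi> x"
proof -
  have "((\<lambda>x. \<phi> x + c * \<psi> x) has_derivative (\<lambda>h. gradient \<phi> x \<bullet> h + c * (gradient \<psi> x \<bullet> h))) (at x)"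
    by (intro derivative_intros has_derivative_mult_right has_derivative_gradient test_functions_continuous[OF assms(1)]
        test_functions_continuous[OF assms(2)])
  from gradient_eq[OF this] show ?thesis by (simp add: vec_eq_iff inner_axis)
qed

lemma bounded_compact_support:
  fixes h :: "'a::metric_space \<Rightarrow> 'b::real_normed_vector"
  assumes "continuous_on UNIV h" "compact C" "\<And>x. x \<notin> C \<Longrightarrow> h x = 0"
  obtains M where "M > 0" "\<And>x. norm (h x) \<le> M"
proof -
  have "compact (h ` C)" using assms by (meson compact_continuous_image continuous_on_subset subset_UNIV)
  then obtain M where M: "M > 0" "\<forall>y\<in>h ` C. norm y \<le> M"
    using compact_imp_bounded[of "h ` C"] unfolding bounded_pos by blast
  have "norm (h x) \<le> M" for x using M assms(3)[of x] by (cases "x \<in> C") auto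
  with M(1) that show ?thesis by blast
qed

lemma test_functions_bounded:
  assumes "\<phi> \<in> test_functions S"
  obtains M where "M > 0" "\<And>x. \<bar>\<phi> x\<bar> \<le> M"
proof -
  have z: "\<phi> x = 0" if "x \<notin> closure {x. \<phi> x \<noteq> 0}" for x
    using that closure_subset[of "{x. \<phi> x \<noteq> 0}"] by auto
  have "compact (closure {x. \<phi> x \<noteq> 0})" using assms by (simp add: test_functions_def)
  from bounded_compact_support[OF test_functions_continuous(1)[OF assms] this z]
  obtain M where "M > 0" "\<And>x. norm (\<phi> x) \<le> M" by metis
  then show thesis using that[of M] by simp
qed

lemma test_functions_gradient_bounded:
  assumes "\<phi> \<in> test_functions S"
  obtains M where "M > 0" "\<And>x. norm (gradient \<phi> x) \<le> M"
proof -
  have "compact (closure {x. \<phi> x \<noteq> 0})" using assms by (simp add: test_functions_def)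
  from bounded_compact_support[OF test_functions_continuous(4)[OF assms] this gradient_zero_outside_support]
  show thesis using that by metis
qed

lemma test_functions_translate:
  assumes "\<phi> \<in> test_functions S"
  shows "(\<lambda>x. \<phi> (x + z)) \<in> test_functions ((\<lambda>x. x - z) ` S)"
proof -
  let ?C = "closure {x. \<phi> x \<noteq> 0}"
  have "{x. \<phi> (x + z) \<noteq> 0} = (\<lambda>x. x - z) ` {x. \<phi> x \<noteq> 0}"
  proof (intro set_eqI iffI)
    fix x assume "x \<in> {x. \<phi> (x + z) \<noteq> 0}"
    then show "x \<in> (\<lambda>x. x - z) ` {x. \<phi> x \<noteq> 0}" by (intro image_eqI[of _ _ "x + z"]) auto
  qed auto
  then have "closure {x. \<phi> (x + z) \<noteq> 0} = (\<lambda>x. x - z) ` ?C"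
    using closure_translation_subtract[of z "{x. \<phi> x \<noteq> 0}"] by simp
  then show ?thesis using assms compact_translation_subtract[of ?C z]
    unfolding test_functions_def by (simp only: mem_Collect_eq cont_diff_translate image_mono) blast
qed

lemma gradient_translate:
  assumes "\<phi> \<in> test_functions S"
  shows "gradient (\<lambda>x. \<phi> (x + z)) x = gradient \<phi> (x + z)"
proof -
  have "((\<lambda>x. \<phi> (x + z)) has_derivative (\<lambda>h. gradient \<phi> (x + z) \<bullet> h)) (at x)"
    by (intro has_derivative_compose[of "\<lambda>x. x + z" "\<lambda>h. h" x UNIV \<phi>] has_derivative_gradient
        test_functions_continuous[OF assms])
       (auto intro!: derivative_eq_intros)
  from gradient_eq[OF this] show ?thesis by (simp add: vec_eq_iff inner_axis)
qed

text \<open>With \<open>n \<rightarrow> \<infinity>\<close> these test functions converge to the indicator of the union of the balls.\<close>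

lemma test_function_balls:
  fixes S :: "(real^'d) set" and b :: "real^'d \<Rightarrow> real"
  assumes "finite F" and F: "\<And>a r. (a, r) \<in> F \<Longrightarrow> r > 0 \<and> cball a r \<subseteq> S"
    and b: "\<And>x. b x = (\<Sum>q\<in>F. bump (fst q) (snd q) x)"
  shows "(\<lambda>x. 1 + (-1) * exp ((- real n) * b x)) \<in> test_functions S"
    and "b x \<ge> 0" and "b x > 0 \<longleftrightarrow> x \<in> (\<Union>q\<in>F. ball (fst q) (snd q))"
proof -
  show nn: "b x \<ge> 0" for x unfolding b by (rule sum_nonneg) (rule bump_nonneg)
  show pos: "b x > 0 \<longleftrightarrow> x \<in> (\<Union>q\<in>F. ball (fst q) (snd q))" for x
  proof -
    have "b x = 0 \<longleftrightarrow> (\<forall>q\<in>F. bump (fst q) (snd q) x = 0)"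
      unfolding b using assms(1) by (rule sum_nonneg_eq_0_iff) (rule bump_nonneg)
    moreover have "bump (fst q) (snd q) x = 0 \<longleftrightarrow> x \<notin> ball (fst q) (snd q)" if "q \<in> F" for q
    proof -
      have "bump (fst q) (snd q) x = 0 \<longleftrightarrow> \<not> bump (fst q) (snd q) x > 0"
        using bump_nonneg[of "fst q" "snd q" x] by linarith
      then show ?thesis using bump_pos_iff[of "snd q" "fst q" x] F[of "fst q" "snd q"] that by simp
    qed
    ultimately have "b x = 0 \<longleftrightarrow> x \<notin> (\<Union>q\<in>F. ball (fst q) (snd q))" by simp
    then show ?thesis using nn[of x] by linarith
  qed
  let ?C = "\<Union>q\<in>F. cball (fst q) (snd q)"
  have C: "compact ?C" using assms(1) by (intro compact_UN) auto
  \<comment> \<open>Where \<open>b\<close> vanishes the exponential is 1 and the function is 0, so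
    for every \<open>n\<close> the support stays inside the union of the closed balls.\<close>
  have "b x > 0" if "1 + (-1) * exp ((- real n) * b x) \<noteq> 0" for x
    using nn[of x] that by (cases "b x = 0") auto
  then have "{x. 1 + (-1) * exp ((- real n) * b x) \<noteq> 0} \<subseteq> {x. b x > 0}" by blast
  also have "\<dots> \<subseteq> ?C" using pos ball_subset_cball by blast
  finally have sub: "closure {x. 1 + (-1) * exp ((- real n) * b x) \<noteq> 0} \<subseteq> ?C"
    by (rule closure_minimal) (use C compact_imp_closed in blast)
  have "compact (closure {x. 1 + (-1) * exp ((- real n) * b x) \<noteq> 0})"
    using sub C by (meson bounded_subset compact_eq_bounded_closed closed_closure)
  moreover have "?C \<subseteq> S" using F by fastforce
  moreover have "cont_diff m (\<lambda>x. 1 + (-1) * exp ((- real n) * b x))" for m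
    unfolding b
    by (intro cont_diff_add cont_diff_mult cont_diff_const cont_diff_exp cont_diff_sum cont_diff_bump)
  ultimately show "(\<lambda>x. 1 + (-1) * exp ((- real n) * b x)) \<in> test_functions S"
    using sub unfolding test_functions_def by blast
qed

section \<open>Positive semidefinite forms\<close>

text \<open>Functions that agree almost everywhere are not identified, so the forms at hand are
  definite at best modulo null sets; therefore only nonnegativity is asked for. Linearity is stated
  for the single combination u + c v, from which sums, differences and multiples follow.\<close>

locale semi_inner =
  fixes X :: "('a \<Rightarrow> real) set" and B :: "('a \<Rightarrow> real) \<Rightarrow> ('a \<Rightarrow> real) \<Rightarrow> real"
  assumes lin_closed: "u \<in> X \<Longrightarrow> v \<in> X \<Longrightarrow> (\<lambda>x. u x + c * v x) \<in> X"
    and sym: "u \<in> X \<Longrightarrow> v \<in> X \<Longrightarrow> B u v = B v u"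
    and lin: "u \<in> X \<Longrightarrow> v \<in> X \<Longrightarrow> w \<in> X \<Longrightarrow> B (\<lambda>x. u x + c * v x) w = B u w + c * B v w"
    and nonneg: "u \<in> X \<Longrightarrow> B u u \<ge> 0"
begin

lemma diff_closed: "u \<in> X \<Longrightarrow> v \<in> X \<Longrightarrow> (\<lambda>x. u x - v x) \<in> X"
  using lin_closed[of u v "-1"] by simp

lemma zero_closed: "u \<in> X \<Longrightarrow> (\<lambda>x. 0) \<in> X"
  using diff_closed[of u u] by simp

lemma scale_closed: "u \<in> X \<Longrightarrow> (\<lambda>x. c * u x) \<in> X"
  using lin_closed[OF zero_closed, of u u c] by simp

lemma lin_right:
  "u \<in> X \<Longrightarrow> v \<in> X \<Longrightarrow> w \<in> X \<Longrightarrow> B w (\<lambda>x. u x + c * v x) = B w u + c * B w v"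
  using lin[of u v w c] sym[OF lin_closed[of u v c], of w] sym[of u w] sym[of v w] by simp

lemma diff_left: "u \<in> X \<Longrightarrow> v \<in> X \<Longrightarrow> w \<in> X \<Longrightarrow> B (\<lambda>x. u x - v x) w = B u w - B v w"
  using lin[of u v w "-1"] by simp

lemma diff_right: "u \<in> X \<Longrightarrow> v \<in> X \<Longrightarrow> w \<in> X \<Longrightarrow> B w (\<lambda>x. u x - v x) = B w u - B w v"
  using lin_right[of u v w "-1"] by simp

lemma zero_left: "w \<in> X \<Longrightarrow> B (\<lambda>x. 0) w = 0"
  using diff_left[of w w w] by simp

lemma zero_right: "w \<in> X \<Longrightarrow> B w (\<lambda>x. 0) = 0"
  using diff_right[of w w w] by simp

lemma scale_left: "u \<in> X \<Longrightarrow> w \<in> X \<Longrightarrow> B (\<lambda>x. c * u x) w = c * B u w"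
  using lin[OF zero_closed, of u u w c] zero_left[of w] by simp

lemma sum_closed:
  assumes "u \<in> X" "\<And>i. i \<in> I \<Longrightarrow> v i \<in> X"
  shows "(\<lambda>x. \<Sum>i\<in>I. c i * v i x) \<in> X"
  using assms(2)
proof (induction I rule: infinite_finite_induct)
  case (insert j F)
  then have "(\<lambda>x. (\<Sum>i\<in>F. c i * v i x) + c j * v j x) \<in> X" by (intro lin_closed) auto
  then show ?case using insert by (simp add: add.commute)
qed (use zero_closed[OF assms(1)] in auto)

lemma sum_left:
  assumes "w \<in> X" "\<And>i. i \<in> I \<Longrightarrow> v i \<in> X"
  shows "B (\<lambda>x. \<Sum>i\<in>I. c i * v i x) w = (\<Sum>i\<in>I. c i * B (v i) w)"
  using assms(2)
proof (induction I rule: infinite_finite_induct)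
  case (insert j F)
  have "B (\<lambda>x. (\<Sum>i\<in>F. c i * v i x) + c j * v j x) w = B (\<lambda>x. \<Sum>i\<in>F. c i * v i x) w + c j * B (v j) w"
    using insert assms(1) by (intro lin sum_closed) auto
  then show ?case using insert by (simp add: add.commute)
qed (use zero_left[OF assms(1)] in auto)

lemma expand:
  assumes "u \<in> X" "v \<in> X"
  shows "B (\<lambda>x. u x + c * v x) (\<lambda>x. u x + c * v x) = B u u + 2 * c * B u v + c\<^sup>2 * B v v"
proof -
  have "B (\<lambda>x. u x + c * v x) (\<lambda>x. u x + c * v x) = B u (\<lambda>x. u x + c * v x) + c * B v (\<lambda>x. u x + c * v x)"
    using assms lin_closed[OF assms] by (intro lin) auto
  then show ?thesis using assms sym[of v u] by (simp add: lin_right algebra_simps power2_eq_square)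
qed

lemma expand_diff:
  assumes "u \<in> X" "v \<in> X"
  shows "B (\<lambda>x. u x - v x) (\<lambda>x. u x - v x) = B u u - 2 * B u v + B v v"
  using expand[OF assms, of "-1"] by simp

text \<open>The form may be degenerate, so the case B v v = 0 is treated apart: there B (u + c v) (u
  + c v) is affine in c and nonnegative, which forces B u v = 0. Otherwise the minimising c gives
  the inequality.\<close>

lemma cauchy_schwarz:
  assumes "u \<in> X" "v \<in> X"
  shows "(B u v)\<^sup>2 \<le> B u u * B v v"
proof (cases "B v v = 0")
  case True
  have "B u v = 0"
  proof (rule ccontr)
    assume n: "B u v \<noteq> 0"
    \<comment> \<open>With this \<open>c\<close> the affine expression takes the value -1.\<close>
    define c where "c = - (B u u + 1) / (2 * B u v)"
    have "0 \<le> B u u + 2 * c * B u v"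
      using expand[OF assms, of c] True nonneg[OF lin_closed[OF assms, of c]] by simp
    moreover have "2 * c * B u v = - (B u u + 1)" using n by (simp add: c_def)
    ultimately show False by linarith
  qed
  then show ?thesis using True by simp
next
  case False
  then have p: "B v v > 0" using nonneg[OF assms(2)] by simp
  have "0 \<le> B u u + 2 * (- B u v / B v v) * B u v + (- B u v / B v v)\<^sup>2 * B v v"
    using expand[OF assms, of "- B u v / B v v"] nonneg[OF lin_closed[OF assms], of "- B u v / B v v"] by metis
  also have "\<dots> = B u u - (B u v)\<^sup>2 / B v v" using p by (simp add: field_simps power2_eq_square)
  finally show ?thesis using p by (simp add: field_simps)
qed

lemma cauchy_schwarz_abs:
  assumes "u \<in> X" "v \<in> X"
  shows "\<bar>B u v\<bar> \<le> sqrt (B u u) * sqrt (B v v)"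
  using real_sqrt_le_mono[OF cauchy_schwarz[OF assms]] by (simp add: real_sqrt_mult)

lemma add_square_le:
  assumes "u \<in> X" "v \<in> X"
  shows "B (\<lambda>x. u x + v x) (\<lambda>x. u x + v x) \<le> 2 * B u u + 2 * B v v"
  using expand[OF assms, of 1] expand[OF assms, of "-1"] nonneg[OF lin_closed[OF assms], of "-1"] by simp

lemma triangle_square_le:
  assumes "u \<in> X" "v \<in> X" "w \<in> X"
  shows "B (\<lambda>x. u x - w x) (\<lambda>x. u x - w x) \<le>
    2 * B (\<lambda>x. u x - v x) (\<lambda>x. u x - v x) + 2 * B (\<lambda>x. v x - w x) (\<lambda>x. v x - w x)"
  using add_square_le[OF diff_closed[OF assms(1,2)] diff_closed[OF assms(2,3)]] by simp

lemma square_bound_of_close: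
  assumes "u \<in> X" "v \<in> X"
  shows "\<bar>sqrt (B u u) - sqrt (B v v)\<bar> \<le> sqrt (B (\<lambda>x. u x - v x) (\<lambda>x. u x - v x))"
proof (rule real_le_rsqrt)
  have "B u v \<le> sqrt (B u u) * sqrt (B v v)" using cauchy_schwarz_abs[OF assms] by linarith
  moreover have "(sqrt (B u u) - sqrt (B v v))\<^sup>2 = B u u - 2 * (sqrt (B u u) * sqrt (B v v)) + B v v"
    using nonneg assms by (simp add: power2_diff)
  ultimately show "\<bar>sqrt (B u u) - sqrt (B v v)\<bar>\<^sup>2 \<le> B (\<lambda>x. u x - v x) (\<lambda>x. u x - v x)"
    unfolding expand_diff[OF assms] by (simp add: power2_abs)
qed

lemma tendsto_square:
  assumes "\<And>n. u n \<in> X" "v \<in> X"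
    and "(\<lambda>n. B (\<lambda>x. u n x - v x) (\<lambda>x. u n x - v x)) \<longlonglongrightarrow> 0"
  shows "(\<lambda>n. B (u n) (u n)) \<longlonglongrightarrow> B v v"
proof -
  have "(\<lambda>n. sqrt (B (u n) (u n)) - sqrt (B v v)) \<longlonglongrightarrow> 0"
  proof (rule Lim_null_comparison)
    show "\<forall>\<^sub>F n in sequentially. norm (sqrt (B (u n) (u n)) - sqrt (B v v)) \<le> sqrt (B (\<lambda>x. u n x - v x) (\<lambda>x. u n x - v x))"
      using square_bound_of_close[OF assms(1,2)] by simp
    show "(\<lambda>n. sqrt (B (\<lambda>x. u n x - v x) (\<lambda>x. u n x - v x))) \<longlonglongrightarrow> 0"
      using tendsto_real_sqrt[OF assms(3)] by simp
  qed
  then have "(\<lambda>n. sqrt (B (u n) (u n))) \<longlonglongrightarrow> sqrt (B v v)" by (simp add: LIM_zero_iff)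
  from tendsto_power[OF this, of 2] show ?thesis using nonneg assms by simp
qed

lemma tendsto_left:
  assumes "\<And>n. u n \<in> X" "v \<in> X" "w \<in> X"
    and "(\<lambda>n. B (\<lambda>x. u n x - v x) (\<lambda>x. u n x - v x)) \<longlonglongrightarrow> 0"
  shows "(\<lambda>n. B (u n) w) \<longlonglongrightarrow> B v w"
proof -
  have "(\<lambda>n. B (u n) w - B v w) \<longlonglongrightarrow> 0"
  proof (rule Lim_null_comparison)
    have "\<bar>B (u n) w - B v w\<bar> \<le> sqrt (B (\<lambda>x. u n x - v x) (\<lambda>x. u n x - v x)) * sqrt (B w w)" for n
      using cauchy_schwarz_abs[OF diff_closed[OF assms(1,2)] assms(3)] diff_left[OF assms(1-3)] by simp
    then show "\<forall>\<^sub>F n in sequentially. norm (B (u n) w - B v w) \<le>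
        sqrt (B (\<lambda>x. u n x - v x) (\<lambda>x. u n x - v x)) * sqrt (B w w)" by simp
    show "(\<lambda>n. sqrt (B (\<lambda>x. u n x - v x) (\<lambda>x. u n x - v x)) * sqrt (B w w)) \<longlonglongrightarrow> 0"
      using tendsto_mult_left_zero[OF tendsto_real_sqrt[OF assms(4), simplified]] by simp
  qed
  then show ?thesis by (simp add: LIM_zero_iff)
qed

text \<open>A minimizing sequence of \<open>B w w - 2 l w\<close> is Cauchy by the parallelogram identity, and its limit
  represents \<open>l\<close>.\<close>

lemma riesz:
  assumes ne: "X \<noteq> {}"
    and complete: "\<And>u. (\<And>n. u n \<in> X) \<Longrightarrow>
      (\<And>e. e > 0 \<Longrightarrow> \<exists>N. \<forall>m\<ge>N. \<forall>n\<ge>N. B (\<lambda>x. u m x - u n x) (\<lambda>x. u m x - u n x) < e) \<Longrightarrow>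
      \<exists>v\<in>X. (\<lambda>n. B (\<lambda>x. u n x - v x) (\<lambda>x. u n x - v x)) \<longlonglongrightarrow> 0"
    and l_lin: "\<And>u v c. u \<in> X \<Longrightarrow> v \<in> X \<Longrightarrow> l (\<lambda>x. u x + c * v x) = l u + c * l v"
    and l_bdd: "\<And>u. u \<in> X \<Longrightarrow> (l u)\<^sup>2 \<le> C * B u u"
  shows "\<exists>g\<in>X. \<forall>w\<in>X. B g w = l w"
proof -
  define Q where "Q = (\<lambda>w. B w w - 2 * l w)"
  \<comment> \<open>By the arithmetic-geometric mean inequality the bound on \<open>l\<close> gives
    2 |l w| \<le> |C| + B w w, so the quadratic part absorbs the linear one up to a
    constant.\<close>
  have lb: "Q w \<ge> - \<bar>C\<bar>" if "w \<in> X" for w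
  proof -
    have "(l w)\<^sup>2 \<le> \<bar>C\<bar> * B w w"
      using l_bdd[OF that] mult_right_mono[of C "\<bar>C\<bar>" "B w w"] nonneg[OF that] by linarith
    also have "\<dots> \<le> ((\<bar>C\<bar> + B w w) / 2)\<^sup>2"
      using sum_squares_bound[of "\<bar>C\<bar>" "B w w"] by (simp add: power2_eq_square field_simps)
    finally have "\<bar>l w\<bar> \<le> (\<bar>C\<bar> + B w w) / 2"
      using abs_le_square_iff[of "l w" "(\<bar>C\<bar> + B w w) / 2"] nonneg[OF that] by simp
    then show ?thesis by (simp add: Q_def abs_le_iff)
  qed
  define m where "m = (INF w\<in>X. Q w)"
  have bb: "bdd_below (Q ` X)" using lb by (auto simp: bdd_below_def)
  have mle: "m \<le> Q w" if "w \<in> X" for w unfolding m_def by (rule cINF_lower[OF bb that])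
  have "\<exists>w\<in>X. Q w < m + e" if "e > 0" for e
    using cINF_less_iff[OF ne bb, of "m + e"] that by (simp add: m_def)
  then have "\<forall>n. \<exists>w\<in>X. Q w < m + 1 / real (Suc n)" by simp
  then obtain u where u: "\<And>n. u n \<in> X" "\<And>n. Q (u n) < m + 1 / real (Suc n)" by metis
  \<comment> \<open>With the midpoint \<open>h\<close> the parallelogram identity reads B (u i - u
    j) (u i - u j) = 2 Q (u i) + 2 Q (u j) - 4 Q h, because the linear parts cancel. Since Q h is at
    least the infimum \<open>m\<close>, only the excesses of the two values over \<open>m\<close>
    remain.\<close>
  have close: "B (\<lambda>x. u i x - u j x) (\<lambda>x. u i x - u j x) \<le> 2 / real (Suc i) + 2 / real (Suc j)" for i j
  proof -
    define h where "h = (\<lambda>x. (1/2) * u i x + (1/2) * u j x)"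
    have h: "h \<in> X" unfolding h_def by (intro lin_closed scale_closed u)
    have lz: "l (\<lambda>x. 0) = 0" using l_lin[OF u(1) u(1), of 0 "-1" 0] by simp
    have "l (\<lambda>x. (1/2) * u i x) = (1/2) * l (u i)"
      using l_lin[OF zero_closed[OF u(1)] u(1), of "1/2" i] lz by simp
    then have lh: "l h = l (u i) / 2 + l (u j) / 2"
      using l_lin[OF scale_closed[OF u(1)] u(1), of "1/2" i "1/2" j] by (simp add: h_def)
    have "B h h = (1/2) * B (u i) h + (1/2) * B (u j) h"
      using lin[OF scale_closed[OF u(1)] u(1) h, of "1/2" i "1/2" j] scale_left[OF u(1) h, of "1/2" i] by (simp add: h_def)
    moreover have "B w h = (1/2) * B w (u i) + (1/2) * B w (u j)" if "w \<in> X" for w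
      using lin_right[OF scale_closed[OF u(1)] u(1) that, of "1/2" i "1/2" j] scale_left[OF u(1) that, of "1/2" i]
        sym[OF that scale_closed[OF u(1)], of "1/2" i] sym[OF that u(1), of i] by (simp add: h_def)
    note this[OF u(1)[of i]] this[OF u(1)[of j]]
    ultimately have "B h h = (B (u i) (u i) + 2 * B (u i) (u j) + B (u j) (u j)) / 4"
      unfolding sym[OF u(1) u(1), of j i] by (simp only:) (simp add: field_simps)
    moreover have "m \<le> Q h" by (rule mle[OF h])
    ultimately have f: "4 * B h h = B (u i) (u i) + 2 * B (u i) (u j) + B (u j) (u j)"
      "m \<le> B h h - (l (u i) + l (u j))"
      unfolding Q_def lh by simp_all
    have key: "bii - 2 * bij + bjj \<le> 2 * p + 2 * q"
      if "4 * bhh = bii + 2 * bij + bjj" "m \<le> bhh - (li + lj)"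
        "bii - 2 * li < m + p" "bjj - 2 * lj < m + q" for bhh bii bij bjj li lj p q :: real
      using that by argo
    from key[OF f u(2)[of i, unfolded Q_def] u(2)[of j, unfolded Q_def]]
    show ?thesis unfolding expand_diff[OF u(1) u(1)] by simp
  qed
  have "\<exists>v\<in>X. (\<lambda>n. B (\<lambda>x. u n x - v x) (\<lambda>x. u n x - v x)) \<longlonglongrightarrow> 0"
  proof (rule complete[OF u(1)])
    fix e :: real assume "e > 0"
    then obtain N where N: "4 / e < real N" using reals_Archimedean2 by blast
    have "B (\<lambda>x. u i x - u j x) (\<lambda>x. u i x - u j x) < e" if "i \<ge> N" "j \<ge> N" for i j
    proof -
      have a: "2 / real (Suc k) < e / 2" if "k \<ge> N" for k
      proof -
        have "4 / e < real (Suc k)" using N that by linarith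
        then show ?thesis using \<open>e > 0\<close> by (simp add: field_simps)
      qed
      from close[of i j] a[OF that(1)] a[OF that(2)] show ?thesis by linarith
    qed
    then show "\<exists>N. \<forall>m\<ge>N. \<forall>n\<ge>N. B (\<lambda>x. u m x - u n x) (\<lambda>x. u m x - u n x) < e" by blast
  qed
  then obtain g where g: "g \<in> X" "(\<lambda>n. B (\<lambda>x. u n x - g x) (\<lambda>x. u n x - g x)) \<longlonglongrightarrow> 0" by blast
  have ld: "l (\<lambda>x. u n x - g x) = l (u n) - l g" for n
    using l_lin[OF u(1) g(1), of n "-1"] by simp
  have "(\<lambda>n. l (u n) - l g) \<longlonglongrightarrow> 0"
  proof (rule Lim_null_comparison)
    have "\<bar>l (u n) - l g\<bar> \<le> sqrt (C * B (\<lambda>x. u n x - g x) (\<lambda>x. u n x - g x))" for n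
      using real_sqrt_le_mono[OF l_bdd[OF diff_closed[OF u(1) g(1)], of n]] ld[of n] by simp
    then show "\<forall>\<^sub>F n in sequentially. norm (l (u n) - l g) \<le> sqrt (C * B (\<lambda>x. u n x - g x) (\<lambda>x. u n x - g x))"
      by simp
    show "(\<lambda>n. sqrt (C * B (\<lambda>x. u n x - g x) (\<lambda>x. u n x - g x))) \<longlonglongrightarrow> 0"
      using tendsto_real_sqrt[OF tendsto_mult_right_zero[OF g(2), of C]] by simp
  qed
  then have "(\<lambda>n. l (u n)) \<longlonglongrightarrow> l g" by (simp add: LIM_zero_iff)
  then have lim: "(\<lambda>n. Q (u n)) \<longlonglongrightarrow> Q g"
    unfolding Q_def by (intro tendsto_intros tendsto_square[OF u(1) g])
  have "Q g \<le> m"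
  proof (rule LIMSEQ_le[OF lim])
    show "(\<lambda>n. m + 1 / real (Suc n)) \<longlonglongrightarrow> m"
      using tendsto_add[OF tendsto_const LIMSEQ_Suc[OF lim_1_over_n], of m] by simp
  qed (use u(2) less_imp_le in blast)
  then have min: "Q g \<le> Q w" if "w \<in> X" for w using mle[OF that] by linarith
  have "B g w = l w" if w: "w \<in> X" for w
  proof -
    have t: "0 \<le> 2 * t * (B g w - l w) + t\<^sup>2 * B w w" for t
      using min[OF lin_closed[OF g(1) w, of t]] expand[OF g(1) w, of t] l_lin[OF g(1) w, of t]
      by (simp add: Q_def algebra_simps)
    define d where "d = B g w - l w"
    have "d = 0"
    proof (rule ccontr)
      assume "d \<noteq> 0"
      \<comment> \<open>A step t = a of size |d| / (B w w + 1) is so short that the linear term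
        outweighs the quadratic one; the added 1 covers the degenerate case B w w = 0.\<close>
      define c where "c = B w w + 1"
      define a where "a = - d / c"
      have p: "c > 0" "B w w - 2 * c < 0" using nonneg[OF w] by (auto simp: c_def)
      then have "d = - (a * c)" "a \<noteq> 0" using \<open>d \<noteq> 0\<close> by (auto simp: a_def)
      then have "2 * a * d + a\<^sup>2 * B w w = a\<^sup>2 * (B w w - 2 * c)"
        by (simp add: algebra_simps power2_eq_square)
      also have "\<dots> < 0" using p \<open>a \<noteq> 0\<close> by (intro mult_pos_neg) auto
      finally show False using t[of a] unfolding d_def by linarith
    qed
    then show ?thesis unfolding d_def by simp
  qed
  then show ?thesis using g(1) by blast
qed

end

section \<open>Square integrable functions\<close>

abbreviation sq_int :: "(real^'d) set \<Rightarrow> (real^'d \<Rightarrow> real) \<Rightarrow> real" where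
  "sq_int S v \<equiv> (LINT x|lebesgue_on S. (v x)\<^sup>2)"

lemma L2_integrable_mult_weight:
  assumes "u \<in> L2 S" "v \<in> L2 S" "\<rho> \<in> borel_measurable (lebesgue_on S)"
    "AE x in lebesgue_on S. \<bar>\<rho> x\<bar> \<le> M"
  shows "integrable (lebesgue_on S) (\<lambda>x. \<rho> x * u x * v x)"
proof (rule Bochner_Integration.integrable_bound)
  show "integrable (lebesgue_on S) (\<lambda>x. M * ((u x)\<^sup>2 + (v x)\<^sup>2))"
    using assms by (auto simp: L2_def)
  show "(\<lambda>x. \<rho> x * u x * v x) \<in> borel_measurable (lebesgue_on S)"
    using assms by (auto simp: L2_def)
  show "AE x in lebesgue_on S. norm (\<rho> x * u x * v x) \<le> norm (M * ((u x)\<^sup>2 + (v x)\<^sup>2))"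
    using assms(4)
  proof eventually_elim
    case (elim x)
    have "\<bar>u x * v x\<bar> \<le> (u x)\<^sup>2 + (v x)\<^sup>2"
    proof -
      have "2 * (\<bar>u x\<bar> * \<bar>v x\<bar>) \<le> (u x)\<^sup>2 + (v x)\<^sup>2"
        using sum_squares_bound[of "\<bar>u x\<bar>" "\<bar>v x\<bar>"] by simp
      moreover have "0 \<le> \<bar>u x\<bar> * \<bar>v x\<bar>" by simp
      ultimately show ?thesis unfolding abs_mult by linarith
    qed
    then have "\<bar>\<rho> x\<bar> * \<bar>u x * v x\<bar> \<le> M * ((u x)\<^sup>2 + (v x)\<^sup>2)"
      using elim by (intro mult_mono) auto
    moreover have "\<dots> \<le> \<bar>M * ((u x)\<^sup>2 + (v x)\<^sup>2)\<bar>" by simp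
    ultimately show ?case by (simp add: abs_mult mult.assoc)
  qed
qed

lemma L2_integrable_mult:
  assumes "u \<in> L2 S" "v \<in> L2 S"
  shows "integrable (lebesgue_on S) (\<lambda>x. u x * v x)"
  using L2_integrable_mult_weight[OF assms, of "\<lambda>_. 1" 1] by simp

lemma L2_lin:
  assumes "u \<in> L2 S" "v \<in> L2 S"
  shows "(\<lambda>x. u x + c * v x) \<in> L2 S"
proof -
  have "integrable (lebesgue_on S) (\<lambda>x. (u x)\<^sup>2 + 2 * c * (u x * v x) + c\<^sup>2 * (v x)\<^sup>2)"
    using assms L2_integrable_mult[OF assms] by (auto simp: L2_def)
  moreover have "(\<lambda>x. (u x + c * v x)\<^sup>2) = (\<lambda>x. (u x)\<^sup>2 + 2 * c * (u x * v x) + c\<^sup>2 * (v x)\<^sup>2)"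
    by (auto simp: power2_sum power_mult_distrib algebra_simps)
  ultimately show ?thesis using assms by (auto simp: L2_def)
qed

lemma mass_form_semi_inner:
  assumes "\<rho> \<in> borel_measurable (lebesgue_on S)" "AE x in lebesgue_on S. 0 \<le> \<rho> x \<and> \<rho> x \<le> M"
  shows "semi_inner (L2 S) (mass_form \<rho> S)"
proof -
  have b: "AE x in lebesgue_on S. \<bar>\<rho> x\<bar> \<le> M" using assms(2) by eventually_elim auto
  note int = L2_integrable_mult_weight[OF _ _ assms(1) b]
  show ?thesis
  proof
    fix u v :: "real^'a \<Rightarrow> real" and c
    assume "u \<in> L2 S" "v \<in> L2 S"
    then show "(\<lambda>x. u x + c * v x) \<in> L2 S" by (rule L2_lin)
  next
    fix u v :: "real^'a \<Rightarrow> real" assume "u \<in> L2 S" "v \<in> L2 S"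
    show "mass_form \<rho> S u v = mass_form \<rho> S v u" by (simp add: mass_form_def ac_simps)
  next
    fix u v w :: "real^'a \<Rightarrow> real" and c assume "u \<in> L2 S" "v \<in> L2 S" "w \<in> L2 S"
    then have "(LINT x|lebesgue_on S. \<rho> x * u x * w x + c * (\<rho> x * v x * w x)) =
        mass_form \<rho> S u w + c * mass_form \<rho> S v w"
      unfolding mass_form_def by (subst Bochner_Integration.integral_add) (auto intro: int)
    then show "mass_form \<rho> S (\<lambda>x. u x + c * v x) w = mass_form \<rho> S u w + c * mass_form \<rho> S v w"
      by (simp add: mass_form_def algebra_simps)
  next
    fix u :: "real^'a \<Rightarrow> real" assume "u \<in> L2 S"
    show "mass_form \<rho> S u u \<ge> 0" unfolding mass_form_def
    proof (rule integral_nonneg_AE)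
      show "AE x in lebesgue_on S. 0 \<le> \<rho> x * u x * u x"
        using assms(2) by eventually_elim (simp add: mult.assoc)
    qed
  qed
qed

interpretation l2: semi_inner "L2 S" "\<lambda>u v. LINT x|lebesgue_on S. u x * v x" for S
  using mass_form_semi_inner[of "\<lambda>_. 1" S 1] by (simp add: mass_form_def[abs_def])

lemmas L2_diff = l2.diff_closed

lemma sq_int_eq: "(LINT x|lebesgue_on S. u x * u x) = sq_int S u"
  by (simp add: power2_eq_square)

lemma L2_abs_integral_le:
  assumes "u \<in> L2 S" "v \<in> L2 S"
  shows "\<bar>LINT x|lebesgue_on S. u x * v x\<bar> \<le> sqrt (sq_int S u) * sqrt (sq_int S v)"
  using l2.cauchy_schwarz_abs[OF assms] by (simp add: sq_int_eq)

lemma L2_triangle_square_le: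
  assumes "u \<in> L2 S" "v \<in> L2 S" "w \<in> L2 S"
  shows "sq_int S (\<lambda>x. u x - w x) \<le> 2 * sq_int S (\<lambda>x. u x - v x) + 2 * sq_int S (\<lambda>x. v x - w x)"
  using l2.triangle_square_le[OF assms] by (simp add: sq_int_eq)

lemma L2_sum: "finite I \<Longrightarrow> (\<And>i. i \<in> I \<Longrightarrow> v i \<in> L2 S) \<Longrightarrow> (\<lambda>x. \<Sum>i\<in>I. v i x) \<in> L2 S"
  using l2.sum_closed[of "\<lambda>x. 0" S I v "\<lambda>_. 1"] by (simp add: L2_def)

lemma L2_zero: "(\<lambda>x. 0) \<in> L2 S"
  by (simp add: L2_def)

lemma L2_bounded:
  assumes "S \<in> lmeasurable" "v \<in> borel_measurable (lebesgue_on S)" and b: "\<And>x. x \<in> S \<Longrightarrow> \<bar>v x\<bar> \<le> M"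
  shows "v \<in> L2 S"
proof -
  interpret finite_measure "lebesgue_on S" using assms(1) by (rule finite_measure_lebesgue_on)
  have "integrable (lebesgue_on S) (\<lambda>x. (v x)\<^sup>2)"
  proof (rule integrable_const_bound[of _ "M\<^sup>2"])
    show "AE x in lebesgue_on S. norm ((v x)\<^sup>2) \<le> M\<^sup>2"
    proof (rule AE_I2)
      fix x assume "x \<in> space (lebesgue_on S)"
      then have "\<bar>v x\<bar> \<le> M" using b by simp
      then show "norm ((v x)\<^sup>2) \<le> M\<^sup>2" using power_mono[of "\<bar>v x\<bar>" M 2] by simp
    qed
  qed (use assms(2) in auto)
  then show ?thesis using assms(2) by (simp add: L2_def)
qed

lemma L2_integrable:
  assumes "S \<in> lmeasurable" "v \<in> L2 S"
  shows "integrable (lebesgue_on S) v"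
  using L2_integrable_mult[OF assms(2) L2_bounded[OF assms(1), of "\<lambda>_. 1" 1]] by simp

lemma AE_lebesgue_on_iff_negligible:
  assumes "S \<in> sets lebesgue"
  shows "(AE x in lebesgue_on S. P x) \<longleftrightarrow> negligible {x\<in>S. \<not> P x}"
proof -
  have "(AE x in lebesgue_on S. P x) \<longleftrightarrow> (AE x in lebesgue. x \<in> S \<longrightarrow> P x)"
    using assms by (simp add: AE_restrict_space_iff)
  also have "\<dots> \<longleftrightarrow> (\<exists>N\<in>null_sets lebesgue. {x\<in>S. \<not> P x} \<subseteq> N)"
    by (simp add: eventually_ae_filter)
  also have "\<dots> \<longleftrightarrow> negligible {x\<in>S. \<not> P x}"
    by (meson negligible_iff_null_sets negligible_subset order_refl)
  finally show ?thesis .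
qed

text \<open>Lebesgue measure is complete: a preimage under \<open>v\<close> differs from the one
  under \<open>u\<close> only inside a null set, all of whose subsets are measurable.\<close>

lemma borel_measurable_lebesgue_on_AE_eq:
  fixes u v :: "'a::euclidean_space \<Rightarrow> 'b::topological_space"
  assumes S: "S \<in> sets lebesgue" and eq: "AE x in lebesgue_on S. u x = v x"
    and u: "u \<in> borel_measurable (lebesgue_on S)"
  shows "v \<in> borel_measurable (lebesgue_on S)"
proof (rule measurableI)
  fix A :: "'b set" assume A: "A \<in> sets borel"
  let ?N = "{x\<in>S. u x \<noteq> v x}"
  have N: "negligible ?N" using eq AE_lebesgue_on_iff_negligible[OF S] by simp
  have "u -` A \<inter> S \<in> sets lebesgue"
    using measurable_sets[OF u A] S by (simp add: sets_restrict_space_iff)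
  moreover have "?N \<in> sets lebesgue" "v -` A \<inter> ?N \<in> sets lebesgue"
    using negligible_imp_sets[OF N] negligible_imp_sets[OF negligible_subset[OF N, of "v -` A \<inter> ?N"]] by auto
  ultimately have "(u -` A \<inter> S - ?N) \<union> (v -` A \<inter> ?N) \<in> sets lebesgue" by blast
  moreover have "(u -` A \<inter> S - ?N) \<union> (v -` A \<inter> ?N) = v -` A \<inter> S" by auto
  ultimately show "v -` A \<inter> space (lebesgue_on S) \<in> sets (lebesgue_on S)"
    using S by (simp add: sets_restrict_space_iff)
qed auto

lemma L2_AE_eq:
  assumes "S \<in> sets lebesgue" "AE x in lebesgue_on S. u x = v x" "u \<in> L2 S"
  shows "v \<in> L2 S"
proof -
  have m: "v \<in> borel_measurable (lebesgue_on S)"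
    using borel_measurable_lebesgue_on_AE_eq[OF assms(1,2)] assms(3) by (simp add: L2_def)
  have "integrable (lebesgue_on S) (\<lambda>x. (v x)\<^sup>2)"
  proof (rule integrable_cong_AE_imp)
    show "integrable (lebesgue_on S) (\<lambda>x. (u x)\<^sup>2)" using assms by (simp add: L2_def)
    show "AE x in lebesgue_on S. (u x)\<^sup>2 = (v x)\<^sup>2" using assms(2) by eventually_elim simp
  qed (use m in auto)
  with m show ?thesis by (simp add: L2_def)
qed

lemma sq_int_zero_iff:
  assumes "v \<in> L2 S"
  shows "sq_int S v = 0 \<longleftrightarrow> (AE x in lebesgue_on S. v x = 0)"
  using assms integral_nonneg_eq_0_iff_AE[of "lebesgue_on S" "\<lambda>x. (v x)\<^sup>2"] by (simp add: L2_def)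

lemma sq_int_nonneg: "sq_int S v \<ge> 0"
  by simp

text \<open>On a set of finite measure a Cauchy sequence in the square mean is Cauchy in the mean,
  so a subsequence converges almost everywhere. Fatou's lemma then shows that its pointwise limit is
  the square mean limit of the whole sequence.\<close>

lemma L2_complete:
  fixes f :: "nat \<Rightarrow> real^'d \<Rightarrow> real"
  assumes S: "S \<in> lmeasurable" and f: "\<And>n. f n \<in> L2 S"
    and cauchy: "\<And>e. e > 0 \<Longrightarrow> \<exists>N. \<forall>m\<ge>N. \<forall>n\<ge>N. sq_int S (\<lambda>x. f m x - f n x) < e"
  shows "\<exists>h\<in>L2 S. (\<lambda>n. sq_int S (\<lambda>x. f n x - h x)) \<longlonglongrightarrow> 0"
proof -
  let ?M = "lebesgue_on S"
  interpret finite_measure ?M using S by (rule finite_measure_lebesgue_on)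
  have [measurable]: "f n \<in> borel_measurable ?M" for n using f by (simp add: L2_def)
  have one: "(\<lambda>_. 1) \<in> L2 S" by (rule L2_bounded[OF S, of _ 1]) auto
  \<comment> \<open>The square root alone is the Cauchy-Schwarz factor between the two norms; the
    added 1 keeps \<open>c\<close> positive when \<open>S\<close> is a null set.\<close>
  define c where "c = sqrt (sq_int S (\<lambda>_. 1)) + 1"
  have c: "c > 0" by (auto simp: c_def intro!: add_nonneg_pos)
  have L1: "\<exists>N. \<forall>i\<ge>N. \<forall>j\<ge>N. LINT x|?M. norm (f i x - f j x) < e" if "e > 0" for e
  proof -
    obtain N where N: "\<And>m n. m \<ge> N \<Longrightarrow> n \<ge> N \<Longrightarrow> sq_int S (\<lambda>x. f m x - f n x) < (e / c)\<^sup>2"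
      using cauchy[of "(e / c)\<^sup>2"] \<open>e > 0\<close> c by auto
    have "LINT x|?M. norm (f i x - f j x) < e" if "i \<ge> N" "j \<ge> N" for i j
    proof -
      have a: "(\<lambda>x. \<bar>f i x - f j x\<bar>) \<in> L2 S" using L2_diff[OF f f, of i j] by (auto simp: L2_def)
      have "(LINT x|?M. \<bar>f i x - f j x\<bar> * 1) \<le> sqrt (sq_int S (\<lambda>x. \<bar>f i x - f j x\<bar>)) * sqrt (sq_int S (\<lambda>_. 1))"
        using L2_abs_integral_le[OF a one] by linarith
      also have "\<dots> \<le> sqrt (sq_int S (\<lambda>x. \<bar>f i x - f j x\<bar>)) * c"
        unfolding c_def by (intro mult_left_mono) auto
      also have "\<dots> < (e / c) * c"
        using N[OF that] c \<open>e > 0\<close> by (intro mult_strict_right_mono real_less_lsqrt) auto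
      finally show ?thesis using c by simp
    qed
    then show ?thesis by blast
  qed
  obtain r where r: "strict_mono r" "AE x in ?M. Cauchy (\<lambda>i. f (r i) x)"
    using cauchy_L1_AE_cauchy_subseq[OF L2_integrable[OF S f] L1] by blast
  define h where "h = (\<lambda>x. lim (\<lambda>i. f (r i) x))"
  have h[measurable]: "h \<in> borel_measurable ?M" unfolding h_def by measurable
  have lim: "AE x in ?M. (\<lambda>i. f (r i) x) \<longlonglongrightarrow> h x"
    using r(2) by eventually_elim (simp add: h_def Cauchy_convergent_iff convergent_LIMSEQ_iff)
  \<comment> \<open>Fatou along the subsequence: a Cauchy bound for \<open>f n\<close> against late
    members passes to the limit \<open>h\<close>. It yields integrability and the estimate at once,
    so membership of \<open>h\<close> need not be known beforehand.\<close>
  have est: "integrable ?M (\<lambda>x. (f n x - h x)\<^sup>2) \<and> sq_int S (\<lambda>x. f n x - h x) \<le> e"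
    if e: "e > 0" and N: "\<And>m. m \<ge> N \<Longrightarrow> sq_int S (\<lambda>x. f n x - f m x) < e" for e n N
  proof -
    have "(\<integral>\<^sup>+x. ennreal ((f n x - h x)\<^sup>2) \<partial>?M) = (\<integral>\<^sup>+x. liminf (\<lambda>i. ennreal ((f n x - f (r i) x)\<^sup>2)) \<partial>?M)"
    proof (rule nn_integral_cong_AE, use lim in eventually_elim)
      case (elim x)
      then have "(\<lambda>i. ennreal ((f n x - f (r i) x)\<^sup>2)) \<longlonglongrightarrow> ennreal ((f n x - h x)\<^sup>2)"
        by (intro tendsto_ennrealI tendsto_intros)
      then show ?case by (simp add: lim_imp_Liminf[symmetric])
    qed
    also have "\<dots> \<le> liminf (\<lambda>i. \<integral>\<^sup>+x. ennreal ((f n x - f (r i) x)\<^sup>2) \<partial>?M)"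
      by (rule nn_integral_liminf) measurable
    also have "\<dots> \<le> ennreal e"
    proof (rule Liminf_le)
      have "(\<integral>\<^sup>+x. ennreal ((f n x - f (r i) x)\<^sup>2) \<partial>?M) \<le> ennreal e" if "i \<ge> N" for i
      proof -
        have "r i \<ge> N" using seq_suble[OF r(1), of i] that by linarith
        have "(\<integral>\<^sup>+x. ennreal ((f n x - f (r i) x)\<^sup>2) \<partial>?M) = ennreal (sq_int S (\<lambda>x. f n x - f (r i) x))"
          using L2_diff[OF f f, of n "r i"] by (intro nn_integral_eq_integral) (auto simp: L2_def)
        also have "\<dots> \<le> ennreal e" using N[OF \<open>r i \<ge> N\<close>] by (intro ennreal_leI) simp
        finally show ?thesis .
      qed
      then show "\<forall>\<^sub>F i in sequentially. (\<integral>\<^sup>+x. ennreal ((f n x - f (r i) x)\<^sup>2) \<partial>?M) \<le> ennreal e"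
        by (auto simp: eventually_sequentially)
    qed simp
    finally have *: "(\<integral>\<^sup>+x. ennreal ((f n x - h x)\<^sup>2) \<partial>?M) \<le> ennreal e" .
    have i: "integrable ?M (\<lambda>x. (f n x - h x)\<^sup>2)"
      using * by (intro integrableI_bounded) (auto simp: le_less_trans[OF _ ennreal_less_top])
    moreover have "ennreal (sq_int S (\<lambda>x. f n x - h x)) \<le> ennreal e"
      using * nn_integral_eq_integral[OF i] by simp
    ultimately show ?thesis using e by simp
  qed
  obtain N1 where N1: "\<And>m n. m \<ge> N1 \<Longrightarrow> n \<ge> N1 \<Longrightarrow> sq_int S (\<lambda>x. f m x - f n x) < 1"
    using cauchy[of 1] by auto
  have "integrable ?M (\<lambda>x. (f N1 x - h x)\<^sup>2)"
    using est[of 1 N1 N1] N1 by simp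
  then have "(\<lambda>x. f N1 x - h x) \<in> L2 S" by (simp add: L2_def)
  from L2_diff[OF f[of N1] this] have hL: "h \<in> L2 S" by simp
  have "(\<lambda>n. sq_int S (\<lambda>x. f n x - h x)) \<longlonglongrightarrow> 0"
  proof (rule LIMSEQ_I)
    fix e :: real assume "e > 0"
    then obtain N where N: "\<And>m n. m \<ge> N \<Longrightarrow> n \<ge> N \<Longrightarrow> sq_int S (\<lambda>x. f m x - f n x) < e / 2"
      using cauchy[of "e / 2"] by auto
    have "sq_int S (\<lambda>x. f n x - h x) < e" if "n \<ge> N" for n
      using est[of "e / 2" N n] N[OF that] \<open>e > 0\<close> by simp
    then show "\<exists>N. \<forall>n\<ge>N. norm (sq_int S (\<lambda>x. f n x - h x) - 0) < e" by auto
  qed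
  with hL show ?thesis by blast
qed

section \<open>Density of the test functions\<close>

lemma continuous_L2:
  assumes "S \<in> lmeasurable" "continuous_on UNIV v" "\<And>x. \<bar>v x\<bar> \<le> M"
  shows "v \<in> L2 S"
proof (rule L2_bounded[OF assms(1), of _ M])
  have "v \<in> borel_measurable lebesgue"
    using borel_measurable_continuous_onI[OF assms(2)] by (simp add: measurable_completion)
  then show "v \<in> borel_measurable (lebesgue_on S)" by (rule measurable_restrict_space1)
qed (use assms in auto)

lemma test_function_L2:
  assumes "S \<in> lmeasurable" "\<phi> \<in> test_functions T"
  shows "\<phi> \<in> L2 S"
  using test_functions_bounded[OF assms(2)] continuous_L2[OF assms(1) test_functions_continuous(1)[OF assms(2)]]
  by metis

lemma test_gradient_L2:
  assumes "S \<in> lmeasurable" "\<phi> \<in> test_functions T"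
  shows "(\<lambda>x. gradient \<phi> x $ i) \<in> L2 S"
proof -
  obtain M where M: "\<And>x. norm (gradient \<phi> x) \<le> M" using test_functions_gradient_bounded[OF assms(2)] by metis
  have "\<bar>gradient \<phi> x $ i\<bar> \<le> M" for x using component_le_norm_cart[of "gradient \<phi> x" i] M[of x] by linarith
  then show ?thesis by (rule continuous_L2[OF assms(1) test_functions_continuous(3)[OF assms(2)]])
qed

definition approximable :: "(real^'d) set \<Rightarrow> (real^'d \<Rightarrow> real) set" where
  "approximable S = {h \<in> L2 S. \<forall>e>0. \<exists>\<psi>\<in>test_functions S. sq_int S (\<lambda>x. h x - \<psi> x) < e}"

lemma approximable_limit:
  assumes S: "S \<in> lmeasurable" and h: "h \<in> L2 S"
    and *: "\<And>e. e > 0 \<Longrightarrow> \<exists>h'\<in>approximable S. sq_int S (\<lambda>x. h x - h' x) < e"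
  shows "h \<in> approximable S"
proof -
  have "\<exists>\<psi>\<in>test_functions S. sq_int S (\<lambda>x. h x - \<psi> x) < e" if "e > 0" for e
  proof -
    obtain h' where h': "h' \<in> approximable S" "sq_int S (\<lambda>x. h x - h' x) < e / 4" using *[of "e / 4"] \<open>e > 0\<close> by auto
    moreover obtain \<psi> where \<psi>: "\<psi> \<in> test_functions S" "sq_int S (\<lambda>x. h' x - \<psi> x) < e / 4"
      using h'(1) \<open>e > 0\<close> by (auto simp: approximable_def dest!: spec[of _ "e / 4"])
    moreover have "sq_int S (\<lambda>x. h x - \<psi> x) \<le> 2 * sq_int S (\<lambda>x. h x - h' x) + 2 * sq_int S (\<lambda>x. h' x - \<psi> x)"
      using h' h \<psi> test_function_L2[OF S] by (intro L2_triangle_square_le) (auto simp: approximable_def)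
    ultimately show ?thesis by (intro bexI[of _ \<psi>]) auto
  qed
  then show ?thesis using h by (simp add: approximable_def)
qed

lemma approximable_lin:
  assumes S: "S \<in> lmeasurable" and "u \<in> approximable S" "v \<in> approximable S"
  shows "(\<lambda>x. u x + c * v x) \<in> approximable S"
proof -
  have L: "u \<in> L2 S" "v \<in> L2 S" using assms by (auto simp: approximable_def)
  have "\<exists>\<psi>\<in>test_functions S. sq_int S (\<lambda>x. (u x + c * v x) - \<psi> x) < e" if "e > 0" for e
  proof -
    have e': "e / 4 > 0" "e / (4 * (c\<^sup>2 + 1)) > 0"
      using \<open>e > 0\<close> by (auto intro!: divide_pos_pos add_nonneg_pos)
    obtain \<phi> where \<phi>: "\<phi> \<in> test_functions S" "sq_int S (\<lambda>x. u x - \<phi> x) < e / 4"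
      using assms(2) e'(1) unfolding approximable_def by blast
    obtain \<psi> where \<psi>: "\<psi> \<in> test_functions S" "sq_int S (\<lambda>x. v x - \<psi> x) < e / (4 * (c\<^sup>2 + 1))"
      using assms(3) e'(2) unfolding approximable_def by blast
    have T: "\<phi> \<in> L2 S" "\<psi> \<in> L2 S" using \<phi> \<psi> test_function_L2[OF S] by auto
    have "sq_int S (\<lambda>x. (u x - \<phi> x) + c * (v x - \<psi> x)) \<le>
        2 * sq_int S (\<lambda>x. u x - \<phi> x) + 2 * sq_int S (\<lambda>x. c * (v x - \<psi> x))"
      using l2.add_square_le[OF L2_diff[OF L(1) T(1)] l2.scale_closed[OF L2_diff[OF L(2) T(2)]]]
      by (simp add: sq_int_eq)
    also have "sq_int S (\<lambda>x. c * (v x - \<psi> x)) = c\<^sup>2 * sq_int S (\<lambda>x. v x - \<psi> x)"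
      by (simp add: power_mult_distrib)
    also have "c\<^sup>2 * sq_int S (\<lambda>x. v x - \<psi> x) \<le> (c\<^sup>2 + 1) * sq_int S (\<lambda>x. v x - \<psi> x)"
      by (intro mult_right_mono) auto
    also have "(c\<^sup>2 + 1) * sq_int S (\<lambda>x. v x - \<psi> x) < (c\<^sup>2 + 1) * (e / (4 * (c\<^sup>2 + 1)))"
      by (intro mult_strict_left_mono \<psi>) (auto intro: add_nonneg_pos)
    also have "(c\<^sup>2 + 1) * (e / (4 * (c\<^sup>2 + 1))) = e / 4"
      using add_nonneg_pos[of "c\<^sup>2" 1] by (simp add: field_simps)
    finally have "sq_int S (\<lambda>x. (u x - \<phi> x) + c * (v x - \<psi> x)) < e" using \<phi>(2) by simp
    then show ?thesis
      by (intro bexI[of _ "\<lambda>x. \<phi> x + c * \<psi> x"] test_functions_add_scale \<phi> \<psi>) (simp add: algebra_simps)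
  qed
  then show ?thesis using L2_lin[OF L] by (simp add: approximable_def)
qed

lemma approximable_zero: "(\<lambda>x. 0) \<in> approximable S"
  using test_functions_zero[of S] by (auto simp: approximable_def L2_zero intro!: bexI[of _ "\<lambda>x. 0"])

lemma approximable_balls:
  assumes S: "S \<in> lmeasurable" and F: "finite F" "\<And>a r. (a, r) \<in> F \<Longrightarrow> r > 0 \<and> cball a r \<subseteq> S"
  shows "indicator (\<Union>q\<in>F. ball (fst q) (snd q)) \<in> approximable S"
proof -
  let ?M = "lebesgue_on S" and ?U = "\<Union>q\<in>F. ball (fst q) (snd q)"
  interpret finite_measure ?M using S by (rule finite_measure_lebesgue_on)
  define b where "b = (\<lambda>x. \<Sum>q\<in>F. bump (fst q) (snd q) x)"
  define \<psi> where "\<psi> = (\<lambda>n x. 1 + (-1) * exp ((- real n) * b x))"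
  have t: "\<psi> n \<in> test_functions S" for n
    unfolding \<psi>_def by (rule test_function_balls[OF F]) (auto simp: b_def)
  have b: "b x \<ge> 0" "b x > 0 \<longleftrightarrow> x \<in> ?U" for x
    using test_function_balls(2,3)[OF F, of b x] by (auto simp: b_def)
  have "?U \<in> sets borel" by (intro borel_open open_UN) auto
  then have [measurable]: "indicator ?U \<in> borel_measurable ?M"
    by (intro measurable_restrict_space1) (auto intro!: measurable_completion borel_measurable_indicator)
  have L: "indicator ?U \<in> L2 S" by (rule L2_bounded[OF S, of _ 1]) (auto simp: indicator_def)
  have [measurable]: "\<psi> n \<in> borel_measurable ?M" for n using test_function_L2[OF S t] by (simp add: L2_def)
  have "(\<lambda>n. sq_int S (\<lambda>x. indicator ?U x - \<psi> n x)) \<longlonglongrightarrow> (LINT x|?M. 0)"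
  proof (rule integral_dominated_convergence[where w="\<lambda>_. 1"])
    show "AE x in ?M. (\<lambda>n. (indicator ?U x - \<psi> n x)\<^sup>2) \<longlonglongrightarrow> 0"
    proof (rule AE_I2)
      fix x
      show "(\<lambda>n. (indicator ?U x - \<psi> n x)\<^sup>2) \<longlonglongrightarrow> 0"
      proof (cases "x \<in> ?U")
        case True
        then have "b x > 0" using b by blast
        then have "(\<lambda>n. exp (- b x) ^ n) \<longlonglongrightarrow> 0" by (intro LIMSEQ_power_zero) simp
        from tendsto_power[OF this, of 2] have "(\<lambda>n. (exp (- b x) ^ n)\<^sup>2) \<longlonglongrightarrow> 0\<^sup>2" .
        then show ?thesis using True by (simp add: \<psi>_def exp_of_nat_mult[symmetric])
      next
        case False
        then have "b x = 0" using b(1)[of x] b(2)[of x] by linarith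
        then show ?thesis using False by (simp add: \<psi>_def)
      qed
    qed
    show "AE x in ?M. norm ((indicator ?U x - \<psi> n x)\<^sup>2) \<le> 1" for n
    proof (rule AE_I2)
      fix x
      have "exp ((- real n) * b x) \<le> 1" "exp ((- real n) * b x) > 0" using b(1)[of x] by auto
      then have "\<bar>indicator ?U x - \<psi> n x\<bar> \<le> 1" unfolding \<psi>_def indicator_def by (cases "x \<in> ?U") simp_all
      then show "norm ((indicator ?U x - \<psi> n x)\<^sup>2) \<le> 1" by (simp add: abs_square_le_1)
    qed
  qed auto
  then have lim: "(\<lambda>n. sq_int S (\<lambda>x. indicator ?U x - \<psi> n x)) \<longlonglongrightarrow> 0" by simp
  have "\<exists>\<phi>\<in>test_functions S. sq_int S (\<lambda>x. indicator ?U x - \<phi> x) < e" if "e > 0" for e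
    using order_tendstoD(2)[OF lim that] t by (auto simp: eventually_sequentially)
  then show ?thesis using L by (simp add: approximable_def)
qed

text \<open>Regularity of the measure reduces \<open>E\<close> to balls. A compact \<open>C\<close>
  inside \<open>E\<close> misses little of it, an open \<open>G\<close> around \<open>C\<close> adds
  little, and finitely many balls inside both \<open>G\<close> and \<open>S\<close> cover
  \<open>C\<close>. The neighbourhood is taken around \<open>C\<close>, so compactness is available
  for the finite cover.\<close>

lemma approximable_indicator:
  assumes "open S" "bounded S" and E: "E \<in> sets lebesgue" "E \<subseteq> S"
  shows "indicator E \<in> approximable S"
proof -
  have S: "S \<in> lmeasurable" using assms by (simp add: lmeasurable_open)
  let ?M = "lebesgue_on S"
  have [measurable]: "indicator E \<in> borel_measurable ?M"
    using E by (intro measurable_restrict_space1) auto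
  have L: "indicator E \<in> L2 S" by (rule L2_bounded[OF S, of _ 1]) (auto simp: indicator_def)
  show ?thesis
  proof (rule approximable_limit[OF S L])
    fix e :: real assume e: "e > 0"
    obtain C where C: "closed C" "C \<subseteq> E" "E - C \<in> lmeasurable" "emeasure lebesgue (E - C) < ennreal (e / 2)"
      using sets_lebesgue_inner_closed[OF E(1), of "e / 2"] e by auto
    then have C': "compact C" using assms(2) E(2) by (meson bounded_subset compact_eq_bounded_closed)
    then obtain G where G: "open G" "C \<subseteq> G" "G - C \<in> lmeasurable" "emeasure lebesgue (G - C) < ennreal (e / 2)"
      using sets_lebesgue_outer_open[of C "e / 2"] e by (auto simp: lmeasurable_compact fmeasurableD)
    have "\<exists>r. r > 0 \<and> cball x r \<subseteq> G \<inter> S" if "x \<in> C" for x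
      using that C G E(2) assms(1) open_contains_cball[of "G \<inter> S"] by (meson IntI open_Int subsetD)
    then obtain r where r: "\<And>x. x \<in> C \<Longrightarrow> r x > 0 \<and> cball x (r x) \<subseteq> G \<inter> S" by metis
    have "C \<subseteq> (\<Union>x\<in>C. ball x (r x))" using r by (auto intro!: bexI)
    from compactE_image[OF C' _ this] obtain D where D: "D \<subseteq> C" "finite D" "C \<subseteq> (\<Union>x\<in>D. ball x (r x))"
      by auto
    define F where "F = (\<lambda>x. (x, r x)) ` D"
    have F: "finite F" "\<And>a r. (a, r) \<in> F \<Longrightarrow> r > 0 \<and> cball a r \<subseteq> S"
      using D r unfolding F_def by blast+
    let ?U = "\<Union>q\<in>F. ball (fst q) (snd q)"
    have "ball x (r x) \<subseteq> G" if "x \<in> D" for x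
      using D(1) r that ball_subset_cball[of x "r x"] by blast
    then have U: "C \<subseteq> ?U" "?U \<subseteq> G" using D(3) by (auto simp: F_def)
    \<comment> \<open>The union of the balls lies between \<open>C\<close> and \<open>G\<close>, so
      \<open>?W\<close> contains every point at which the two indicators differ.\<close>
    let ?W = "(E - C) \<union> (G - C)"
    have W: "?W \<in> lmeasurable" using C G by blast
    have "?U \<in> sets borel" by (intro borel_open open_UN) auto
    then have [measurable]: "indicator ?U \<in> borel_measurable ?M"
      by (intro measurable_restrict_space1) (auto intro!: measurable_completion borel_measurable_indicator)
    interpret finite_measure ?M using S by (rule finite_measure_lebesgue_on)
    have "sq_int S (\<lambda>x. indicator E x - indicator ?U x) \<le> (LINT x|?M. indicator ?W x)"
    proof (rule integral_mono)
      show "(indicator E x - indicator ?U x :: real)\<^sup>2 \<le> indicator ?W x" for x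
      proof -
        have "x \<in> ?W" if "(x \<in> E) \<noteq> (x \<in> ?U)" using that U C(2) by blast
        then show ?thesis unfolding indicator_def by (cases "x \<in> E"; cases "x \<in> ?U") simp_all
      qed
      show "integrable ?M (\<lambda>x. (indicator E x - indicator ?U x)\<^sup>2 :: real)"
      proof (rule integrable_const_bound[of _ 1])
        show "AE x in ?M. norm ((indicator E x - indicator ?U x)\<^sup>2 :: real) \<le> 1"
          by (intro AE_I2) (simp add: indicator_def)
      qed measurable
      show "integrable ?M (indicator ?W :: _ \<Rightarrow> real)"
        by (rule integrable_const_bound[of _ 1]) (use W in \<open>auto simp: indicator_def intro!: measurable_restrict_space1\<close>)
    qed
    also have "\<dots> = (LINT x|lebesgue. indicator S x *\<^sub>R indicator ?W x)"
      using S by (intro integral_restrict_space) (auto simp: fmeasurableD)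
    also have "\<dots> \<le> (LINT x|lebesgue. indicator ?W x)"
    proof (rule integral_mono)
      have "S \<inter> ?W \<in> lmeasurable" using W S by (intro fmeasurable.Int)
      then have "integrable lebesgue (indicator (S \<inter> ?W) :: _ \<Rightarrow> real)" by (auto intro!: integrable_real_indicator simp: fmeasurable_def)
      then show "integrable lebesgue (\<lambda>x. indicator S x *\<^sub>R indicator ?W x :: real)"
        unfolding indicator_inter_arith real_scaleR_def .
      show "integrable lebesgue (indicator ?W :: _ \<Rightarrow> real)" using W by (auto intro!: integrable_real_indicator simp: fmeasurable_def)
    qed (simp add: indicator_def)
    also have "\<dots> = measure lebesgue ?W" by simp
    also have "\<dots> \<le> measure lebesgue (E - C) + measure lebesgue (G - C)"
      using C G by (intro measure_Un_le) auto
    also have "\<dots> < e / 2 + e / 2"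
      using C G e by (intro add_strict_mono) (auto simp: emeasure_eq_measure2 ennreal_less_iff)
    finally show "\<exists>h'\<in>approximable S. sq_int S (\<lambda>x. indicator E x - h' x) < e"
      using approximable_balls[OF S F] by (intro bexI[of _ "indicator ?U"]) auto
  qed
qed

lemma approximable_sum:
  assumes S: "S \<in> lmeasurable" and "finite I" "\<And>i. i \<in> I \<Longrightarrow> v i \<in> approximable S"
  shows "(\<lambda>x. \<Sum>i\<in>I. c i * v i x) \<in> approximable S"
  using assms(2,3)
proof (induction I rule: finite_induct)
  case (insert j F)
  have "(\<lambda>x. (\<Sum>i\<in>F. c i * v i x) + c j * v j x) \<in> approximable S"
    using insert by (intro approximable_lin S) auto
  then show ?case using insert by (simp add: add.commute)
qed (simp add: approximable_zero)

text \<open>Simple functions are finite combinations of indicators of measurable subsets, and a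
  sequence of them converges to \<open>h\<close> in the square mean by dominated
  convergence.\<close>

lemma test_functions_dense:
  assumes "open S" "bounded S" and h: "h \<in> L2 S"
  shows "h \<in> approximable S"
proof -
  have S: "S \<in> lmeasurable" using assms by (simp add: lmeasurable_open)
  let ?M = "lebesgue_on S"
  have hm[measurable]: "h \<in> borel_measurable ?M" and hi: "integrable ?M (\<lambda>x. (h x)\<^sup>2)"
    using h by (auto simp: L2_def)
  obtain F where "(\<forall>i. simple_function ?M (F i)) \<and> (\<forall>x\<in>S. (\<lambda>i. F i x) \<longlonglongrightarrow> h x) \<and>
      (\<forall>i. \<forall>x\<in>S. \<bar>F i x\<bar> \<le> 2 * \<bar>h x\<bar>)"
    using borel_measurable_implies_sequence_metric[OF hm, of 0] by (auto simp: dist_real_def)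
  then have F: "\<And>i. simple_function ?M (F i)" "\<And>x. x \<in> S \<Longrightarrow> (\<lambda>i. F i x) \<longlonglongrightarrow> h x"
    "\<And>i x. x \<in> S \<Longrightarrow> \<bar>F i x\<bar> \<le> 2 * \<bar>h x\<bar>" by blast+
  have [measurable]: "F i \<in> borel_measurable ?M" for i using F(1) by (rule borel_measurable_simple_function)
  have FL: "F i \<in> approximable S" for i
  proof -
    let ?G = "\<lambda>x. \<Sum>y\<in>F i ` S. y * indicator (F i -` {y} \<inter> S) x"
    have fin: "finite (F i ` S)" using F(1)[of i] by (simp add: simple_function_def)
    have "F i -` {y} \<inter> S \<in> sets lebesgue" for y
      using measurable_sets[of "F i" ?M borel "{y}"] S by (auto simp: sets_restrict_space_iff fmeasurableD)
    then have "?G \<in> approximable S"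
      by (intro approximable_sum S fin approximable_indicator assms) auto
    moreover have eq: "?G x = F i x" if "x \<in> S" for x
    proof -
      have "?G x = (\<Sum>y\<in>F i ` S. if y = F i x then y else 0)"
        using that by (intro sum.cong) (auto simp: indicator_def)
      then show ?thesis using that fin by (simp add: sum.delta)
    qed
    moreover have "sq_int S (\<lambda>x. F i x - \<psi> x) = sq_int S (\<lambda>x. ?G x - \<psi> x)" for \<psi>
      by (rule Bochner_Integration.integral_cong) (use eq in auto)
    moreover have "F i \<in> L2 S"
      by (rule L2_AE_eq[of S ?G]) (use S calculation in \<open>auto simp: approximable_def fmeasurableD intro!: AE_I2\<close>)
    ultimately show ?thesis by (simp add: approximable_def)
  qed
  \<comment> \<open>\<open>F i\<close> is bounded by 2 |h|, so the difference is bounded by 3 |h|;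
    this is the origin of the factor 9 in the dominating function.\<close>
  have "(\<lambda>i. sq_int S (\<lambda>x. h x - F i x)) \<longlonglongrightarrow> (LINT x|?M. 0)"
  proof (rule integral_dominated_convergence[where w="\<lambda>x. 9 * (h x)\<^sup>2"])
    show "AE x in ?M. (\<lambda>i. (h x - F i x)\<^sup>2) \<longlonglongrightarrow> 0"
    proof (rule AE_I2)
      fix x assume "x \<in> space ?M"
      then have "(\<lambda>i. (h x - F i x)\<^sup>2) \<longlonglongrightarrow> (h x - h x)\<^sup>2" using F(2) by (intro tendsto_intros) auto
      then show "(\<lambda>i. (h x - F i x)\<^sup>2) \<longlonglongrightarrow> 0" by simp
    qed
    show "AE x in ?M. norm ((h x - F i x)\<^sup>2) \<le> 9 * (h x)\<^sup>2" for i
    proof (rule AE_I2)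
      fix x assume "x \<in> space ?M"
      then have "\<bar>h x - F i x\<bar> \<le> 3 * \<bar>h x\<bar>" using F(3)[of x i] by (auto simp: abs_if split: if_splits)
      from power_mono[OF this, of 2] show "norm ((h x - F i x)\<^sup>2) \<le> 9 * (h x)\<^sup>2"
        by (simp add: power_mult_distrib)
    qed
  qed (use hi in auto)
  then have lim: "(\<lambda>i. sq_int S (\<lambda>x. h x - F i x)) \<longlonglongrightarrow> 0" by simp
  show ?thesis
  proof (rule approximable_limit[OF S h])
    fix e :: real assume "e > 0"
    then show "\<exists>h'\<in>approximable S. sq_int S (\<lambda>x. h x - h' x) < e"
      using order_tendstoD(2)[OF lim, of e] FL by (meson eventually_sequentially order_refl)
  qed
qed

text \<open>With \<open>C = 0\<close> this is the fundamental lemma of the calculus of variations.\<close>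

lemma sq_int_le_dual:
  assumes "open S" "bounded S" and h: "h \<in> L2 S" and "C \<ge> 0"
    and *: "\<And>\<psi>. \<psi> \<in> test_functions S \<Longrightarrow> \<bar>LINT x|lebesgue_on S. h x * \<psi> x\<bar> \<le> C * sqrt (sq_int S \<psi>)"
  shows "sq_int S h \<le> C\<^sup>2"
proof -
  have S: "S \<in> lmeasurable" using assms by (simp add: lmeasurable_open)
  define A where "A = sqrt (sq_int S h)"
  have A: "A \<ge> 0" "A\<^sup>2 = sq_int S h" by (auto simp: A_def)
  \<comment> \<open>The optimal choice for the test function would be \<open>h\<close> itself, which
    need not be smooth. A test function at distance at most \<open>t\<close> from \<open>h\<close>
    changes the inequality by t (C + A) only.\<close>
  have est: "A\<^sup>2 \<le> C * A + t * (C + A)" if "t > 0" for t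
  proof -
    have "t\<^sup>2 > 0" using that by simp
    then obtain \<psi> where \<psi>: "\<psi> \<in> test_functions S" "sq_int S (\<lambda>x. h x - \<psi> x) < t\<^sup>2"
      using test_functions_dense[OF assms(1-3)] unfolding approximable_def by blast
    have p: "\<psi> \<in> L2 S" by (rule test_function_L2[OF S \<psi>(1)])
    have d: "sqrt (sq_int S (\<lambda>x. h x - \<psi> x)) \<le> t" using \<psi>(2) that by (intro real_le_lsqrt) auto
    have "A\<^sup>2 = (LINT x|lebesgue_on S. h x * \<psi> x) + (LINT x|lebesgue_on S. h x * (h x - \<psi> x))"
      using l2.diff_right[OF h p h] A by (simp add: sq_int_eq)
    also have "\<dots> \<le> C * sqrt (sq_int S \<psi>) + A * t"
      using *[OF \<psi>(1)] L2_abs_integral_le[OF h L2_diff[OF h p]] mult_left_mono[OF d A(1)]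
      unfolding A_def by linarith
    also have "\<dots> \<le> C * (A + t) + A * t"
      using l2.square_bound_of_close[OF h p] d \<open>C \<ge> 0\<close> unfolding A_def
      by (intro add_right_mono mult_left_mono) (auto simp: sq_int_eq)
    finally show ?thesis by (simp add: algebra_simps)
  qed
  have "A\<^sup>2 \<le> C * A"
  proof (rule field_le_epsilon)
    fix e :: real assume "e > 0"
    \<comment> \<open>The added 1 keeps the denominator positive when both \<open>C\<close> and
      \<open>A\<close> vanish.\<close>
    define t where "t = e / (C + A + 1)"
    have t: "t > 0" using A \<open>C \<ge> 0\<close> \<open>e > 0\<close> by (simp add: t_def)
    have "t * (C + A) \<le> t * (C + A + 1)" using t by simp
    also have "\<dots> = e" using A \<open>C \<ge> 0\<close> by (simp add: t_def)
    finally show "A\<^sup>2 \<le> C * A + e" using est[OF t] by linarith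
  qed
  then have "A \<le> C" using A \<open>C \<ge> 0\<close> by (cases "A = 0") (auto simp: power2_eq_square)
  then show ?thesis using A power_mono[of A C 2] by simp
qed

abbreviation gsq_int :: "(real^'d) set \<Rightarrow> (real^'d \<Rightarrow> real^'d) \<Rightarrow> real" where
  "gsq_int S g \<equiv> (LINT x|lebesgue_on S. (norm (g x))\<^sup>2)"

section \<open>Restriction and translation of integrals\<close>

lemma integral_zero_outside:
  fixes f :: "'a::euclidean_space \<Rightarrow> real"
  assumes "T \<subseteq> S" "T \<in> sets lebesgue" "S \<in> sets lebesgue" "\<And>x. x \<in> S \<Longrightarrow> x \<notin> T \<Longrightarrow> f x = 0"
  shows "integral\<^sup>L (lebesgue_on S) f = integral\<^sup>L (lebesgue_on T) f"
proof -
  have "integral\<^sup>L (lebesgue_on S) f = integral\<^sup>L (lebesgue_on S) (\<lambda>x. if x \<in> T then f x else 0)"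
    by (rule Bochner_Integration.integral_cong) (use assms(4) in auto)
  then show ?thesis using integral_restrict[OF assms(1-3)] by simp
qed

lemma lebesgue_on_measurable_subset:
  assumes "T \<subseteq> S" "T \<in> sets lebesgue" "S \<in> sets lebesgue" "f \<in> borel_measurable (lebesgue_on S)"
  shows "f \<in> borel_measurable (lebesgue_on T)"
proof -
  have "lebesgue_on T = restrict_space (lebesgue_on S) T"
    using assms(1-3) by (simp add: restrict_restrict_space Int_absorb1)
  then show ?thesis using measurable_restrict_space1[OF assms(4), of T] by simp
qed

lemma integrable_lebesgue_on_subset:
  fixes f :: "'a::euclidean_space \<Rightarrow> real"
  assumes "T \<subseteq> S" "T \<in> sets lebesgue" "S \<in> sets lebesgue" "integrable (lebesgue_on S) f"
  shows "integrable (lebesgue_on T) f"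
proof -
  have "integrable lebesgue (\<lambda>x. indicator T x *\<^sub>R (if x \<in> S then f x else 0))"
    using assms Lebesgue_Measure.integrable_restrict_UNIV[of S f] by (intro integrable_mult_indicator) auto
  moreover have "(\<lambda>x. indicator T x *\<^sub>R (if x \<in> S then f x else 0)) = (\<lambda>x. if x \<in> T then f x else 0)"
  proof
    fix x show "indicator T x *\<^sub>R (if x \<in> S then f x else 0) = (if x \<in> T then f x else 0)"
      using assms(1) by (cases "x \<in> T") auto
  qed
  ultimately show ?thesis using Lebesgue_Measure.integrable_restrict_UNIV[of T f] assms(2) by simp
qed

lemma AE_lebesgue_on_subset:
  assumes "T \<subseteq> S" "T \<in> sets lebesgue" "S \<in> sets lebesgue" "AE x in lebesgue_on S. P x"
  shows "AE x in lebesgue_on T. P x"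
  using assms by (auto simp: AE_lebesgue_on_iff_negligible elim: negligible_subset)

lemma L2_subset:
  assumes "T \<subseteq> S" "T \<in> sets lebesgue" "S \<in> sets lebesgue" "v \<in> L2 S"
  shows "v \<in> L2 T"
  using assms integrable_lebesgue_on_subset[OF assms(1-3)] lebesgue_on_measurable_subset[OF assms(1-3)]
  by (auto simp: L2_def)

lemma integral_nonneg_subset:
  fixes f :: "'a::euclidean_space \<Rightarrow> real"
  assumes "T \<subseteq> S" "T \<in> sets lebesgue" "S \<in> sets lebesgue" "integrable (lebesgue_on S) f"
    "\<And>x. x \<in> S \<Longrightarrow> 0 \<le> f x"
  shows "integral\<^sup>L (lebesgue_on T) f \<le> integral\<^sup>L (lebesgue_on S) f"
  by (rule integral_mono_lebesgue_on_AE[OF assms(4)]) (use assms in \<open>auto intro!: AE_I2\<close>)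

lemma sq_int_subset:
  assumes "T \<subseteq> S" "T \<in> sets lebesgue" "S \<in> sets lebesgue" "v \<in> L2 S"
  shows "sq_int T v \<le> sq_int S v"
  using assms by (intro integral_nonneg_subset) (auto simp: L2_def)

lemma translate_measurable: "(\<lambda>x. x + z) \<in> lebesgue \<rightarrow>\<^sub>M (lebesgue :: 'a::euclidean_space measure)"
  and distr_lebesgue_translate: "distr lebesgue lebesgue (\<lambda>x. x + z) = (lebesgue :: 'a measure)"
proof -
  \<comment> \<open>A translation is the diagonal affine map with all factors equal to 1, for which
    the density in the transformation formula is 1.\<close>
  have eq: "(\<lambda>x. z + (\<Sum>j\<in>Basis. (1 * (x \<bullet> j)) *\<^sub>R j)) = (\<lambda>x. x + z)"
    by (simp add: euclidean_representation add.commute)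
  show "(\<lambda>x. x + z) \<in> lebesgue \<rightarrow>\<^sub>M lebesgue"
    using lebesgue_affine_measurable[of "\<lambda>_. 1" z] unfolding eq by simp
  show "distr lebesgue lebesgue (\<lambda>x. x + z) = lebesgue"
    using lebesgue_affine_euclidean[of "\<lambda>_. 1" z] unfolding eq by (simp add: density_1)
qed

lemma translate_measurable_on:
  assumes "A \<in> sets lebesgue" "(\<lambda>x. x + z) ` A \<subseteq> B"
    and f: "f \<in> borel_measurable (lebesgue_on B)"
  shows "(\<lambda>x. f (x + z)) \<in> borel_measurable (lebesgue_on A)"
proof -
  have "(\<lambda>x. x + z) \<in> lebesgue_on A \<rightarrow>\<^sub>M lebesgue"
    by (intro measurable_restrict_space1 translate_measurable)
  then have "(\<lambda>x. x + z) \<in> lebesgue_on A \<rightarrow>\<^sub>M lebesgue_on B"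
    using assms(2) by (intro measurable_restrict_space2) auto
  from measurable_compose[OF this f] show ?thesis .
qed

lemma integral_translate_on:
  fixes f :: "'a::euclidean_space \<Rightarrow> real"
  assumes A: "A \<in> sets lebesgue" and f: "f \<in> borel_measurable (lebesgue_on ((\<lambda>x. x + z) ` A))"
  shows "(LINT x|lebesgue_on A. f (x + z)) = (LINT x|lebesgue_on ((\<lambda>x. x + z) ` A). f x)"
    and "integrable (lebesgue_on ((\<lambda>x. x + z) ` A)) f \<Longrightarrow> integrable (lebesgue_on A) (\<lambda>x. f (x + z))"
proof -
  let ?B = "(\<lambda>x. x + z) ` A"
  have B: "?B \<in> sets lebesgue" using lebesgue_sets_translation[OF A, of z] by (simp add: add.commute)
  have m: "(\<lambda>x. indicator ?B x *\<^sub>R f x) \<in> borel_measurable lebesgue"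
    using f borel_measurable_restrict_space_iff[of ?B lebesgue f] B by simp
  have eq: "(\<lambda>x. indicator ?B (x + z) *\<^sub>R f (x + z)) = (\<lambda>x. indicator A x *\<^sub>R f (x + z))"
  proof
    fix x
    have "x + z \<in> ?B \<longleftrightarrow> x \<in> A" by auto
    then show "indicator ?B (x + z) *\<^sub>R f (x + z) = indicator A x *\<^sub>R f (x + z)"
      unfolding indicator_def by simp
  qed
  show "(LINT x|lebesgue_on A. f (x + z)) = (LINT x|lebesgue_on ?B. f x)"
    using integral_distr[OF translate_measurable m, of z] A B
    by (simp add: distr_lebesgue_translate eq integral_restrict_space del: real_scaleR_def)
  show "integrable (lebesgue_on A) (\<lambda>x. f (x + z))" if "integrable (lebesgue_on ?B) f"
    using that integrable_distr_eq[OF translate_measurable m, of z] A B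
    by (simp add: distr_lebesgue_translate eq integrable_restrict_space del: real_scaleR_def)
qed

lemma L2_translate:
  assumes A: "A \<in> sets lebesgue" and v: "v \<in> L2 ((\<lambda>x. x + z) ` A)"
  shows "(\<lambda>x. v (x + z)) \<in> L2 A" "sq_int A (\<lambda>x. v (x + z)) = sq_int ((\<lambda>x. x + z) ` A) v"
proof -
  have [measurable]: "v \<in> borel_measurable (lebesgue_on ((\<lambda>x. x + z) ` A))"
    and i: "integrable (lebesgue_on ((\<lambda>x. x + z) ` A)) (\<lambda>x. (v x)\<^sup>2)"
    using v by (auto simp: L2_def)
  have m: "(\<lambda>x. (v x)\<^sup>2) \<in> borel_measurable (lebesgue_on ((\<lambda>x. x + z) ` A))" by measurable
  show "(\<lambda>x. v (x + z)) \<in> L2 A"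
    using integral_translate_on(2)[OF A m i] translate_measurable_on[OF A order_refl, of v z]
    by (simp add: L2_def)
  show "sq_int A (\<lambda>x. v (x + z)) = sq_int ((\<lambda>x. x + z) ` A) v"
    by (rule integral_translate_on(1)[OF A m])
qed

section \<open>Weak gradients\<close>

lemma has_weak_gradientD:
  assumes "has_weak_gradient S v g"
  shows "v \<in> L2 S" "(\<lambda>x. g x $ i) \<in> L2 S"
    "\<phi> \<in> test_functions S \<Longrightarrow>
      (LINT x|lebesgue_on S. v x * gradient \<phi> x $ i) = - (LINT x|lebesgue_on S. g x $ i * \<phi> x)"
  using assms by (auto simp: has_weak_gradient_def)

lemma has_weak_gradient_lin:
  assumes S: "S \<in> lmeasurable" and u: "has_weak_gradient S u g" and v: "has_weak_gradient S v h"
  shows "has_weak_gradient S (\<lambda>x. u x + c * v x) (\<lambda>x. g x + c *\<^sub>R h x)"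
  unfolding has_weak_gradient_def
proof (intro conjI allI ballI)
  show "(\<lambda>x. u x + c * v x) \<in> L2 S" by (intro L2_lin has_weak_gradientD[OF u] has_weak_gradientD[OF v])
  show "(\<lambda>x. (g x + c *\<^sub>R h x) $ i) \<in> L2 S" for i
    using L2_lin[OF has_weak_gradientD(2)[OF u] has_weak_gradientD(2)[OF v]] by simp
  fix \<phi> i assume \<phi>: "\<phi> \<in> test_functions S"
  note L = test_function_L2[OF S \<phi>] test_gradient_L2[OF S \<phi>, of i]
  show "(LINT x|lebesgue_on S. (u x + c * v x) * gradient \<phi> x $ i) =
      - (LINT x|lebesgue_on S. (g x + c *\<^sub>R h x) $ i * \<phi> x)"
    using l2.lin[OF has_weak_gradientD(1)[OF u] has_weak_gradientD(1)[OF v] L(2), of c]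
      l2.lin[OF has_weak_gradientD(2)[OF u] has_weak_gradientD(2)[OF v] L(1), of i c i]
      has_weak_gradientD(3)[OF u \<phi>, of i] has_weak_gradientD(3)[OF v \<phi>, of i] by simp
qed

text \<open>The difference of two weak gradients integrates to 0 against every test function, so
  \<open>sq_int_le_dual\<close> applies to each component with constant 0.\<close>

lemma has_weak_gradient_unique:
  assumes S: "open S" "bounded S" and g: "has_weak_gradient S v g" and h: "has_weak_gradient S v h"
  shows "AE x in lebesgue_on S. g x = h x"
proof -
  have Sm: "S \<in> lmeasurable" using S by (simp add: lmeasurable_open)
  have "AE x in lebesgue_on S. g x $ i - h x $ i = 0" for i
  proof -
    have L: "(\<lambda>x. g x $ i - h x $ i) \<in> L2 S" by (intro L2_diff has_weak_gradientD[OF g] has_weak_gradientD[OF h])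
    have "sq_int S (\<lambda>x. g x $ i - h x $ i) \<le> 0\<^sup>2"
    proof (rule sq_int_le_dual[OF S L])
      fix \<psi> assume \<psi>: "\<psi> \<in> test_functions S"
      show "\<bar>LINT x|lebesgue_on S. (g x $ i - h x $ i) * \<psi> x\<bar> \<le> 0 * sqrt (sq_int S \<psi>)"
        using l2.diff_left[OF has_weak_gradientD(2)[OF g] has_weak_gradientD(2)[OF h] test_function_L2[OF Sm \<psi>], of i i]
          has_weak_gradientD(3)[OF g \<psi>, of i] has_weak_gradientD(3)[OF h \<psi>, of i] by simp
    qed simp
    then have "sq_int S (\<lambda>x. g x $ i - h x $ i) = 0" using sq_int_nonneg[of S] by (simp add: antisym)
    then show ?thesis using sq_int_zero_iff[OF L] by simp
  qed
  then have "AE x in lebesgue_on S. \<forall>i. g x $ i - h x $ i = 0" by (simp add: AE_all_countable)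
  then show ?thesis by eventually_elim (simp add: vec_eq_iff)
qed

lemma H1_has_weak_gradient: "v \<in> H1 S \<Longrightarrow> has_weak_gradient S v (weak_gradient S v)"
  unfolding H1_def weak_gradient_def by (auto intro: someI[of "has_weak_gradient S v"])

lemma has_weak_gradient_H1: "has_weak_gradient S v g \<Longrightarrow> v \<in> H1 S"
  by (auto simp: H1_def)

lemma weak_gradient_eq:
  assumes "open S" "bounded S" "has_weak_gradient S v g"
  shows "AE x in lebesgue_on S. weak_gradient S v x = g x"
  using has_weak_gradient_unique[OF assms(1,2)] H1_has_weak_gradient[OF has_weak_gradient_H1] assms(3) by blast

lemma has_weak_gradient_AE_eq:
  assumes S: "S \<in> lmeasurable" and g: "has_weak_gradient S v g" and eq: "AE x in lebesgue_on S. v x = u x"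
  shows "has_weak_gradient S u g"
  unfolding has_weak_gradient_def
proof (intro conjI allI ballI)
  have Sm: "S \<in> sets lebesgue" using S by (rule fmeasurableD)
  show u: "u \<in> L2 S" using L2_AE_eq[OF Sm eq] has_weak_gradientD(1)[OF g] by blast
  show "(\<lambda>x. g x $ i) \<in> L2 S" for i by (rule has_weak_gradientD(2)[OF g])
  fix \<phi> i assume \<phi>: "\<phi> \<in> test_functions S"
  have "(LINT x|lebesgue_on S. u x * gradient \<phi> x $ i) = (LINT x|lebesgue_on S. v x * gradient \<phi> x $ i)"
  proof (rule integral_cong_AE)
    show "AE x in lebesgue_on S. u x * gradient \<phi> x $ i = v x * gradient \<phi> x $ i"
      using eq by eventually_elim simp
  qed (use u has_weak_gradientD(1)[OF g] test_gradient_L2[OF S \<phi>, of i] in \<open>auto simp: L2_def\<close>)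
  then show "(LINT x|lebesgue_on S. u x * gradient \<phi> x $ i) = - (LINT x|lebesgue_on S. g x $ i * \<phi> x)"
    using has_weak_gradientD(3)[OF g \<phi>] by simp
qed

text \<open>A test function on the smaller set is one on the larger set, and it vanishes together
  with its gradient off the smaller set; the same \<open>g\<close> therefore serves.\<close>

lemma has_weak_gradient_subset:
  assumes T: "T \<subseteq> S" "T \<in> sets lebesgue" "S \<in> sets lebesgue" and g: "has_weak_gradient S v g"
  shows "has_weak_gradient T v g"
  unfolding has_weak_gradient_def
proof (intro conjI allI ballI)
  show "v \<in> L2 T" by (rule L2_subset[OF T has_weak_gradientD(1)[OF g]])
  show "(\<lambda>x. g x $ i) \<in> L2 T" for i by (rule L2_subset[OF T has_weak_gradientD(2)[OF g]])
  fix \<phi> i assume \<phi>: "\<phi> \<in> test_functions T"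
  have \<phi>S: "\<phi> \<in> test_functions S" using \<phi> test_functions_mono[OF T(1)] by blast
  have "(LINT x|lebesgue_on S. v x * gradient \<phi> x $ i) = (LINT x|lebesgue_on T. v x * gradient \<phi> x $ i)"
    by (rule integral_zero_outside[OF T]) (simp add: gradient_zero_outside[OF \<phi>])
  moreover have "(LINT x|lebesgue_on S. g x $ i * \<phi> x) = (LINT x|lebesgue_on T. g x $ i * \<phi> x)"
    by (rule integral_zero_outside[OF T]) (simp add: test_functions_zero_outside[OF \<phi>])
  ultimately show "(LINT x|lebesgue_on T. v x * gradient \<phi> x $ i) = - (LINT x|lebesgue_on T. g x $ i * \<phi> x)"
    using has_weak_gradientD(3)[OF g \<phi>S] by simp
qed

lemma norm_square_vec: "(norm (x :: real^'d))\<^sup>2 = (\<Sum>i\<in>UNIV. (x $ i)\<^sup>2)"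
  unfolding power2_norm_eq_inner inner_vec_def by (simp add: power2_eq_square)

lemma gsq_int_eq:
  assumes "\<And>i. (\<lambda>x. g x $ i) \<in> L2 S"
  shows "gsq_int S g = (\<Sum>i\<in>UNIV. sq_int S (\<lambda>x. g x $ i))" "integrable (lebesgue_on S) (\<lambda>x. (norm (g x))\<^sup>2)"
  using assms by (auto simp: norm_square_vec L2_def)

text \<open>Both sides of the defining identity are continuous under convergence in the square mean,
  because a test function and its derivatives are square integrable on \<open>S\<close>.\<close>

lemma has_weak_gradient_limit:
  assumes S: "S \<in> lmeasurable" and hw: "\<And>n. has_weak_gradient S (v n) (g n)"
    and u: "u \<in> L2 S" "(\<lambda>n. sq_int S (\<lambda>x. v n x - u x)) \<longlonglongrightarrow> 0"
    and h: "\<And>i. (\<lambda>x. h x $ i) \<in> L2 S" "\<And>i. (\<lambda>n. sq_int S (\<lambda>x. g n x $ i - h x $ i)) \<longlonglongrightarrow> 0"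
  shows "has_weak_gradient S u h"
  unfolding has_weak_gradient_def
proof (intro conjI allI ballI)
  fix \<phi> i assume \<phi>: "\<phi> \<in> test_functions S"
  have a: "(\<lambda>n. LINT x|lebesgue_on S. v n x * gradient \<phi> x $ i) \<longlonglongrightarrow> (LINT x|lebesgue_on S. u x * gradient \<phi> x $ i)"
    by (rule l2.tendsto_left) (use u has_weak_gradientD[OF hw] test_gradient_L2[OF S \<phi>] in \<open>auto simp: sq_int_eq\<close>)
  have "(\<lambda>n. LINT x|lebesgue_on S. g n x $ i * \<phi> x) \<longlonglongrightarrow> (LINT x|lebesgue_on S. h x $ i * \<phi> x)"
    by (rule l2.tendsto_left) (use h has_weak_gradientD[OF hw] test_function_L2[OF S \<phi>] in \<open>auto simp: sq_int_eq\<close>)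
  then have b: "(\<lambda>n. - (LINT x|lebesgue_on S. g n x $ i * \<phi> x)) \<longlonglongrightarrow> - (LINT x|lebesgue_on S. h x $ i * \<phi> x)"
    by (rule tendsto_minus)
  show "(LINT x|lebesgue_on S. u x * gradient \<phi> x $ i) = - (LINT x|lebesgue_on S. h x $ i * \<phi> x)"
    by (rule LIMSEQ_unique[OF a[unfolded has_weak_gradientD(3)[OF hw \<phi>]] b])
qed (use u h in auto)

lemma has_weak_gradient_complete:
  assumes S: "S \<in> lmeasurable" and hw: "\<And>n. has_weak_gradient S (v n) (g n)"
    and cv: "\<And>e. e > 0 \<Longrightarrow> \<exists>N. \<forall>m\<ge>N. \<forall>n\<ge>N. sq_int S (\<lambda>x. v m x - v n x) < e"
    and cg: "\<And>e. e > 0 \<Longrightarrow> \<exists>N. \<forall>m\<ge>N. \<forall>n\<ge>N. gsq_int S (\<lambda>x. g m x - g n x) < e"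
  shows "\<exists>u h. has_weak_gradient S u h \<and> (\<lambda>n. sq_int S (\<lambda>x. v n x - u x)) \<longlonglongrightarrow> 0 \<and>
    (\<lambda>n. gsq_int S (\<lambda>x. g n x - h x)) \<longlonglongrightarrow> 0"
proof -
  obtain u where u: "u \<in> L2 S" "(\<lambda>n. sq_int S (\<lambda>x. v n x - u x)) \<longlonglongrightarrow> 0"
    using L2_complete[OF S has_weak_gradientD(1)[OF hw] cv] by blast
  have d: "(\<lambda>x. (g m x - g n x) $ i) \<in> L2 S" for m n i
    using L2_diff[OF has_weak_gradientD(2)[OF hw, of m i] has_weak_gradientD(2)[OF hw, of n i]] by simp
  have "\<exists>h\<in>L2 S. (\<lambda>n. sq_int S (\<lambda>x. g n x $ i - h x)) \<longlonglongrightarrow> 0" for i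
  proof (rule L2_complete[OF S has_weak_gradientD(2)[OF hw]])
    fix e :: real assume "e > 0"
    have "sq_int S (\<lambda>x. g m x $ i - g n x $ i) \<le> gsq_int S (\<lambda>x. g m x - g n x)" for m n
      unfolding gsq_int_eq(1)[OF d]
      using member_le_sum[of i UNIV "\<lambda>i. sq_int S (\<lambda>x. (g m x - g n x) $ i)"] by simp
    then show "\<exists>N. \<forall>m\<ge>N. \<forall>n\<ge>N. sq_int S (\<lambda>x. g m x $ i - g n x $ i) < e"
      using cg[OF \<open>e > 0\<close>] by (blast intro: le_less_trans)
  qed
  then have "\<forall>i. \<exists>h. h \<in> L2 S \<and> (\<lambda>n. sq_int S (\<lambda>x. g n x $ i - h x)) \<longlonglongrightarrow> 0" by blast
  from choice[OF this] obtain h where h: "\<And>i. h i \<in> L2 S" "\<And>i. (\<lambda>n. sq_int S (\<lambda>x. g n x $ i - h i x)) \<longlonglongrightarrow> 0"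
    by blast
  define H where "H = (\<lambda>x. \<chi> i. h i x)"
  have H: "(\<lambda>x. H x $ i) \<in> L2 S" "(\<lambda>n. sq_int S (\<lambda>x. g n x $ i - H x $ i)) \<longlonglongrightarrow> 0" for i
    using h[of i] by (simp_all add: H_def)
  have "(\<lambda>x. (g n x - H x) $ i) \<in> L2 S" for n i
    using L2_diff[OF has_weak_gradientD(2)[OF hw, of n i] H(1)[of i]] by simp
  from gsq_int_eq(1)[OF this]
  have "(\<lambda>n. gsq_int S (\<lambda>x. g n x - H x)) = (\<lambda>n. \<Sum>i\<in>UNIV. sq_int S (\<lambda>x. g n x $ i - H x $ i))" by simp
  moreover have "(\<lambda>n. \<Sum>i\<in>UNIV. sq_int S (\<lambda>x. g n x $ i - H x $ i)) \<longlonglongrightarrow> 0"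
    by (intro tendsto_null_sum H)
  ultimately have "(\<lambda>n. gsq_int S (\<lambda>x. g n x - H x)) \<longlonglongrightarrow> 0" by simp
  then show ?thesis using has_weak_gradient_limit[OF S hw u H] u by blast
qed

section \<open>Integration by parts and translations\<close>

text \<open>The parameter sits in the smooth factor, so only \<open>\<psi>\<close> is
  differentiated. By the mean value theorem its difference quotients are bounded by the gradient
  bound times |z|, which makes a multiple of |v| a dominating function.\<close>

lemma integral_shift_derivative:
  assumes K: "K \<in> lmeasurable" and v: "v \<in> L2 K" and \<psi>: "\<psi> \<in> test_functions T"
  shows "((\<lambda>s. LINT y|lebesgue_on K. v y * \<psi> (y - s *\<^sub>R z)) has_real_derivative
    - (LINT y|lebesgue_on K. v y * (gradient \<psi> (y - s *\<^sub>R z) \<bullet> z))) (at s)"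
proof -
  let ?M = "lebesgue_on K"
  obtain M where M: "M > 0" "\<And>x. norm (gradient \<psi> x) \<le> M" using test_functions_gradient_bounded[OF \<psi>] by metis
  have d: "((\<lambda>t. \<psi> (y - t *\<^sub>R z)) has_real_derivative - (gradient \<psi> (y - t *\<^sub>R z) \<bullet> z)) (at t)" for y t
  proof -
    have "((\<lambda>t. \<psi> (y - t *\<^sub>R z)) has_derivative (\<lambda>h. gradient \<psi> (y - t *\<^sub>R z) \<bullet> (- (h *\<^sub>R z)))) (at t)"
      by (rule has_derivative_compose[of "\<lambda>t. y - t *\<^sub>R z" "\<lambda>h. - (h *\<^sub>R z)" t UNIV \<psi>])
         (auto intro!: derivative_eq_intros has_derivative_gradient test_functions_continuous(2)[OF \<psi>])
    moreover have "(\<lambda>h. gradient \<psi> (y - t *\<^sub>R z) \<bullet> (- (h *\<^sub>R z))) = (*) (- (gradient \<psi> (y - t *\<^sub>R z) \<bullet> z))"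
      by (auto simp: mult.commute)
    ultimately show ?thesis unfolding has_field_derivative_def by simp
  qed
  have bd: "\<bar>(\<psi> (y - (s + h) *\<^sub>R z) - \<psi> (y - s *\<^sub>R z)) / h\<bar> \<le> M * norm z" if "h \<noteq> 0" for y h
  proof -
    have "\<bar>\<psi> (y - (s + h) *\<^sub>R z) - \<psi> (y - s *\<^sub>R z)\<bar> \<le> (M * norm z) * \<bar>(s + h) - s\<bar>"
    proof (rule field_differentiable_bound[of UNIV "\<lambda>t. \<psi> (y - t *\<^sub>R z)", unfolded real_norm_def])
      show "\<bar>- (gradient \<psi> (y - t *\<^sub>R z) \<bullet> z)\<bar> \<le> M * norm z" for t
        using Cauchy_Schwarz_ineq2[of "gradient \<psi> (y - t *\<^sub>R z)" z] mult_right_mono[OF M(2), of "norm z"]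
        by (metis abs_minus_cancel norm_ge_zero order_trans)
    qed (use d in \<open>auto intro: has_field_derivative_at_within\<close>)
    then show ?thesis using that by (simp add: field_simps)
  qed
  have vm[measurable]: "v \<in> borel_measurable ?M" and vi: "integrable ?M v"
    using v L2_integrable[OF K v] by (auto simp: L2_def)
  have psi_m[measurable]: "(\<lambda>y. \<psi> (y - t *\<^sub>R z)) \<in> borel_measurable ?M" for t
  proof -
    have "continuous_on UNIV (\<lambda>y. \<psi> (y - t *\<^sub>R z))"
      by (rule continuous_on_compose2[OF test_functions_continuous(1)[OF \<psi>]]) (auto intro: continuous_intros)
    from borel_measurable_continuous_onI[OF this] show ?thesis
      by (intro measurable_restrict_space1) (simp add: measurable_completion)
  qed
  have int: "integrable ?M (\<lambda>y. v y * \<psi> (y - t *\<^sub>R z))" for t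
  proof -
    obtain B where B: "\<And>x. \<bar>\<psi> x\<bar> \<le> B" using test_functions_bounded[OF \<psi>] by metis
    show ?thesis
    proof (rule Bochner_Integration.integrable_bound[of _ "\<lambda>y. B * v y"])
      show "AE y in ?M. norm (v y * \<psi> (y - t *\<^sub>R z)) \<le> norm (B * v y)"
      proof (rule AE_I2)
        fix y
        have "\<bar>\<psi> (y - t *\<^sub>R z)\<bar> \<le> \<bar>B\<bar>" using B[of "y - t *\<^sub>R z"] by linarith
        then show "norm (v y * \<psi> (y - t *\<^sub>R z)) \<le> norm (B * v y)"
          using mult_left_mono[of "\<bar>\<psi> (y - t *\<^sub>R z)\<bar>" "\<bar>B\<bar>" "\<bar>v y\<bar>"] by (simp add: abs_mult mult.commute)
      qed
    qed (use vi in auto)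
  qed
  show ?thesis
    unfolding DERIV_def tendsto_at_iff_sequentially
  proof (intro allI impI)
    fix X :: "nat \<Rightarrow> real" assume X: "\<forall>i. X i \<in> UNIV - {0}" "X \<longlonglongrightarrow> 0"
    let ?q = "\<lambda>n y. v y * ((\<psi> (y - (s + X n) *\<^sub>R z) - \<psi> (y - s *\<^sub>R z)) / X n)"
    have lim: "(\<lambda>n. LINT y|?M. ?q n y) \<longlonglongrightarrow> (LINT y|?M. v y * - (gradient \<psi> (y - s *\<^sub>R z) \<bullet> z))"
    proof (rule integral_dominated_convergence[where w="\<lambda>y. (M * norm z) * \<bar>v y\<bar>"])
      have lim: "(\<lambda>n. ?q n y) \<longlonglongrightarrow> v y * - (gradient \<psi> (y - s *\<^sub>R z) \<bullet> z)" for y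
        using d[of y s] X unfolding DERIV_def tendsto_at_iff_sequentially
        by (intro tendsto_mult_left) (auto simp: o_def)
      then show "AE y in ?M. (\<lambda>n. ?q n y) \<longlonglongrightarrow> v y * - (gradient \<psi> (y - s *\<^sub>R z) \<bullet> z)" by simp
      show "(\<lambda>y. v y * - (gradient \<psi> (y - s *\<^sub>R z) \<bullet> z)) \<in> borel_measurable ?M"
        by (rule borel_measurable_LIMSEQ_real[OF lim]) measurable
      show "AE y in ?M. norm (?q n y) \<le> (M * norm z) * \<bar>v y\<bar>" for n
      proof (rule AE_I2)
        fix y
        have "\<bar>v y\<bar> * \<bar>(\<psi> (y - (s + X n) *\<^sub>R z) - \<psi> (y - s *\<^sub>R z)) / X n\<bar> \<le> \<bar>v y\<bar> * (M * norm z)"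
          using bd[of "X n" y] X(1) by (intro mult_left_mono) auto
        then show "norm (?q n y) \<le> (M * norm z) * \<bar>v y\<bar>" by (simp add: abs_mult mult.commute)
      qed
    qed (use vi in auto)
    have "(LINT y|?M. ?q n y) =
        ((LINT y|?M. v y * \<psi> (y - (s + X n) *\<^sub>R z)) - (LINT y|?M. v y * \<psi> (y - s *\<^sub>R z))) / X n" for n
    proof -
      have "(LINT y|?M. ?q n y) = (LINT y|?M. (v y * \<psi> (y - (s + X n) *\<^sub>R z) - v y * \<psi> (y - s *\<^sub>R z)) / X n)"
        by (simp add: algebra_simps)
      then show ?thesis by (simp add: int)
    qed
    from lim[unfolded this] show "((\<lambda>h. ((LINT y|?M. v y * \<psi> (y - (s + h) *\<^sub>R z)) - (LINT y|?M. v y * \<psi> (y - s *\<^sub>R z))) / h) \<circ> X)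
        \<longlonglongrightarrow> - (LINT y|?M. v y * (gradient \<psi> (y - s *\<^sub>R z) \<bullet> z))"
      by (simp add: o_def)
  qed
qed

text \<open>By translation invariance the integral of the shifted function does not depend on a
  small shift, so its derivative at shift 0 vanishes; by \<open>integral_shift_derivative\<close>
  this derivative is minus the integral of the partial derivative.\<close>

lemma test_function_gradient_integral_zero:
  assumes S: "S \<in> lmeasurable" and \<xi>: "\<xi> \<in> test_functions S"
  shows "(LINT x|lebesgue_on S. gradient \<xi> x $ i) = 0"
proof -
  let ?C = "closure {x. \<xi> x \<noteq> 0}"
  have C: "compact ?C" "?C \<subseteq> S" using \<xi> by (auto simp: test_functions_def)
  have Cm: "?C \<in> sets lebesgue" using C(1) by (simp add: lmeasurable_compact fmeasurableD)
  obtain r where r: "?C \<subseteq> ball 0 r" using C(1) by (meson compact_imp_bounded bounded_subset_ballD)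
  \<comment> \<open>The radius exceeds that of the support by 1, so that shifts of length below 1
    keep the support inside \<open>K\<close>.\<close>
  define K where "K = ball (0::real^'a) (r + 1)"
  have K: "K \<in> lmeasurable" "?C \<subseteq> K" "K \<in> sets lebesgue" using r by (auto simp: K_def fmeasurableD)
  let ?z = "axis i 1 :: real^'a"
  have one: "(\<lambda>_. 1) \<in> L2 K" by (rule L2_bounded[OF K(1), of _ 1]) auto
  have const: "(LINT y|lebesgue_on K. 1 * \<xi> (y - s *\<^sub>R ?z)) = (LINT y|lebesgue_on K. 1 * \<xi> (y - 0 *\<^sub>R ?z))" if s: "\<bar>0 - s\<bar> < 1" for s
  proof -
    have sub: "(\<lambda>x. x + s *\<^sub>R ?z) ` ?C \<subseteq> K"
    proof -
      have "norm (x + s *\<^sub>R ?z) < r + 1" if "x \<in> ?C" for x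
        using norm_triangle_ineq[of x "s *\<^sub>R ?z"] r that s by (auto simp: norm_axis_1)
      then show ?thesis by (auto simp: K_def)
    qed
    have Cs: "(\<lambda>x. x + s *\<^sub>R ?z) ` ?C \<in> sets lebesgue"
      using lebesgue_sets_translation[OF Cm, of "s *\<^sub>R ?z"] by (simp add: add.commute)
    have z: "\<xi> x = 0" if "x \<notin> ?C" for x using that closure_subset[of "{x. \<xi> x \<noteq> 0}"] by auto
    have "(LINT y|lebesgue_on K. \<xi> (y - s *\<^sub>R ?z)) = (LINT y|lebesgue_on ((\<lambda>x. x + s *\<^sub>R ?z) ` ?C). \<xi> (y - s *\<^sub>R ?z))"
    proof (rule integral_zero_outside[OF sub Cs K(3)])
      fix x assume "x \<notin> (\<lambda>x. x + s *\<^sub>R ?z) ` ?C"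
      then have "x - s *\<^sub>R ?z \<notin> ?C" using image_eqI[of x "\<lambda>x. x + s *\<^sub>R ?z" "x - s *\<^sub>R ?z" ?C] by auto
      then show "\<xi> (x - s *\<^sub>R ?z) = 0" by (rule z)
    qed
    also have "\<dots> = (LINT y|lebesgue_on ?C. \<xi> (y + s *\<^sub>R ?z - s *\<^sub>R ?z))"
    proof (rule integral_translate_on(1)[OF Cm, symmetric])
      have "continuous_on UNIV (\<lambda>y. \<xi> (y - s *\<^sub>R ?z))"
        by (rule continuous_on_compose2[OF test_functions_continuous(1)[OF \<xi>]]) (auto intro: continuous_intros)
      from borel_measurable_continuous_onI[OF this]
      show "(\<lambda>y. \<xi> (y - s *\<^sub>R ?z)) \<in> borel_measurable (lebesgue_on ((\<lambda>x. x + s *\<^sub>R ?z) ` ?C))"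
        by (intro measurable_restrict_space1) (simp add: measurable_completion)
    qed
    also have "\<dots> = (LINT y|lebesgue_on K. \<xi> y)"
    proof -
      have "(LINT y|lebesgue_on K. \<xi> y) = (LINT y|lebesgue_on ?C. \<xi> y)"
        by (rule integral_zero_outside[OF K(2) Cm K(3)]) (rule z)
      then show ?thesis by simp
    qed
    finally show ?thesis by simp
  qed
  have "- (LINT y|lebesgue_on K. 1 * (gradient \<xi> (y - 0 *\<^sub>R ?z) \<bullet> ?z)) = 0"
  proof (rule DERIV_local_const[OF integral_shift_derivative[OF K(1) one \<xi>, of ?z 0] zero_less_one], intro allI impI)
    fix s :: real assume "\<bar>0 - s\<bar> < 1"
    from const[OF this, symmetric]
    show "(LINT y|lebesgue_on K. 1 * \<xi> (y - 0 *\<^sub>R ?z)) = (LINT y|lebesgue_on K. 1 * \<xi> (y - s *\<^sub>R ?z))" .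
  qed
  then have "(LINT y|lebesgue_on K. gradient \<xi> y $ i) = 0" by (simp add: inner_axis)
  moreover have "(LINT y|lebesgue_on K. gradient \<xi> y $ i) = (LINT y|lebesgue_on ?C. gradient \<xi> y $ i)"
    by (rule integral_zero_outside[OF K(2) Cm K(3)]) (simp add: gradient_zero_outside_support)
  moreover have "(LINT y|lebesgue_on S. gradient \<xi> y $ i) = (LINT y|lebesgue_on ?C. gradient \<xi> y $ i)"
    by (rule integral_zero_outside[OF C(2) Cm fmeasurableD[OF S]]) (simp add: gradient_zero_outside_support)
  ultimately show ?thesis by simp
qed

text \<open>The product of \<open>\<phi>\<close> with a test function on \<open>S\<close> is again a
  test function on \<open>S\<close>, even if the support of \<open>\<phi>\<close> leaves
  \<open>S\<close>. The integral of its gradient vanishes, and the product rule makes this the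
  formula of integration by parts.\<close>

lemma test_function_has_weak_gradient:
  assumes S: "S \<in> lmeasurable" and \<phi>: "\<phi> \<in> test_functions T"
  shows "has_weak_gradient S \<phi> (gradient \<phi>)"
  unfolding has_weak_gradient_def
proof (intro conjI allI ballI)
  fix \<psi> i assume \<psi>: "\<psi> \<in> test_functions S"
  let ?\<xi> = "\<lambda>x. \<phi> x * \<psi> x"
  have "closure {x. ?\<xi> x \<noteq> 0} \<subseteq> closure {x. \<psi> x \<noteq> 0}" by (intro closure_mono) auto
  then have \<xi>: "?\<xi> \<in> test_functions S"
    using \<phi> \<psi> compact_eq_bounded_closed unfolding test_functions_def
    by (auto intro: cont_diff_mult bounded_subset)
  have "gradient ?\<xi> x $ i = \<phi> x * gradient \<psi> x $ i + gradient \<phi> x $ i * \<psi> x" for x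
    using gradient_eq[OF has_derivative_mult[OF has_derivative_gradient has_derivative_gradient, of \<phi> x \<psi>]]
      test_functions_continuous(2)[OF \<phi>] test_functions_continuous(2)[OF \<psi>] by (simp add: inner_axis)
  moreover note test_function_gradient_integral_zero[OF S \<xi>, of i]
  moreover have "integrable (lebesgue_on S) (\<lambda>x. \<phi> x * gradient \<psi> x $ i)"
    "integrable (lebesgue_on S) (\<lambda>x. gradient \<phi> x $ i * \<psi> x)"
    by (intro L2_integrable_mult test_function_L2[OF S \<phi>] test_function_L2[OF S \<psi>] test_gradient_L2[OF S \<phi>]
        test_gradient_L2[OF S \<psi>])+
  ultimately show "(LINT x|lebesgue_on S. \<phi> x * gradient \<psi> x $ i) = - (LINT x|lebesgue_on S. gradient \<phi> x $ i * \<psi> x)"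
    by simp
qed (use test_function_L2[OF S \<phi>] test_gradient_L2[OF S \<phi>] in auto)

text \<open>By duality, it suffices to test the difference with \<open>\<psi>\<close>; then the derivative in \<open>s\<close> of
  \<open>\<integral> v(y) \<psi>(y - s z) dy\<close> is \<open>\<integral> (g \<bullet> z)(y) \<psi>(y - s z) dy\<close>.\<close>

lemma translation_estimate:
  fixes A K :: "(real^'d) set"
  assumes A: "open A" "bounded A" and K: "open K" "bounded K" and hw: "has_weak_gradient K v g"
    and seg: "\<And>x s. x \<in> A \<Longrightarrow> s \<in> {0..1} \<Longrightarrow> x + s *\<^sub>R z \<in> K"
  shows "(\<lambda>x. v (x + z) - v x) \<in> L2 A"
    and "sq_int A (\<lambda>x. v (x + z) - v x) \<le> (norm z)\<^sup>2 * gsq_int K g"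
proof -
  have Am: "A \<in> lmeasurable" and Km: "K \<in> lmeasurable" using A K by (auto simp: lmeasurable_open)
  note As = fmeasurableD[OF Am] and Ks = fmeasurableD[OF Km]
  have AK: "A \<subseteq> K" using seg[of _ 0] by auto
  have sh: "(\<lambda>x. x + s *\<^sub>R z) ` A \<subseteq> K" if "s \<in> {0..1}" for s using seg that by auto
  have shm: "(\<lambda>x. x + s *\<^sub>R z) ` A \<in> sets lebesgue" for s
    using lebesgue_sets_translation[OF As, of "s *\<^sub>R z"] by (simp add: add.commute)
  note vL = has_weak_gradientD(1)[OF hw] and gL = has_weak_gradientD(2)[OF hw]
  have gzL: "(\<lambda>x. g x \<bullet> z) \<in> L2 K"
  proof -
    have "(\<lambda>x. \<Sum>i\<in>UNIV. z $ i * g x $ i) \<in> L2 K" using l2.sum_closed[OF vL, of UNIV "\<lambda>i x. g x $ i" "\<lambda>i. z $ i"] gL by simp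
    then show ?thesis by (simp add: inner_vec_def mult.commute)
  qed
  have vA: "v \<in> L2 A" by (rule L2_subset[OF AK As Ks vL])
  have vzA: "(\<lambda>x. v (x + z)) \<in> L2 A"
    using L2_translate(1)[OF As L2_subset[OF sh[of 1] shm Ks vL, simplified]] by simp
  show dL: "(\<lambda>x. v (x + z) - v x) \<in> L2 A" by (rule L2_diff[OF vzA vA])
  define G where "G = sqrt (sq_int K (\<lambda>x. g x \<bullet> z))"
  have main: "\<bar>LINT x|lebesgue_on A. (v (x + z) - v x) * \<psi> x\<bar> \<le> G * sqrt (sq_int A \<psi>)"
    if \<psi>: "\<psi> \<in> test_functions A" for \<psi>
  proof -
    \<comment> \<open>\<open>F s\<close> is the integral of v(x + s z) \<psi>(x) over
      \<open>A\<close>, with the shift moved from \<open>v\<close> to the smooth factor so that it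
      can be differentiated in \<open>s\<close>.\<close>
    define F where "F = (\<lambda>s. LINT y|lebesgue_on K. v y * \<psi> (y - s *\<^sub>R z))"
    define \<eta> where "\<eta> = (\<lambda>s y. \<psi> (y + - (s *\<^sub>R z)))"
    have \<eta>: "\<eta> s \<in> test_functions K" if "s \<in> {0..1}" for s
    proof -
      have "\<eta> s \<in> test_functions ((\<lambda>x. x - - (s *\<^sub>R z)) ` A)"
        unfolding \<eta>_def by (rule test_functions_translate[OF \<psi>])
      then show ?thesis using test_functions_mono[OF sh[OF that]] by auto
    qed
    have off: "\<eta> s y = 0" if "y \<notin> (\<lambda>x. x + s *\<^sub>R z) ` A" for s y
    proof -
      have "y - s *\<^sub>R z \<notin> A" using that image_eqI[of y "\<lambda>x. x + s *\<^sub>R z" "y - s *\<^sub>R z" A] by auto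
      then show ?thesis using test_functions_zero_outside[OF \<psi>] by (simp add: \<eta>_def)
    qed
    have sq: "sq_int K (\<eta> s) = sq_int A \<psi>" if s: "s \<in> {0..1}" for s
    proof -
      have "sq_int K (\<eta> s) = sq_int ((\<lambda>x. x + s *\<^sub>R z) ` A) (\<eta> s)"
        by (rule integral_zero_outside[OF sh[OF s] shm Ks]) (simp add: off)
      also have "\<dots> = sq_int A (\<lambda>x. \<eta> s (x + s *\<^sub>R z))"
        by (rule L2_translate(2)[OF As, symmetric]) (rule L2_subset[OF sh[OF s] shm Ks test_function_L2[OF Km \<eta>[OF s]]])
      finally show ?thesis by (simp add: \<eta>_def)
    qed
    have F_eq: "F s = (LINT x|lebesgue_on A. v (x + s *\<^sub>R z) * \<psi> x)" if s: "s \<in> {0..1}" for s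
    proof -
      have "F s = (LINT y|lebesgue_on ((\<lambda>x. x + s *\<^sub>R z) ` A). v y * \<eta> s y)"
        using integral_zero_outside[OF sh[OF s] shm Ks, of "\<lambda>y. v y * \<eta> s y"] off
        by (simp add: F_def \<eta>_def)
      also have "\<dots> = (LINT x|lebesgue_on A. v (x + s *\<^sub>R z) * \<eta> s (x + s *\<^sub>R z))"
      proof (rule integral_translate_on(1)[OF As, symmetric])
        show "(\<lambda>y. v y * \<eta> s y) \<in> borel_measurable (lebesgue_on ((\<lambda>x. x + s *\<^sub>R z) ` A))"
          using L2_subset[OF sh[OF s] shm Ks vL] L2_subset[OF sh[OF s] shm Ks test_function_L2[OF Km \<eta>[OF s]]]
          by (auto simp: L2_def)
      qed
      finally show ?thesis by (simp add: \<eta>_def)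
    qed
    \<comment> \<open>The hypothesis on segments makes the shifted \<open>\<psi>\<close> a test
      function on \<open>K\<close>, so the weak gradient may take over the derivative.
      Cauchy-Schwarz then separates the directional derivative of \<open>v\<close> from
      \<open>\<psi>\<close>, whose norm is unaffected by the shift.\<close>
    have F': "\<bar>- (LINT y|lebesgue_on K. v y * (gradient \<psi> (y - s *\<^sub>R z) \<bullet> z))\<bar> \<le> G * sqrt (sq_int A \<psi>)"
      if s: "s \<in> {0..1}" for s
    proof -
      have grad: "gradient (\<eta> s) y = gradient \<psi> (y - s *\<^sub>R z)" for y
        unfolding \<eta>_def using gradient_translate[OF \<psi>, of "- (s *\<^sub>R z)" y] by simp
      have "(LINT y|lebesgue_on K. v y * (gradient \<psi> (y - s *\<^sub>R z) \<bullet> z)) =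
          (LINT y|lebesgue_on K. v y * (\<Sum>i\<in>UNIV. z $ i * gradient (\<eta> s) y $ i))"
        by (simp add: inner_vec_def grad mult.commute)
      also have "\<dots> = (LINT y|lebesgue_on K. (\<Sum>i\<in>UNIV. z $ i * gradient (\<eta> s) y $ i) * v y)"
        by (simp add: mult.commute)
      also have "\<dots> = (\<Sum>i\<in>UNIV. z $ i * (LINT y|lebesgue_on K. gradient (\<eta> s) y $ i * v y))"
        by (rule l2.sum_left[OF vL]) (rule test_gradient_L2[OF Km \<eta>[OF s]])
      also have "\<dots> = (\<Sum>i\<in>UNIV. z $ i * - (LINT y|lebesgue_on K. g y $ i * \<eta> s y))"
        using has_weak_gradientD(3)[OF hw \<eta>[OF s]] by (simp add: mult.commute)
      also have "\<dots> = - (\<Sum>i\<in>UNIV. z $ i * (LINT y|lebesgue_on K. g y $ i * \<eta> s y))"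
        by (simp add: sum_negf)
      also have "(\<Sum>i\<in>UNIV. z $ i * (LINT y|lebesgue_on K. g y $ i * \<eta> s y)) =
          (LINT y|lebesgue_on K. (\<Sum>i\<in>UNIV. z $ i * g y $ i) * \<eta> s y)"
        by (rule l2.sum_left[symmetric]) (use test_function_L2[OF Km \<eta>[OF s]] gL in auto)
      also have "\<dots> = (LINT y|lebesgue_on K. (g y \<bullet> z) * \<eta> s y)"
        by (simp add: inner_vec_def mult.commute)
      finally show ?thesis
        using L2_abs_integral_le[OF gzL test_function_L2[OF Km \<eta>[OF s]]] by (simp add: G_def sq[OF s])
    qed
    have "norm (F 1 - F 0) \<le> (G * sqrt (sq_int A \<psi>)) * norm (1 - 0 :: real)"
    proof (rule field_differentiable_bound[of "{0..1}" F])
      show "(F has_real_derivative - (LINT y|lebesgue_on K. v y * (gradient \<psi> (y - s *\<^sub>R z) \<bullet> z))) (at s within {0..1})" for s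
        unfolding F_def by (rule has_field_derivative_at_within[OF integral_shift_derivative[OF Km vL \<psi>]])
    qed (use F' in auto)
    moreover have "F 1 - F 0 = (LINT x|lebesgue_on A. (v (x + z) - v x) * \<psi> x)"
      using l2.diff_left[OF vzA vA test_function_L2[OF Am \<psi>]] F_eq[of 1] F_eq[of 0] by simp
    ultimately show ?thesis by simp
  qed
  have "sq_int A (\<lambda>x. v (x + z) - v x) \<le> G\<^sup>2"
    by (rule sq_int_le_dual[OF A dL]) (use main in \<open>auto simp: G_def\<close>)
  also have "G\<^sup>2 = sq_int K (\<lambda>x. g x \<bullet> z)" by (simp add: G_def)
  also have "\<dots> \<le> (LINT x|lebesgue_on K. (norm z)\<^sup>2 * (norm (g x))\<^sup>2)"
  proof (rule integral_mono)
    show "(g x \<bullet> z)\<^sup>2 \<le> (norm z)\<^sup>2 * (norm (g x))\<^sup>2" for x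
      using power_mono[OF Cauchy_Schwarz_ineq2[of "g x" z] abs_ge_zero, of 2] by (simp add: power_mult_distrib mult.commute)
  qed (use gzL gsq_int_eq(2)[OF gL] in \<open>auto simp: L2_def\<close>)
  also have "\<dots> = (norm z)\<^sup>2 * gsq_int K g" by simp
  finally show "sq_int A (\<lambda>x. v (x + z) - v x) \<le> (norm z)\<^sup>2 * gsq_int K g" .
qed

section \<open>Poincare inequalities\<close>

text \<open>Expanding the square, the left-hand side is the double integral of (v x - v y)^2 over Q
  x Q. With y = x + z and the integration over x carried out first,
  \<open>translation_estimate\<close> bounds each slice by D^2 times the integral of |g|^2, and
  slices with |z| > D are empty; the volume of the ball of radius \<open>D\<close> is what the
  integration over z leaves. Borel measurability of \<open>v\<close> on the whole space makes the
  integrand jointly measurable, as exchanging the integrals requires.\<close>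

lemma poincare_borel:
  fixes Q :: "(real^'d) set"
  assumes Q: "open Q" "convex Q" "bounded Q" and D: "\<And>x y. x \<in> Q \<Longrightarrow> y \<in> Q \<Longrightarrow> norm (x - y) \<le> D"
    and hw: "has_weak_gradient Q v g" and v: "v \<in> borel_measurable borel"
  shows "2 * measure lebesgue Q * sq_int Q v - 2 * (LINT x|lebesgue_on Q. v x)\<^sup>2
    \<le> measure lebesgue (cball (0::real^'d) D) * D\<^sup>2 * gsq_int Q g"
proof -
  note [measurable] = v
  have Qm: "Q \<in> lmeasurable" and Qs: "Q \<in> sets lebesgue" and Qb[measurable]: "Q \<in> sets borel"
    using Q by (auto simp: lmeasurable_open)
  let ?M = "lebesgue_on Q"
  interpret fin: finite_measure ?M using Qm by (rule finite_measure_lebesgue_on)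
  note vL = has_weak_gradientD(1)[OF hw]
  have vi: "integrable ?M v" "integrable ?M (\<lambda>x. (v x)\<^sup>2)"
    using L2_integrable[OF Qm vL] vL by (auto simp: L2_def)
  have mQ: "measure ?M Q = measure lebesgue Q"
    using Qs by (simp add: measure_restrict_space)
  define q where "q = measure lebesgue Q"
  define s where "s = sq_int Q v"
  define m where "m = (LINT x|?M. v x)"
  have one: "measure ?M Q = q" using mQ by (simp add: q_def)
  have conv: "(\<integral>\<^sup>+x. indicator Q x * h x \<partial>lborel) = (\<integral>\<^sup>+x. h x \<partial>?M)" for h :: "real^'d \<Rightarrow> ennreal"
    using Qs by (simp add: nn_integral_restrict_space nn_integral_completion mult.commute)
  have sq: "0 \<le> (v x)\<^sup>2 - 2 * v x * v y + (v y)\<^sup>2" for x y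
    using sum_squares_bound[of "v x" "v y"] by simp
  define F where "F = (\<lambda>x y. indicator Q x * (indicator Q y * ennreal ((v x - v y)\<^sup>2)))"
  have inner: "(\<integral>\<^sup>+y. F x y \<partial>lborel) = indicator Q x * ennreal ((v x)\<^sup>2 * q - 2 * v x * m + s)" for x
  proof -
    have i: "integrable ?M (\<lambda>y. (v x)\<^sup>2 - 2 * v x * v y + (v y)\<^sup>2)"
      using vi by (intro Bochner_Integration.integrable_add Bochner_Integration.integrable_diff) auto
    have "(\<integral>\<^sup>+y. ennreal ((v x - v y)\<^sup>2) \<partial>?M) = (\<integral>\<^sup>+y. ennreal ((v x)\<^sup>2 - 2 * v x * v y + (v y)\<^sup>2) \<partial>?M)"
      by (simp add: power2_diff algebra_simps)
    also have "\<dots> = ennreal (LINT y|?M. (v x)\<^sup>2 - 2 * v x * v y + (v y)\<^sup>2)"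
      by (rule nn_integral_eq_integral[OF i]) (use sq in \<open>auto intro!: AE_I2\<close>)
    also have "(LINT y|?M. (v x)\<^sup>2 - 2 * v x * v y + (v y)\<^sup>2) = (v x)\<^sup>2 * q - 2 * v x * m + s"
      using vi by (simp add: one s_def m_def mult.commute)
    finally show ?thesis
      unfolding F_def by (simp add: nn_integral_cmult conv)
  qed
  have total: "(\<integral>\<^sup>+x. (\<integral>\<^sup>+y. F x y \<partial>lborel) \<partial>lborel) = ennreal (2 * q * s - 2 * m\<^sup>2)"
  proof -
    have i: "integrable ?M (\<lambda>x. (v x)\<^sup>2 * q - 2 * v x * m + s)"
      using vi by (intro Bochner_Integration.integrable_add Bochner_Integration.integrable_diff) auto
    have p: "(v x)\<^sup>2 * q - 2 * v x * m + s \<ge> 0" for x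
    proof -
      have "(v x)\<^sup>2 * q - 2 * v x * m + s = (LINT y|?M. (v x)\<^sup>2 - 2 * v x * v y + (v y)\<^sup>2)"
        using vi by (simp add: one s_def m_def mult.commute)
      also have "\<dots> \<ge> 0" by (rule Bochner_Integration.integral_nonneg) (use sq in auto)
      finally show ?thesis .
    qed
    have "(\<integral>\<^sup>+x. (\<integral>\<^sup>+y. F x y \<partial>lborel) \<partial>lborel) = (\<integral>\<^sup>+x. ennreal ((v x)\<^sup>2 * q - 2 * v x * m + s) \<partial>?M)"
      unfolding inner by (rule conv)
    also have "\<dots> = ennreal (LINT x|?M. (v x)\<^sup>2 * q - 2 * v x * m + s)"
      by (rule nn_integral_eq_integral[OF i]) (use p in auto)
    also have "(LINT x|?M. (v x)\<^sup>2 * q - 2 * v x * m + s) = 2 * q * s - 2 * m\<^sup>2"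
      using vi by (simp add: one flip: s_def m_def) (simp add: power2_eq_square)
    finally show ?thesis .
  qed
  \<comment> \<open>For fixed z only those x count for which x and x + z both lie in
    \<open>Q\<close>; by convexity the whole segment does, as the translation estimate
    demands.\<close>
  have slice: "(\<integral>\<^sup>+x. F x (x + z) \<partial>lborel) \<le> indicator (cball 0 D) z * ennreal (D\<^sup>2 * gsq_int Q g)" for z
  proof -
    define A where "A = {x\<in>Q. x + z \<in> Q}"
    have Aeq: "A = Q \<inter> (\<lambda>x. x - z) ` Q"
      by (auto simp: A_def) (metis add_diff_cancel image_iff)
    have A: "open A" "bounded A" unfolding Aeq using Q
      by (auto intro: open_translation_subtract bounded_subset)
    then have [measurable]: "A \<in> sets borel" by auto
    have "(\<integral>\<^sup>+x. F x (x + z) \<partial>lborel) = (\<integral>\<^sup>+x. indicator A x * ennreal ((v (x + z) - v x)\<^sup>2) \<partial>lborel)"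
      by (intro nn_integral_cong) (auto simp: F_def A_def indicator_def power2_commute)
    also have "\<dots> = (\<integral>\<^sup>+x. ennreal ((v (x + z) - v x)\<^sup>2) \<partial>lebesgue_on A)"
      using A by (simp add: nn_integral_restrict_space nn_integral_completion mult.commute)
    also have "\<dots> \<le> indicator (cball 0 D) z * ennreal (D\<^sup>2 * gsq_int Q g)"
    proof (cases "A = {}")
      case True
      then show ?thesis by (simp add: nn_integral_restrict_space nn_integral_completion)
    next
      case False
      then obtain x where x: "x \<in> Q" "x + z \<in> Q" by (auto simp: A_def)
      then have z: "norm z \<le> D" using D[of "x + z" x] by simp
      have seg: "x + s *\<^sub>R z \<in> Q" if "x \<in> A" "s \<in> {0..1}" for x s
      proof -
        have "(1 - s) *\<^sub>R x + s *\<^sub>R (x + z) \<in> Q"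
          using that Q(2) by (intro convexD) (auto simp: A_def)
        then show ?thesis by (simp add: algebra_simps)
      qed
      note T = translation_estimate[OF A Q(1,3) hw seg]
      have "(\<integral>\<^sup>+x. ennreal ((v (x + z) - v x)\<^sup>2) \<partial>lebesgue_on A) = ennreal (sq_int A (\<lambda>x. v (x + z) - v x))"
        using T(1) by (intro nn_integral_eq_integral) (auto simp: L2_def)
      also have "\<dots> \<le> ennreal (D\<^sup>2 * gsq_int Q g)"
      proof (rule ennreal_leI)
        have "(norm z)\<^sup>2 * gsq_int Q g \<le> D\<^sup>2 * gsq_int Q g"
          using z by (intro mult_right_mono power_mono) auto
        then show "sq_int A (\<lambda>x. v (x + z) - v x) \<le> D\<^sup>2 * gsq_int Q g" using T(2) by linarith
      qed
      finally show ?thesis using z by simp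
    qed
    finally show ?thesis .
  qed
  have "(\<integral>\<^sup>+x. (\<integral>\<^sup>+y. F x y \<partial>lborel) \<partial>lborel) = (\<integral>\<^sup>+x. (\<integral>\<^sup>+z. F x (x + z) \<partial>lborel) \<partial>lborel)"
  proof (rule nn_integral_cong)
    fix x
    have "(\<integral>\<^sup>+y. F x y \<partial>lborel) = (\<integral>\<^sup>+y. F x y \<partial>distr lborel borel ((+) x))"
      by (simp add: lborel_distr_plus)
    also have "\<dots> = (\<integral>\<^sup>+z. F x (x + z) \<partial>lborel)"
      by (rule nn_integral_distr) (simp_all add: F_def)
    finally show "(\<integral>\<^sup>+y. F x y \<partial>lborel) = (\<integral>\<^sup>+z. F x (x + z) \<partial>lborel)" .
  qed
  also have "\<dots> = (\<integral>\<^sup>+z. (\<integral>\<^sup>+x. F x (x + z) \<partial>lborel) \<partial>lborel)"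
    by (rule lborel_pair.Fubini') (simp add: F_def)
  also have "\<dots> \<le> (\<integral>\<^sup>+z. indicator (cball (0::real^'d) D) z * ennreal (D\<^sup>2 * gsq_int Q g) \<partial>lborel)"
    by (intro nn_integral_mono slice)
  also have "\<dots> = ennreal (D\<^sup>2 * gsq_int Q g) * emeasure lborel (cball (0::real^'d) D)"
    by (subst nn_integral_multc) (auto intro!: borel_measurable_indicator simp: mult.commute)
  also have "emeasure lborel (cball (0::real^'d) D) = ennreal (measure lebesgue (cball (0::real^'d) D))"
    using emeasure_eq_ennreal_measure[of lborel "cball (0::real^'d) D"] emeasure_lborel_cball_finite[of "0::real^'d" D]
    by (simp add: measure_completion)
  also have "ennreal (D\<^sup>2 * gsq_int Q g) * ennreal (measure lebesgue (cball (0::real^'d) D)) =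
      ennreal (measure lebesgue (cball (0::real^'d) D) * D\<^sup>2 * gsq_int Q g)"
    by (subst ennreal_mult[symmetric]) (auto simp: mult.commute mult.left_commute)
  finally have "ennreal (2 * q * s - 2 * m\<^sup>2) \<le> ennreal (measure lebesgue (cball (0::real^'d) D) * D\<^sup>2 * gsq_int Q g)"
    unfolding total .
  then show ?thesis unfolding q_def s_def m_def
    by (subst (asm) ennreal_le_iff) auto
qed

lemma borel_representative:
  assumes S: "S \<in> sets lebesgue" and v: "v \<in> borel_measurable (lebesgue_on S)"
  obtains w :: "'a::euclidean_space \<Rightarrow> real" where "w \<in> borel_measurable borel" "AE x in lebesgue_on S. v x = w x"
proof -
  have "(\<lambda>x. indicator S x *\<^sub>R v x) \<in> borel_measurable lebesgue"
    using v S borel_measurable_restrict_space_iff[of S lebesgue v] by simp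
  then obtain w where w: "w \<in> borel_measurable lborel" "AE x in lborel. indicator S x *\<^sub>R v x = w x"
    using completion_ex_borel_measurable_real by blast
  have "AE x in lebesgue. x \<in> S \<longrightarrow> v x = w x"
    using AE_completion[OF w(2)] by eventually_elim (metis indicator_simps(1) scaleR_one)
  then have "AE x in lebesgue_on S. v x = w x" using S by (simp add: AE_restrict_space_iff)
  then show thesis using that w(1) by simp
qed

text \<open>Both sides depend only on the class of \<open>v\<close> modulo null sets, so a Borel
  representative may replace it.\<close>

lemma poincare:
  fixes Q :: "(real^'d) set"
  assumes Q: "open Q" "convex Q" "bounded Q" and D: "\<And>x y. x \<in> Q \<Longrightarrow> y \<in> Q \<Longrightarrow> norm (x - y) \<le> D"
    and hw: "has_weak_gradient Q v g"
  shows "2 * measure lebesgue Q * sq_int Q v - 2 * (LINT x|lebesgue_on Q. v x)\<^sup>2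
    \<le> measure lebesgue (cball (0::real^'d) D) * D\<^sup>2 * gsq_int Q g"
proof -
  have Qm: "Q \<in> lmeasurable" and Qs: "Q \<in> sets lebesgue" using Q by (auto simp: lmeasurable_open)
  have vm: "v \<in> borel_measurable (lebesgue_on Q)" using has_weak_gradientD(1)[OF hw] by (simp add: L2_def)
  obtain w where w: "w \<in> borel_measurable borel" "AE x in lebesgue_on Q. v x = w x"
    using borel_representative[OF Qs vm] .
  have wm: "w \<in> borel_measurable (lebesgue_on Q)"
    by (rule borel_measurable_lebesgue_on_AE_eq[OF Qs w(2) vm])
  have "sq_int Q v = sq_int Q w"
    by (rule integral_cong_AE) (use w(2) vm wm in \<open>auto elim: eventually_mono\<close>)
  moreover have "(LINT x|lebesgue_on Q. v x) = (LINT x|lebesgue_on Q. w x)"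
    by (rule integral_cong_AE[OF vm wm w(2)])
  ultimately show ?thesis
    using poincare_borel[OF Q D has_weak_gradient_AE_eq[OF Qm hw w(2)] w(1)] by simp
qed

text \<open>With vanishing gradient the Poincare inequality makes \<open>v\<close> constant almost
  everywhere on each ball. Constants of overlapping balls agree, since the overlap is open and
  nonempty and so not a null set; connectedness then gives one constant for all of
  \<open>K\<close>.\<close>

lemma zero_gradient_const:
  fixes K :: "(real^'d) set"
  assumes K: "open K" "bounded K" "connected K" and hw: "has_weak_gradient K v g"
    and g: "gsq_int K g = 0"
  shows "\<exists>c. AE x in lebesgue_on K. v x = c"
proof -
  have Ks: "K \<in> sets lebesgue" using K by auto
  have "\<exists>q. fst q > 0 \<and> ball p (fst q) \<subseteq> K \<and> negligible {x\<in>ball p (fst q). v x \<noteq> snd q}" if "p \<in> K" for p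
  proof -
    obtain r where r: "r > 0" "ball p r \<subseteq> K" using K(1) \<open>p \<in> K\<close> openE by blast
    let ?B = "ball p r"
    have B: "?B \<in> lmeasurable" "?B \<in> sets lebesgue" by auto
    have hB: "has_weak_gradient ?B v g" by (rule has_weak_gradient_subset[OF r(2) B(2) Ks hw])
    have "gsq_int ?B g \<le> gsq_int K g"
      by (rule integral_nonneg_subset[OF r(2) B(2) Ks gsq_int_eq(2)]) (use has_weak_gradientD[OF hw] in auto)
    then have g0: "gsq_int ?B g = 0" using g by (simp add: antisym)
    have D: "norm (x - y) \<le> 2 * r" if "x \<in> ?B" "y \<in> ?B" for x y
      using that norm_triangle_ineq4[of "x - p" "y - p"] by (simp add: dist_norm norm_minus_commute)
    define q where "q = measure lebesgue ?B"
    define m where "m = (LINT x|lebesgue_on ?B. v x)"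
    have q: "q > 0" using r(1) by (simp add: q_def content_ball_pos measure_completion)
    have le: "q * sq_int ?B v \<le> m\<^sup>2"
      using poincare[OF _ _ _ D hB] g0 by (simp add: q_def m_def)
    interpret fin: finite_measure "lebesgue_on ?B" using B(1) by (rule finite_measure_lebesgue_on)
    note vL = has_weak_gradientD(1)[OF hB]
    have vi: "integrable (lebesgue_on ?B) v" "integrable (lebesgue_on ?B) (\<lambda>x. (v x)\<^sup>2)"
      using L2_integrable[OF B(1) vL] vL by (auto simp: L2_def)
    have one: "measure (lebesgue_on ?B) ?B = q" using B by (simp add: q_def measure_restrict_space)
    \<comment> \<open>The mean value of \<open>v\<close> on the ball. The square integral of v - c
      equals that of \<open>v\<close> minus m^2 / q, which \<open>le\<close> makes
      nonpositive.\<close>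
    define c where "c = m / q"
    have cL: "(\<lambda>_. c) \<in> L2 ?B" by (rule L2_bounded[OF B(1), of _ "\<bar>c\<bar>"]) auto
    have "sq_int ?B (\<lambda>x. v x - c) = sq_int ?B v - 2 * (m * c) + q * c\<^sup>2"
      using l2.expand_diff[OF vL cL] by (simp add: sq_int_eq one m_def power2_eq_square[of c])
    also have "\<dots> = sq_int ?B v - m\<^sup>2 / q" using q by (simp add: c_def field_simps power2_eq_square)
    also have "\<dots> \<le> 0" using le q by (simp add: field_simps)
    finally have "sq_int ?B (\<lambda>x. v x - c) = 0" using sq_int_nonneg[of ?B "\<lambda>x. v x - c"] by linarith
    then have "AE x in lebesgue_on ?B. v x - c = 0" using sq_int_zero_iff[OF L2_diff[OF vL cL]] by simp
    then have "negligible {x\<in>?B. v x \<noteq> c}" using AE_lebesgue_on_iff_negligible[OF B(2)] by simp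
    then show ?thesis using r by (intro exI[of _ "(r, c)"]) simp
  qed
  then have "\<forall>p\<in>K. \<exists>q. fst q > 0 \<and> ball p (fst q) \<subseteq> K \<and> negligible {x\<in>ball p (fst q). v x \<noteq> snd q}" by blast
  from bchoice[OF this] obtain q where q: "\<And>p. p \<in> K \<Longrightarrow> fst (q p) > 0 \<and> ball p (fst (q p)) \<subseteq> K \<and>
      negligible {x\<in>ball p (fst (q p)). v x \<noteq> snd (q p)}" by blast
  define r where "r = (\<lambda>p. fst (q p))"
  define c where "c = (\<lambda>p. snd (q p))"
  have rc: "r p > 0 \<and> ball p (r p) \<subseteq> K \<and> negligible {x\<in>ball p (r p). v x \<noteq> c p}" if "p \<in> K" for p
    using q[OF that] by (simp add: r_def c_def)
  have same: "c p = c q" if "p \<in> K" "q \<in> ball p (r p)" for p q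
  proof (rule ccontr)
    assume ne: "c p \<noteq> c q"
    have "q \<in> K" using rc that by blast
    let ?I = "ball p (r p) \<inter> ball q (r q)"
    have "?I \<subseteq> {x\<in>ball p (r p). v x \<noteq> c p} \<union> {x\<in>ball q (r q). v x \<noteq> c q}" using ne by auto
    then have "negligible ?I" using rc[OF \<open>p \<in> K\<close>] rc[OF \<open>q \<in> K\<close>] by (meson negligible_Un negligible_subset)
    moreover have "open ?I" by auto
    moreover have "q \<in> ?I" using that rc[OF \<open>q \<in> K\<close>] by auto
    ultimately show False using open_not_negligible by blast
  qed
  show ?thesis
  proof (cases "K = {}")
    case True
    then show ?thesis by (auto intro!: AE_I2)
  next
    case False
    then obtain a where a: "a \<in> K" by blast
    have const: "c p = c a" if "p \<in> K" for p
    proof (rule connected_local_const[OF K(3) that a], rule ballI)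
      fix q assume "q \<in> K"
      then show "\<forall>\<^sub>F b in at q within K. c q = c b"
        unfolding eventually_at_topological using same rc[OF \<open>q \<in> K\<close>]
        by (intro exI[of _ "ball q (r q)"]) auto
    qed
    \<comment> \<open>Uncountably many balls are involved, but negligibility is a local property, so
      one ball around each point suffices.\<close>
    have "negligible {x\<in>K. v x \<noteq> c a}"
      unfolding locally_negligible_alt[of "{x\<in>K. v x \<noteq> c a}"]
    proof
      fix x assume x: "x \<in> {x\<in>K. v x \<noteq> c a}"
      then have "x \<in> K" by simp
      let ?U = "{x\<in>K. v x \<noteq> c a} \<inter> ball x (r x)"
      have "?U \<subseteq> {y\<in>ball x (r x). v y \<noteq> c x}" using const[OF \<open>x \<in> K\<close>] by auto
      then have "negligible ?U" using rc[OF \<open>x \<in> K\<close>] negligible_subset by blast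
      then show "\<exists>U. openin (top_of_set {x\<in>K. v x \<noteq> c a}) U \<and> x \<in> U \<and> negligible U"
        using x rc[OF \<open>x \<in> K\<close>] by (intro exI[of _ ?U]) (auto intro: openin_open_Int)
    qed
    then show ?thesis using AE_lebesgue_on_iff_negligible[OF Ks] by blast
  qed
qed

section \<open>The space of functions vanishing on the boundary\<close>

lemma gsq_int_lin_le:
  assumes g: "\<And>i. (\<lambda>x. g x $ i) \<in> L2 S" and h: "\<And>i. (\<lambda>x. h x $ i) \<in> L2 S"
  shows "gsq_int S (\<lambda>x. g x + c *\<^sub>R h x) \<le> 2 * gsq_int S g + 2 * c\<^sup>2 * gsq_int S h"
proof -
  have L: "(\<lambda>x. (g x + c *\<^sub>R h x) $ i) \<in> L2 S" for i using L2_lin[OF g h, of i c i] by simp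
  have "sq_int S (\<lambda>x. (g x + c *\<^sub>R h x) $ i) \<le> 2 * sq_int S (\<lambda>x. g x $ i) + 2 * c\<^sup>2 * sq_int S (\<lambda>x. h x $ i)" for i
    using l2.add_square_le[OF g[of i] l2.scale_closed[OF h[of i], of c]] by (simp add: sq_int_eq power_mult_distrib)
  then have "(\<Sum>i\<in>UNIV. sq_int S (\<lambda>x. (g x + c *\<^sub>R h x) $ i)) \<le>
      (\<Sum>i\<in>UNIV. 2 * sq_int S (\<lambda>x. g x $ i) + 2 * c\<^sup>2 * sq_int S (\<lambda>x. h x $ i))" by (rule sum_mono)
  then show ?thesis by (simp add: gsq_int_eq(1)[OF L] gsq_int_eq(1)[OF g] gsq_int_eq(1)[OF h] sum.distrib sum_distrib_left)
qed

lemma gsq_int_triangle: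
  assumes "\<And>i. (\<lambda>x. g x $ i) \<in> L2 S" "\<And>i. (\<lambda>x. h x $ i) \<in> L2 S" "\<And>i. (\<lambda>x. k x $ i) \<in> L2 S"
  shows "gsq_int S (\<lambda>x. g x - k x) \<le> 2 * gsq_int S (\<lambda>x. g x - h x) + 2 * gsq_int S (\<lambda>x. h x - k x)"
  using gsq_int_lin_le[of "\<lambda>x. g x - h x" S "\<lambda>x. h x - k x" 1] assms L2_diff by fastforce

text \<open>The definition of \<open>H10\<close> refers to the gradient selected by
  \<open>SOME\<close>. This form admits any weak gradient and replaces the sequence by an
  approximation to arbitrary accuracy, which suits linear combinations and changes on null
  sets.\<close>

lemma H10_iff:
  assumes S: "open S" "bounded S"
  shows "v \<in> H10 S \<longleftrightarrow> (\<exists>g. has_weak_gradient S v g \<and>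
    (\<forall>e>0. \<exists>\<phi>\<in>test_functions S. sq_int S (\<lambda>x. v x - \<phi> x) < e \<and> gsq_int S (\<lambda>x. g x - gradient \<phi> x) < e))"
  (is "_ \<longleftrightarrow> (\<exists>g. ?P g)")
proof
  assume v: "v \<in> H10 S"
  then obtain \<phi> where \<phi>: "\<And>n. \<phi> n \<in> test_functions S" "(\<lambda>n. sq_int S (\<lambda>x. v x - \<phi> n x)) \<longlonglongrightarrow> 0"
      "(\<lambda>n. gsq_int S (\<lambda>x. weak_gradient S v x - gradient (\<phi> n) x)) \<longlonglongrightarrow> 0"
    by (auto simp: H10_def)
  have "?P (weak_gradient S v)"
  proof (intro conjI allI impI)
    show "has_weak_gradient S v (weak_gradient S v)" using v by (auto simp: H10_def intro: H1_has_weak_gradient)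
    fix e :: real assume "e > 0"
    then have "\<forall>\<^sub>F n in sequentially. sq_int S (\<lambda>x. v x - \<phi> n x) < e \<and>
        gsq_int S (\<lambda>x. weak_gradient S v x - gradient (\<phi> n) x) < e"
      by (intro eventually_conj order_tendstoD(2)[OF \<phi>(2)] order_tendstoD(2)[OF \<phi>(3)])
    then obtain n where "sq_int S (\<lambda>x. v x - \<phi> n x) < e \<and> gsq_int S (\<lambda>x. weak_gradient S v x - gradient (\<phi> n) x) < e"
      using eventually_happens[of _ sequentially] by auto
    then show "\<exists>\<phi>\<in>test_functions S. sq_int S (\<lambda>x. v x - \<phi> x) < e \<and> gsq_int S (\<lambda>x. weak_gradient S v x - gradient \<phi> x) < e"
      using \<phi>(1) by blast
  qed
  then show "\<exists>g. ?P g" by blast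
next
  assume "\<exists>g. ?P g"
  then obtain g where g: "has_weak_gradient S v g" and
    a: "\<And>e. e > 0 \<Longrightarrow> \<exists>\<phi>\<in>test_functions S. sq_int S (\<lambda>x. v x - \<phi> x) < e \<and> gsq_int S (\<lambda>x. g x - gradient \<phi> x) < e"
    by blast
  have Sm: "S \<in> lmeasurable" using S by (simp add: lmeasurable_open)
  have "\<forall>n. \<exists>\<phi>. \<phi> \<in> test_functions S \<and> sq_int S (\<lambda>x. v x - \<phi> x) < 1 / real (Suc n) \<and>
      gsq_int S (\<lambda>x. g x - gradient \<phi> x) < 1 / real (Suc n)"
  proof
    fix n
    have "1 / real (Suc n) > 0" by simp
    from a[OF this] show "\<exists>\<phi>. \<phi> \<in> test_functions S \<and> sq_int S (\<lambda>x. v x - \<phi> x) < 1 / real (Suc n) \<and>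
      gsq_int S (\<lambda>x. g x - gradient \<phi> x) < 1 / real (Suc n)" by blast
  qed
  from choice[OF this] obtain \<phi> where \<phi>: "\<And>n. \<phi> n \<in> test_functions S"
    "\<And>n. sq_int S (\<lambda>x. v x - \<phi> n x) < 1 / real (Suc n)"
    "\<And>n. gsq_int S (\<lambda>x. g x - gradient (\<phi> n) x) < 1 / real (Suc n)" by blast
  have eq: "gsq_int S (\<lambda>x. weak_gradient S v x - gradient (\<phi> n) x) = gsq_int S (\<lambda>x. g x - gradient (\<phi> n) x)" for n
  proof (rule integral_cong_AE)
    have v1: "v \<in> H1 S" using g by (rule has_weak_gradient_H1)
    have L: "(\<lambda>x. (g x - gradient (\<phi> n) x) $ i) \<in> L2 S" if "has_weak_gradient S v g" for g i
      using L2_diff[OF has_weak_gradientD(2)[OF that, of i] test_gradient_L2[OF Sm \<phi>(1), of n i]] by simp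
    show "(\<lambda>x. (norm (weak_gradient S v x - gradient (\<phi> n) x))\<^sup>2) \<in> borel_measurable (lebesgue_on S)"
      "(\<lambda>x. (norm (g x - gradient (\<phi> n) x))\<^sup>2) \<in> borel_measurable (lebesgue_on S)"
      using gsq_int_eq(2)[OF L[OF H1_has_weak_gradient[OF v1]]] gsq_int_eq(2)[OF L[OF g]] by auto
    show "AE x in lebesgue_on S. (norm (weak_gradient S v x - gradient (\<phi> n) x))\<^sup>2 = (norm (g x - gradient (\<phi> n) x))\<^sup>2"
      using weak_gradient_eq[OF S g] by eventually_elim simp
  qed
  have lim: "(\<lambda>n. 1 / real (Suc n)) \<longlonglongrightarrow> 0" by (rule LIMSEQ_Suc[OF lim_1_over_n])
  have "(\<lambda>n. sq_int S (\<lambda>x. v x - \<phi> n x)) \<longlonglongrightarrow> 0"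
    by (rule tendsto_sandwich[OF _ _ tendsto_const lim]) (use \<phi>(2) in \<open>auto intro!: always_eventually less_imp_le\<close>)
  moreover have "(\<lambda>n. gsq_int S (\<lambda>x. weak_gradient S v x - gradient (\<phi> n) x)) \<longlonglongrightarrow> 0"
    unfolding eq
    by (rule tendsto_sandwich[OF _ _ tendsto_const lim]) (use \<phi>(3) in \<open>auto intro!: always_eventually less_imp_le\<close>)
  ultimately show "v \<in> H10 S" using \<phi>(1) has_weak_gradient_H1[OF g] unfolding H10_def by blast
qed

lemma H10_H1: "v \<in> H10 S \<Longrightarrow> v \<in> H1 S"
  by (simp add: H10_def)

lemma H10_AE_eq:
  assumes S: "open S" "bounded S" and v: "v \<in> H10 S" and eq: "AE x in lebesgue_on S. v x = u x"
  shows "u \<in> H10 S"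
proof -
  have Sm: "S \<in> lmeasurable" using S by (simp add: lmeasurable_open)
  obtain g where g: "has_weak_gradient S v g"
    "\<And>e. e > 0 \<Longrightarrow> \<exists>\<phi>\<in>test_functions S. sq_int S (\<lambda>x. v x - \<phi> x) < e \<and> gsq_int S (\<lambda>x. g x - gradient \<phi> x) < e"
    using v H10_iff[OF S] by blast
  have gu: "has_weak_gradient S u g" by (rule has_weak_gradient_AE_eq[OF Sm g(1) eq])
  have "sq_int S (\<lambda>x. u x - \<phi> x) = sq_int S (\<lambda>x. v x - \<phi> x)" if "\<phi> \<in> test_functions S" for \<phi>
  proof (rule integral_cong_AE)
    show "AE x in lebesgue_on S. (u x - \<phi> x)\<^sup>2 = (v x - \<phi> x)\<^sup>2" using eq by eventually_elim simp
  qed (use L2_diff[OF has_weak_gradientD(1)[OF gu] test_function_L2[OF Sm that]]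
      L2_diff[OF has_weak_gradientD(1)[OF g(1)] test_function_L2[OF Sm that]] in \<open>auto simp: L2_def\<close>)
  then show ?thesis unfolding H10_iff[OF S] using gu g(2) by (intro exI[of _ g]) auto
qed

lemma H10_lin:
  assumes S: "open S" "bounded S" and u: "u \<in> H10 S" and v: "v \<in> H10 S"
  shows "(\<lambda>x. u x + c * v x) \<in> H10 S"
proof -
  have Sm: "S \<in> lmeasurable" using S by (simp add: lmeasurable_open)
  obtain g where g: "has_weak_gradient S u g"
    "\<And>e. e > 0 \<Longrightarrow> \<exists>\<phi>\<in>test_functions S. sq_int S (\<lambda>x. u x - \<phi> x) < e \<and> gsq_int S (\<lambda>x. g x - gradient \<phi> x) < e"
    using u H10_iff[OF S] by blast
  obtain h where h: "has_weak_gradient S v h"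
    "\<And>e. e > 0 \<Longrightarrow> \<exists>\<phi>\<in>test_functions S. sq_int S (\<lambda>x. v x - \<phi> x) < e \<and> gsq_int S (\<lambda>x. h x - gradient \<phi> x) < e"
    using v H10_iff[OF S] by blast
  have "\<exists>\<phi>\<in>test_functions S. sq_int S (\<lambda>x. (u x + c * v x) - \<phi> x) < e \<and>
      gsq_int S (\<lambda>x. (g x + c *\<^sub>R h x) - gradient \<phi> x) < e" if "e > 0" for e
  proof -
    define d where "d = e / (2 + 2 * c\<^sup>2)"
    have p: "2 + 2 * c\<^sup>2 > 0" by (simp add: add_pos_nonneg)
    then have "(2 + 2 * c\<^sup>2) * d = e" by (simp add: d_def)
    then have d: "d > 0" "2 * d + 2 * c\<^sup>2 * d = e" using p that by (simp_all only: distrib_right) (simp add: d_def)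
    obtain \<phi> where \<phi>: "\<phi> \<in> test_functions S" "sq_int S (\<lambda>x. u x - \<phi> x) < d" "gsq_int S (\<lambda>x. g x - gradient \<phi> x) < d"
      using g(2)[OF d(1)] by blast
    obtain \<psi> where \<psi>: "\<psi> \<in> test_functions S" "sq_int S (\<lambda>x. v x - \<psi> x) < d" "gsq_int S (\<lambda>x. h x - gradient \<psi> x) < d"
      using h(2)[OF d(1)] by blast
    note L = test_function_L2[OF Sm \<phi>(1)] test_function_L2[OF Sm \<psi>(1)]
      test_gradient_L2[OF Sm \<phi>(1)] test_gradient_L2[OF Sm \<psi>(1)]
    have lt: "2 * a + 2 * c\<^sup>2 * b < e" if "a < d" "b < d" for a b
    proof -
      have "2 * c\<^sup>2 * b \<le> 2 * c\<^sup>2 * d" using that by (intro mult_left_mono) auto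
      then show ?thesis using that d by linarith
    qed
    have "sq_int S (\<lambda>x. (u x - \<phi> x) + c * (v x - \<psi> x)) \<le> 2 * sq_int S (\<lambda>x. u x - \<phi> x) + 2 * c\<^sup>2 * sq_int S (\<lambda>x. v x - \<psi> x)"
      using l2.add_square_le[OF L2_diff[OF has_weak_gradientD(1)[OF g(1)] L(1)]
          l2.scale_closed[OF L2_diff[OF has_weak_gradientD(1)[OF h(1)] L(2)], of c]]
      by (simp add: sq_int_eq power_mult_distrib)
    also have "\<dots> < e" by (rule lt[OF \<phi>(2) \<psi>(2)])
    finally have 1: "sq_int S (\<lambda>x. (u x + c * v x) - (\<phi> x + c * \<psi> x)) < e" by (simp add: algebra_simps)
    have "gsq_int S (\<lambda>x. (g x - gradient \<phi> x) + c *\<^sub>R (h x - gradient \<psi> x)) \<le>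
        2 * gsq_int S (\<lambda>x. g x - gradient \<phi> x) + 2 * c\<^sup>2 * gsq_int S (\<lambda>x. h x - gradient \<psi> x)"
      using L2_diff[OF has_weak_gradientD(2)[OF g(1)] L(3)] L2_diff[OF has_weak_gradientD(2)[OF h(1)] L(4)]
      by (intro gsq_int_lin_le) auto
    also have "\<dots> < e" by (rule lt[OF \<phi>(3) \<psi>(3)])
    finally have 2: "gsq_int S (\<lambda>x. (g x + c *\<^sub>R h x) - gradient (\<lambda>x. \<phi> x + c * \<psi> x) x) < e"
      unfolding gradient_test_add_scale[OF \<phi>(1) \<psi>(1)] by (simp add: algebra_simps)
    show ?thesis by (rule bexI[of _ "\<lambda>x. \<phi> x + c * \<psi> x"]) (rule conjI[OF 1 2], rule test_functions_add_scale[OF \<phi>(1) \<psi>(1)])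
  qed
  then show ?thesis unfolding H10_iff[OF S] using has_weak_gradient_lin[OF Sm g(1) h(1)] by blast
qed

lemma test_function_H10:
  assumes S: "open S" "bounded S" and "\<phi> \<in> test_functions S"
  shows "\<phi> \<in> H10 S"
proof -
  have "S \<in> lmeasurable" using S by (simp add: lmeasurable_open)
  from test_function_has_weak_gradient[OF this assms(3)] show ?thesis
    unfolding H10_iff[OF S] using assms(3) by (intro exI[of _ "gradient \<phi>"]) (auto intro!: bexI[of _ \<phi>])
qed

text \<open>Approximation in two stages, by a member of the sequence and then by a test function
  close to it; each stage may use e / 4 because the squared triangle inequality doubles
  both.\<close>

lemma H10_closed:
  assumes S: "open S" "bounded S" and v: "\<And>n. v n \<in> H10 S" and u: "has_weak_gradient S u h"
    and lim: "(\<lambda>n. sq_int S (\<lambda>x. v n x - u x)) \<longlonglongrightarrow> 0"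
      "(\<lambda>n. gsq_int S (\<lambda>x. weak_gradient S (v n) x - h x)) \<longlonglongrightarrow> 0"
  shows "u \<in> H10 S"
proof -
  have Sm: "S \<in> lmeasurable" using S by (simp add: lmeasurable_open)
  have "\<exists>\<phi>\<in>test_functions S. sq_int S (\<lambda>x. u x - \<phi> x) < e \<and> gsq_int S (\<lambda>x. h x - gradient \<phi> x) < e" if "e > 0" for e
  proof -
    have "\<forall>\<^sub>F n in sequentially. sq_int S (\<lambda>x. v n x - u x) < e / 4 \<and>
        gsq_int S (\<lambda>x. weak_gradient S (v n) x - h x) < e / 4"
      using that by (intro eventually_conj order_tendstoD(2)[OF lim(1)] order_tendstoD(2)[OF lim(2)]) auto
    then obtain n where n: "sq_int S (\<lambda>x. v n x - u x) < e / 4" "gsq_int S (\<lambda>x. weak_gradient S (v n) x - h x) < e / 4"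
      using eventually_happens[of _ sequentially] by auto
    have hv: "has_weak_gradient S (v n) (weak_gradient S (v n))" by (rule H1_has_weak_gradient[OF H10_H1[OF v]])
    obtain \<phi> where \<phi>: "\<phi> \<in> test_functions S" "sq_int S (\<lambda>x. v n x - \<phi> x) < e / 4"
        "gsq_int S (\<lambda>x. weak_gradient S (v n) x - gradient \<phi> x) < e / 4"
    proof -
      obtain \<psi> where \<psi>: "\<And>m. \<psi> m \<in> test_functions S" "(\<lambda>m. sq_int S (\<lambda>x. v n x - \<psi> m x)) \<longlonglongrightarrow> 0"
          "(\<lambda>m. gsq_int S (\<lambda>x. weak_gradient S (v n) x - gradient (\<psi> m) x)) \<longlonglongrightarrow> 0"
        using v[of n] by (auto simp: H10_def)
      have "\<forall>\<^sub>F m in sequentially. sq_int S (\<lambda>x. v n x - \<psi> m x) < e / 4 \<and>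
          gsq_int S (\<lambda>x. weak_gradient S (v n) x - gradient (\<psi> m) x) < e / 4"
        using that \<open>e > 0\<close> by (intro eventually_conj order_tendstoD(2)[OF \<psi>(2)] order_tendstoD(2)[OF \<psi>(3)]) auto
      then obtain m where "sq_int S (\<lambda>x. v n x - \<psi> m x) < e / 4 \<and>
          gsq_int S (\<lambda>x. weak_gradient S (v n) x - gradient (\<psi> m) x) < e / 4"
        using eventually_happens[of _ sequentially] by auto
      then show thesis using that \<psi>(1) by blast
    qed
    note L = has_weak_gradientD[OF u] has_weak_gradientD[OF hv] test_function_L2[OF Sm \<phi>(1)] test_gradient_L2[OF Sm \<phi>(1)]
    have "sq_int S (\<lambda>x. u x - \<phi> x) \<le> 2 * sq_int S (\<lambda>x. u x - v n x) + 2 * sq_int S (\<lambda>x. v n x - \<phi> x)"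
      by (intro L2_triangle_square_le L)
    moreover have "sq_int S (\<lambda>x. u x - v n x) = sq_int S (\<lambda>x. v n x - u x)"
      by (simp add: power2_commute)
    ultimately have "sq_int S (\<lambda>x. u x - \<phi> x) < e" using n \<phi> by linarith
    moreover have "gsq_int S (\<lambda>x. h x - gradient \<phi> x) \<le> 2 * gsq_int S (\<lambda>x. h x - weak_gradient S (v n) x) +
        2 * gsq_int S (\<lambda>x. weak_gradient S (v n) x - gradient \<phi> x)"
      by (intro gsq_int_triangle L)
    moreover have "gsq_int S (\<lambda>x. h x - weak_gradient S (v n) x) = gsq_int S (\<lambda>x. weak_gradient S (v n) x - h x)"
      by (simp add: norm_minus_commute)
    ultimately show ?thesis using n \<phi> by (intro bexI[of _ \<phi>]) linarith+
  qed
  then show ?thesis unfolding H10_iff[OF S] using u by blast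
qed

text \<open>A sufficiently long translation moves the support off the domain, so the translation estimate
  bounds the function itself.\<close>

lemma friedrichs:
  fixes S :: "(real^'d) set"
  assumes S: "open S" "bounded S"
  shows "\<exists>C>0. \<forall>v\<in>H10 S. sq_int S v \<le> C * gsq_int S (weak_gradient S v)"
proof -
  have Sm: "S \<in> lmeasurable" and Ss: "S \<in> sets lebesgue" using S by (auto simp: lmeasurable_open)
  obtain r where r: "r > 0" "S \<subseteq> ball 0 r" using bounded_subset_ballD[OF S(2), of 0] by auto
  \<comment> \<open>From a point of norm below r, a shift of length 2 r leads to a point of norm
    above r, hence out of \<open>S\<close>, while the whole segment stays in the ball of radius 3
    r.\<close>
  define z where "z = (2 * r) *\<^sub>R (axis undefined 1 :: real^'d)"
  have z: "norm z = 2 * r" using r(1) by (simp add: z_def norm_axis_1)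
  define R where "R = (2 * r)\<^sup>2"
  have "R > 0" using r(1) by (simp add: R_def)
  define K where "K = ball (0::real^'d) (3 * r)"
  have K: "open K" "bounded K" "K \<in> lmeasurable" "K \<in> sets lebesgue" by (auto simp: K_def)
  have SK: "S \<subseteq> K" using r by (auto simp: K_def subset_iff)
  have test: "sq_int S \<phi> \<le> R * gsq_int S (gradient \<phi>)" if \<phi>: "\<phi> \<in> test_functions S" for \<phi>
  proof -
    have seg: "x + s *\<^sub>R z \<in> K" if "x \<in> S" "s \<in> {0..1}" for x s
    proof -
      have "norm (s *\<^sub>R z) \<le> 2 * r" using that z r(1) mult_left_le_one_le[of "2 * r" s] by simp
      moreover have "norm x < r" using r that by auto
      ultimately have "norm (x + s *\<^sub>R z) < 3 * r" using norm_triangle_ineq[of x "s *\<^sub>R z"] by linarith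
      then show ?thesis by (simp add: K_def)
    qed
    have out: "\<phi> (x + z) = 0" if "x \<in> S" for x
    proof -
      have "norm x < r" using r that by auto
      then have "norm (x + z) > r" using norm_diff_ineq[of z x] z by (simp add: add.commute)
      then have "x + z \<notin> S" using r by auto
      then show ?thesis by (rule test_functions_zero_outside[OF \<phi>])
    qed
    have "sq_int S \<phi> = sq_int S (\<lambda>x. \<phi> (x + z) - \<phi> x)"
      by (rule Bochner_Integration.integral_cong) (use out in auto)
    also have "\<dots> \<le> (norm z)\<^sup>2 * gsq_int K (gradient \<phi>)"
      using translation_estimate(2)[OF S K(1,2) test_function_has_weak_gradient[OF K(3) \<phi>] seg] .
    also have "gsq_int K (gradient \<phi>) = gsq_int S (gradient \<phi>)"
      by (rule integral_zero_outside[OF SK Ss K(4)]) (simp add: gradient_zero_outside[OF \<phi>])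
    finally show ?thesis unfolding z R_def .
  qed
  \<comment> \<open>Passing from test functions to their limits uses the squared triangle inequality
    twice, once for the function and once for the gradient; each use costs a factor 2.\<close>
  have "sq_int S v \<le> (4 * R) * gsq_int S (weak_gradient S v)" if v: "v \<in> H10 S" for v
  proof (rule field_le_epsilon)
    fix e :: real assume "e > 0"
    let ?g = "weak_gradient S v"
    note R = \<open>R > 0\<close>
    have hv: "has_weak_gradient S v ?g" by (rule H1_has_weak_gradient[OF H10_H1[OF v]])
    obtain \<psi> where \<psi>: "\<And>m. \<psi> m \<in> test_functions S" "(\<lambda>m. sq_int S (\<lambda>x. v x - \<psi> m x)) \<longlonglongrightarrow> 0"
        "(\<lambda>m. gsq_int S (\<lambda>x. ?g x - gradient (\<psi> m) x)) \<longlonglongrightarrow> 0"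
      using v by (auto simp: H10_def)
    define d where "d = e / (2 + 4 * R)"
    have p: "2 + 4 * R > 0" using R by simp
    then have "(2 + 4 * R) * d = e" by (simp add: d_def)
    then have d: "d > 0" "2 * d + 4 * R * d = e" using p \<open>e > 0\<close> by (simp_all only: distrib_right) (simp add: d_def)
    have "\<forall>\<^sub>F m in sequentially. sq_int S (\<lambda>x. v x - \<psi> m x) < d \<and> gsq_int S (\<lambda>x. ?g x - gradient (\<psi> m) x) < d"
      by (intro eventually_conj order_tendstoD(2)[OF \<psi>(2)] order_tendstoD(2)[OF \<psi>(3)] d)
    then obtain m where m: "sq_int S (\<lambda>x. v x - \<psi> m x) < d" "gsq_int S (\<lambda>x. ?g x - gradient (\<psi> m) x) < d"
      using eventually_happens[of _ sequentially] by auto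
    note L = has_weak_gradientD[OF hv] test_function_L2[OF Sm \<psi>(1)] test_gradient_L2[OF Sm \<psi>(1)] L2_zero
    have "sq_int S v \<le> 2 * sq_int S (\<lambda>x. v x - \<psi> m x) + 2 * sq_int S (\<psi> m)"
      using L2_triangle_square_le[OF L(1) L(4) L(6), of m] by simp
    moreover have "gsq_int S (gradient (\<psi> m)) \<le> 2 * gsq_int S (\<lambda>x. gradient (\<psi> m) x - ?g x) + 2 * gsq_int S ?g"
      using gsq_int_triangle[OF L(5) L(2), of "\<lambda>_. 0" m] by (simp add: L2_zero)
    then have "gsq_int S (gradient (\<psi> m)) \<le> 2 * gsq_int S (\<lambda>x. ?g x - gradient (\<psi> m) x) + 2 * gsq_int S ?g"
      by (simp add: norm_minus_commute)
    then have "R * gsq_int S (gradient (\<psi> m)) \<le> R * (2 * d + 2 * gsq_int S ?g)"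
      using m R by (intro mult_left_mono) auto
    moreover have "sq_int S (\<psi> m) \<le> R * gsq_int S (gradient (\<psi> m))" by (rule test[OF \<psi>(1)])
    moreover have "R * (2 * d + 2 * gsq_int S ?g) = 2 * (R * d) + 2 * (R * gsq_int S ?g)" by (simp add: algebra_simps)
    moreover have "4 * R * d = 4 * (R * d)" "4 * R * gsq_int S ?g = 4 * (R * gsq_int S ?g)" by simp_all
    ultimately show "sq_int S v \<le> 4 * R * gsq_int S ?g + e" using m d by linarith
  qed
  then show ?thesis using \<open>R > 0\<close> by (intro exI[of _ "4 * R"]) auto
qed

section \<open>Compactness of the embedding into square integrable functions\<close>

lemma integral_disjoint_UN:
  fixes f :: "'a::euclidean_space \<Rightarrow> real"
  assumes "finite I" "disjoint_family_on Q I" "\<And>i. i \<in> I \<Longrightarrow> Q i \<in> sets lebesgue"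
    and "\<And>i. i \<in> I \<Longrightarrow> integrable (lebesgue_on (Q i)) f"
  shows "(LINT x|lebesgue_on (\<Union>i\<in>I. Q i). f x) = (\<Sum>i\<in>I. LINT x|lebesgue_on (Q i). f x)"
proof -
  have U: "(\<Union>i\<in>I. Q i) \<in> sets lebesgue" using assms(1,3) by blast
  have eq: "(if x \<in> (\<Union>i\<in>I. Q i) then f x else 0) = (\<Sum>i\<in>I. if x \<in> Q i then f x else 0)" for x
  proof (cases "x \<in> (\<Union>i\<in>I. Q i)")
    case True
    then obtain j where j: "j \<in> I" "x \<in> Q j" by blast
    have "x \<notin> Q i" if "i \<in> I" "i \<noteq> j" for i
      using assms(2) that j by (auto simp: disjoint_family_on_def)
    then have "(\<Sum>i\<in>I. if x \<in> Q i then f x else 0) = (\<Sum>i\<in>I. if i = j then f x else 0)"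
      using j by (intro sum.cong) auto
    then show ?thesis using True j assms(1) by simp
  next
    case False
    then show ?thesis by (auto intro!: sum.neutral[symmetric])
  qed
  have "(LINT x|lebesgue_on (\<Union>i\<in>I. Q i). f x) = (LINT x|lebesgue. (\<Sum>i\<in>I. if x \<in> Q i then f x else 0))"
    unfolding eq[symmetric] by (rule Lebesgue_Measure.integral_restrict_UNIV[OF U, symmetric])
  also have "\<dots> = (\<Sum>i\<in>I. LINT x|lebesgue. (if x \<in> Q i then f x else 0))"
    using assms(3,4) by (intro Bochner_Integration.integral_sum) (simp add: Lebesgue_Measure.integrable_restrict_UNIV)
  also have "\<dots> = (\<Sum>i\<in>I. LINT x|lebesgue_on (Q i). f x)"
    using assms(3) by (intro sum.cong) (simp_all add: Lebesgue_Measure.integral_restrict_UNIV)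
  finally show ?thesis .
qed

lemma integral_mono_negligible_diff:
  fixes f :: "'a::euclidean_space \<Rightarrow> real"
  assumes S: "S \<in> sets lebesgue" and T: "T \<in> sets lebesgue" and "negligible (S - T)"
    and i: "integrable (lebesgue_on T) f" and nn: "\<And>x. f x \<ge> 0"
  shows "(LINT x|lebesgue_on S. f x) \<le> (LINT x|lebesgue_on T. f x)"
proof -
  have "(LINT x|lebesgue. (if x \<in> S then f x else 0)) \<le> (LINT x|lebesgue. (if x \<in> T then f x else 0))"
  proof (rule Bochner_Integration.integral_mono_AE')
    show "integrable lebesgue (\<lambda>x. if x \<in> T then f x else 0)"
      using i T by (simp add: Lebesgue_Measure.integrable_restrict_UNIV)
    have "AE x in lebesgue. x \<notin> S - T"
      by (rule AE_not_in) (use assms(3) in \<open>simp add: negligible_iff_null_sets\<close>)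
    then show "AE x in lebesgue. (if x \<in> S then f x else 0) \<le> (if x \<in> T then f x else 0)"
      by eventually_elim (use nn in auto)
  qed (use nn in auto)
  then show ?thesis using S T by (simp add: Lebesgue_Measure.integral_restrict_UNIV)
qed

text \<open>The pieces may overlap, as the balls along the boundary do; for a nonnegative integrand
  the overlap turns equality into an inequality.\<close>

lemma integral_le_sum_cover:
  fixes f :: "'a::euclidean_space \<Rightarrow> real"
  assumes K: "K \<in> sets lebesgue" and "finite I" and Q: "\<And>i. i \<in> I \<Longrightarrow> Q i \<in> sets lebesgue"
    "\<And>i. i \<in> I \<Longrightarrow> Q i \<subseteq> K" and cov: "K \<subseteq> (\<Union>i\<in>I. Q i)"
    and i: "integrable (lebesgue_on K) f" and nn: "\<And>x. f x \<ge> 0"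
  shows "(LINT x|lebesgue_on K. f x) \<le> (\<Sum>i\<in>I. LINT x|lebesgue_on (Q i). f x)"
proof -
  have iQ: "integrable lebesgue (\<lambda>x. if x \<in> Q j then f x else 0)" if "j \<in> I" for j
    using integrable_lebesgue_on_subset[OF Q(2)[OF that] Q(1)[OF that] K i] Q(1)[OF that]
    by (simp add: Lebesgue_Measure.integrable_restrict_UNIV)
  have "(LINT x|lebesgue. (if x \<in> K then f x else 0)) \<le> (LINT x|lebesgue. (\<Sum>i\<in>I. if x \<in> Q i then f x else 0))"
  proof (rule Bochner_Integration.integral_mono)
    show "integrable lebesgue (\<lambda>x. if x \<in> K then f x else 0)"
      using i K by (simp add: Lebesgue_Measure.integrable_restrict_UNIV)
    show "integrable lebesgue (\<lambda>x. \<Sum>i\<in>I. if x \<in> Q i then f x else 0)"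
      by (intro Bochner_Integration.integrable_sum iQ)
    show "(if x \<in> K then f x else 0) \<le> (\<Sum>i\<in>I. if x \<in> Q i then f x else 0)" for x
    proof (cases "x \<in> K")
      case True
      then obtain j where j: "j \<in> I" "x \<in> Q j" using cov by blast
      then show ?thesis
        using True nn member_le_sum[of j I "\<lambda>i. if x \<in> Q i then f x else 0"] assms(2) by simp
    qed (use nn in \<open>auto intro!: sum_nonneg\<close>)
  qed
  also have "\<dots> = (\<Sum>i\<in>I. LINT x|lebesgue. (if x \<in> Q i then f x else 0))"
    by (intro Bochner_Integration.integral_sum iQ)
  also have "\<dots> = (\<Sum>i\<in>I. LINT x|lebesgue_on (Q i). f x)"
    using Q by (intro sum.cong) (simp_all add: Lebesgue_Measure.integral_restrict_UNIV)
  finally show ?thesis using K by (simp add: Lebesgue_Measure.integral_restrict_UNIV)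
qed

section \<open>Cubic grids and the estimate on compact subsets\<close>

text \<open>Open cubes of side h indexed by integer vectors. Leaving out the grid hyperplanes makes
  the cells both open and pairwise disjoint, at the price of a null set.\<close>

definition grid_cell :: "real \<Rightarrow> ('d \<Rightarrow> int) \<Rightarrow> (real^'d) set" where
  "grid_cell h z = box (\<chi> i. h * real_of_int (z i)) (\<chi> i. h * (real_of_int (z i) + 1))"

lemma mem_grid_cell:
  "x \<in> grid_cell h z \<longleftrightarrow> (\<forall>i. h * real_of_int (z i) < x $ i \<and> x $ i < h * (real_of_int (z i) + 1))"
  by (simp add: grid_cell_def mem_box_cart)

lemma grid_cell_unique:
  assumes "h > 0" "x \<in> grid_cell h z"
  shows "z = (\<lambda>i. \<lfloor>x $ i / h\<rfloor>)"
proof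
  fix i
  have "h * real_of_int (z i) < x $ i" "x $ i < h * (real_of_int (z i) + 1)"
    using assms(2) by (auto simp: mem_grid_cell)
  then show "z i = \<lfloor>x $ i / h\<rfloor>" using assms(1)
    by (intro floor_unique[symmetric]) (simp_all add: field_simps)
qed

text \<open>The Poincare inequality on a cube, with diameter bound h n from the sum norm and volume
  h^n. After division by the volume the gradient term keeps a factor h^2, so it becomes small on a
  fine grid; the other term involves \<open>v\<close> only through its integral over the
  cube.\<close>

lemma grid_cell_poincare:
  fixes z :: "'d::finite \<Rightarrow> int" and v :: "real^'d \<Rightarrow> real"
  defines "n \<equiv> CARD('d)"
  assumes h: "h > 0" and hw: "has_weak_gradient (grid_cell h z) v g"
  shows "sq_int (grid_cell h z) v \<le> unit_ball_vol n * real n ^ (n + 2) * h\<^sup>2 * gsq_int (grid_cell h z) g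
    + (LINT x|lebesgue_on (grid_cell h z). v x)\<^sup>2 / h ^ n"
proof -
  let ?Q = "grid_cell h z"
  have Q: "open ?Q" "convex ?Q" "bounded ?Q" by (auto simp: grid_cell_def)
  have D: "norm (x - y) \<le> h * n" if "x \<in> ?Q" "y \<in> ?Q" for x y
  proof -
    have "norm (x - y) \<le> (\<Sum>i\<in>UNIV. \<bar>(x - y) $ i\<bar>)" by (rule norm_le_l1_cart)
    also have "\<dots> \<le> (\<Sum>i\<in>(UNIV::'d set). h)"
    proof (rule sum_mono)
      fix i
      have "h * real_of_int (z i) < x $ i" "x $ i < h * real_of_int (z i) + h"
        "h * real_of_int (z i) < y $ i" "y $ i < h * real_of_int (z i) + h"
        using that by (auto simp: mem_grid_cell distrib_left)
      then show "\<bar>(x - y) $ i\<bar> \<le> h" by (simp add: abs_le_iff)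
    qed
    finally show ?thesis by (simp add: n_def mult.commute)
  qed
  have vol: "measure lebesgue ?Q = h ^ n"
  proof -
    have "measure lebesgue ?Q = measure lborel (cbox (\<chi> i. h * real_of_int (z i)) (\<chi> i. h * (real_of_int (z i) + 1) :: real^'d))"
      by (simp add: grid_cell_def measure_completion measure_lborel_box_eq measure_lborel_cbox_eq)
    also have "\<dots> = (\<Prod>i\<in>(UNIV::'d set). h)"
    proof -
      have "cbox (\<chi> i. h * real_of_int (z i)) (\<chi> i. h * (real_of_int (z i) + 1) :: real^'d) \<noteq> {}"
        unfolding interval_ne_empty_cart using h by simp
      from content_cbox_cart[OF this] show ?thesis by (simp add: distrib_left)
    qed
    finally show ?thesis by (simp add: n_def)
  qed
  have "measure lebesgue (cball (0::real^'d) (h * n)) = unit_ball_vol n * (h * n) ^ n"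
    using h by (simp add: measure_completion content_cball n_def)
  then have "2 * h ^ n * sq_int ?Q v - 2 * (LINT x|lebesgue_on ?Q. v x)\<^sup>2
      \<le> unit_ball_vol n * (h * n) ^ n * (h * n)\<^sup>2 * gsq_int ?Q g"
    using poincare[OF Q D hw] by (simp add: vol)
  \<comment> \<open>A factor 2 is given away on the right so that it cancels throughout.\<close>
  also have "\<dots> \<le> 2 * (unit_ball_vol n * (h * n) ^ n * (h * n)\<^sup>2 * gsq_int ?Q g)"
  proof -
    have "0 \<le> unit_ball_vol n * (h * n) ^ n * (h * n)\<^sup>2 * gsq_int ?Q g"
      using h by (intro mult_nonneg_nonneg) auto
    then show ?thesis by linarith
  qed
  also have "unit_ball_vol n * (h * n) ^ n * (h * n)\<^sup>2 * gsq_int ?Q g =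
      h ^ n * (unit_ball_vol n * real n ^ (n + 2) * h\<^sup>2 * gsq_int ?Q g)"
    by (simp add: power_mult_distrib power_add power2_eq_square)
  finally have "h ^ n * sq_int ?Q v \<le> h ^ n * (unit_ball_vol n * real n ^ (n + 2) * h\<^sup>2 * gsq_int ?Q g)
      + (LINT x|lebesgue_on ?Q. v x)\<^sup>2" by linarith
  then have "h ^ n * sq_int ?Q v \<le> h ^ n * (unit_ball_vol n * real n ^ (n + 2) * h\<^sup>2 * gsq_int ?Q g
      + (LINT x|lebesgue_on ?Q. v x)\<^sup>2 / h ^ n)" using h by (simp add: distrib_left)
  then show ?thesis using h by (simp add: mult_le_cancel_left_pos)
qed

text \<open>A grid of width h splits \<open>C\<close> into cells contained in \<open>K\<close>,
  finitely many since \<open>C\<close> is bounded. On each of them \<open>grid_cell_poincare\<close>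
  applies, and h is taken so small that the gradient terms add up to at most \<epsilon> times the
  total. What is left are the integrals over the cells, the finitely many functionals.\<close>

lemma interior_functionals:
  fixes K C :: "(real^'d) set"
  assumes K: "open K" "bounded K" and C: "compact C" "C \<subseteq> K" and "\<epsilon> > 0"
  obtains \<Q> M where "finite \<Q>" "\<And>Q. Q \<in> \<Q> \<Longrightarrow> open Q \<and> Q \<subseteq> K" "M \<ge> 0"
    "\<And>v g. has_weak_gradient K v g \<Longrightarrow>
      sq_int C v \<le> \<epsilon> * gsq_int K g + M * (\<Sum>Q\<in>\<Q>. (LINT x|lebesgue_on Q. v x)\<^sup>2)"
proof -
  let ?n = "CARD('d)"
  have Ks: "K \<in> sets lebesgue" using K by auto
  have Cs: "C \<in> sets lebesgue" using C by (simp add: lmeasurable_compact fmeasurableD)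
  obtain \<delta> where \<delta>: "\<delta> > 0" "\<And>x. x \<in> C \<Longrightarrow> ball x \<delta> \<subseteq> K"
  proof -
    obtain d where "d > 0" "\<And>x y. x \<in> C \<Longrightarrow> y \<in> - K \<Longrightarrow> d \<le> dist x y"
    proof -
      have "closed (- K)" "C \<inter> - K = {}" using C(2) K(1) by auto
      from separate_compact_closed[OF C(1) this] show ?thesis using that by blast
    qed
    then show thesis using that[of d] by fastforce
  qed
  define c where "c = unit_ball_vol ?n * real ?n ^ (?n + 2)"
  have c: "c > 0" by (simp add: c_def)
  \<comment> \<open>The first bound keeps a cell that meets \<open>C\<close> inside
    \<open>K\<close>, since the cell has diameter at most n h; the second gives h^2 \<le> h; the
    third then makes the gradient constant c h^2 at most \<epsilon>.\<close>
  define h where "h = Min {\<delta> / (2 * ?n), 1, \<epsilon> / c}"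
  have h: "h > 0" "h \<le> \<delta> / (2 * ?n)" "h \<le> 1" "h \<le> \<epsilon> / c" using \<delta>(1) c \<open>\<epsilon> > 0\<close> by (auto simp: h_def)
  have hc: "c * h\<^sup>2 \<le> \<epsilon>"
  proof -
    have "h\<^sup>2 \<le> h" using h by (simp add: power2_eq_square mult_left_le)
    then have "c * h\<^sup>2 \<le> c * (\<epsilon> / c)" using h c by (intro mult_left_mono) auto
    then show ?thesis using c by simp
  qed
  define key where "key = (\<lambda>(x::real^'d) i. \<lfloor>x $ i / h\<rfloor>)"
  obtain R where R: "\<And>x. x \<in> C \<Longrightarrow> norm x \<le> R" using C(1) compact_imp_bounded bounded_iff by metis
  have "finite (key ` C)"
  proof (rule finite_subset)
    show "key ` C \<subseteq> {f. \<forall>i. (i \<in> UNIV \<longrightarrow> f i \<in> {\<lfloor>- R / h\<rfloor>..\<lfloor>R / h\<rfloor>}) \<and> (i \<notin> UNIV \<longrightarrow> f i = 0)}"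
    proof (clarsimp simp: key_def)
      fix x i assume "x \<in> C"
      then have "\<bar>x $ i\<bar> \<le> R" using R component_le_norm_cart[of x i] by fastforce
      then have "- R / h \<le> x $ i / h" "x $ i / h \<le> R / h"
        using h(1) divide_right_mono[of "- R" "x $ i" h] divide_right_mono[of "x $ i" R h] by auto
      then show "\<lfloor>- (R / h)\<rfloor> \<le> \<lfloor>x $ i / h\<rfloor> \<and> \<lfloor>x $ i / h\<rfloor> \<le> \<lfloor>R / h\<rfloor>" by (auto intro!: floor_mono)
    qed
  qed (rule finite_set_of_finite_funs; simp)
  moreover define Z where "Z = {z \<in> key ` C. grid_cell h z \<subseteq> K}"
  ultimately have Z: "finite Z" by simp
  define U where "U = (\<Union>z\<in>Z. grid_cell h z)"
  have cells: "open (grid_cell h z)" "grid_cell h z \<in> sets lebesgue" for z :: "'d \<Rightarrow> int"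
    by (auto simp: grid_cell_def)
  have disj: "disjoint_family_on (grid_cell h) Z"
    unfolding disjoint_family_on_def using grid_cell_unique[OF h(1)] by blast
  have Us: "U \<in> sets lebesgue" using Z cells by (auto simp: U_def)
  have UK: "U \<subseteq> K" by (auto simp: U_def Z_def)
  \<comment> \<open>A point of \<open>C\<close> off all grid hyperplanes lies in the open cell of
    its own key, and that cell is contained in \<open>K\<close> by the choice of \<open>h\<close>.
    Hence only points on countably many hyperplanes are lost.\<close>
  have neg: "negligible (C - U)"
  proof (rule negligible_subset)
    let ?N = "\<Union>m::int. \<Union>i. {x::real^'d. x $ i = h * m}"
    show "negligible ?N"
    proof (rule negligible_countable_Union)
      fix X assume "X \<in> range (\<lambda>m::int. \<Union>i. {x::real^'d. x $ i = h * m})"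
      then obtain m :: int where X: "X = (\<Union>i. {x::real^'d. x $ i = h * m})" by blast
      show "negligible X"
        unfolding X
      proof (rule negligible_countable_Union)
        fix Y assume "Y \<in> range (\<lambda>i. {x::real^'d. x $ i = h * m})"
        then obtain i where "Y = {x. x \<bullet> axis i 1 = h * m}" by (auto simp: cart_eq_inner_axis)
        then show "negligible Y" using negligible_standard_hyperplane[of "axis i (1::real)" "h * m"]
          by (simp add: axis_in_Basis_iff)
      qed auto
    qed auto
    show "C - U \<subseteq> ?N"
    proof (rule subsetI, rule ccontr)
      fix x assume x: "x \<in> C - U" "x \<notin> ?N"
      have fl: "h * \<lfloor>x $ i / h\<rfloor> < x $ i \<and> x $ i < h * (\<lfloor>x $ i / h\<rfloor> + 1)" for i
      proof -
        have "h * \<lfloor>x $ i / h\<rfloor> \<le> x $ i" "x $ i < h * (\<lfloor>x $ i / h\<rfloor> + 1)"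
          using h(1) mult_left_mono[OF of_int_floor_le, of h "x $ i / h"]
            mult_strict_left_mono[OF floor_correct[THEN conjunct2], of h "x $ i / h"] by auto
        moreover have "x $ i \<noteq> h * \<lfloor>x $ i / h\<rfloor>" using x(2) by blast
        ultimately show ?thesis by linarith
      qed
      then have xc: "x \<in> grid_cell h (key x)" by (simp add: mem_grid_cell key_def)
      have "grid_cell h (key x) \<subseteq> K"
      proof
        fix y assume y: "y \<in> grid_cell h (key x)"
        have "norm (x - y) \<le> (\<Sum>i\<in>UNIV. \<bar>(x - y) $ i\<bar>)" by (rule norm_le_l1_cart)
        also have "\<dots> \<le> (\<Sum>i\<in>(UNIV::'d set). h)"
        proof (rule sum_mono)
          fix i
          have "h * real_of_int (key x i) < x $ i" "x $ i < h * real_of_int (key x i) + h"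
            "h * real_of_int (key x i) < y $ i" "y $ i < h * real_of_int (key x i) + h"
            using xc y by (auto simp: mem_grid_cell distrib_left)
          then show "\<bar>(x - y) $ i\<bar> \<le> h" by (simp add: abs_le_iff)
        qed
        also have "\<dots> = ?n * h" by simp
        also have "\<dots> \<le> \<delta> / 2" using h(2) by (simp add: field_simps)
        also have "\<dots> < \<delta>" using \<delta>(1) by simp
        finally have "y \<in> ball x \<delta>" by (simp add: dist_norm)
        then show "y \<in> K" using \<delta>(2) x(1) by blast
      qed
      then have "key x \<in> Z" using x(1) by (auto simp: Z_def)
      then show False using xc x(1) by (auto simp: U_def)
    qed
  qed
  have est: "sq_int C v \<le> \<epsilon> * gsq_int K g + (1 / h ^ ?n) * (\<Sum>Q\<in>grid_cell h ` Z. (LINT x|lebesgue_on Q. v x)\<^sup>2)"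
    if hw: "has_weak_gradient K v g" for v g
  proof -
    note vL = has_weak_gradientD(1)[OF hw]
    have gi: "integrable (lebesgue_on K) (\<lambda>x. (norm (g x))\<^sup>2)" by (rule gsq_int_eq(2)[OF has_weak_gradientD(2)[OF hw]])
    have vi: "integrable (lebesgue_on K) (\<lambda>x. (v x)\<^sup>2)" using vL by (simp add: L2_def)
    have QK: "grid_cell h z \<subseteq> K" if "z \<in> Z" for z using that by (simp add: Z_def)
    have "sq_int C v \<le> sq_int U v"
      by (rule integral_mono_negligible_diff[OF Cs Us neg integrable_lebesgue_on_subset[OF UK Us Ks vi]]) simp
    also have "\<dots> = (\<Sum>z\<in>Z. sq_int (grid_cell h z) v)"
      unfolding U_def by (rule integral_disjoint_UN[OF Z disj cells(2) integrable_lebesgue_on_subset[OF QK cells(2) Ks vi]])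
    also have "\<dots> \<le> (\<Sum>z\<in>Z. c * h\<^sup>2 * gsq_int (grid_cell h z) g + (LINT x|lebesgue_on (grid_cell h z). v x)\<^sup>2 / h ^ ?n)"
      unfolding c_def
      by (intro sum_mono grid_cell_poincare[OF h(1)] has_weak_gradient_subset[OF QK cells(2) Ks hw])
    also have "\<dots> = c * h\<^sup>2 * (\<Sum>z\<in>Z. gsq_int (grid_cell h z) g) + (1 / h ^ ?n) * (\<Sum>z\<in>Z. (LINT x|lebesgue_on (grid_cell h z). v x)\<^sup>2)"
      by (simp add: sum.distrib sum_distrib_left)
    also have "(\<Sum>z\<in>Z. gsq_int (grid_cell h z) g) = gsq_int U g"
      unfolding U_def
      by (rule integral_disjoint_UN[OF Z disj cells(2) integrable_lebesgue_on_subset[OF QK cells(2) Ks gi], symmetric])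
    also have "(\<Sum>z\<in>Z. (LINT x|lebesgue_on (grid_cell h z). v x)\<^sup>2) = (\<Sum>Q\<in>grid_cell h ` Z. (LINT x|lebesgue_on Q. v x)\<^sup>2)"
    proof (rule sum.reindex[symmetric, unfolded o_def])
      show "inj_on (grid_cell h) Z"
      proof (rule inj_onI)
        fix z z' :: "'d \<Rightarrow> int" assume eq: "grid_cell h z = grid_cell h z'"
        have "(\<chi> i. h * (z i + 1 / 2)) \<in> grid_cell h z" using h(1) by (simp add: mem_grid_cell)
        from grid_cell_unique[OF h(1) this] grid_cell_unique[OF h(1) this[unfolded eq]]
        show "z = z'" by (rule trans[OF _ sym])
      qed
    qed
    also have "c * h\<^sup>2 * gsq_int U g \<le> \<epsilon> * gsq_int K g"
    proof (rule mult_mono)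
      show "gsq_int U g \<le> gsq_int K g" by (rule integral_nonneg_subset[OF UK Us Ks gi]) simp
    qed (use hc \<open>\<epsilon> > 0\<close> in auto)
    finally show ?thesis by simp
  qed
  show thesis
  proof (rule that[of "grid_cell h ` Z" "1 / h ^ ?n"])
    show "finite (grid_cell h ` Z)" using Z by simp
    show "open Q \<and> Q \<subseteq> K" if "Q \<in> grid_cell h ` Z" for Q using that cells by (auto simp: Z_def)
  qed (use h(1) est in auto)
qed

text \<open>Only continuity of the boundary graphs is needed: shifting a boundary piece in the direction of
  the graph moves it to a compact subset of the domain.\<close>

lemma boundary_shift:
  fixes K :: "(real^'d) set"
  assumes dom: "bounded_lipschitz_domain K" and p: "p \<in> frontier K"
  obtains r where "r > 0" "\<And>t. 0 < t \<Longrightarrow> t < r \<Longrightarrow> \<exists>C. compact C \<and> C \<subseteq> K \<and>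
    (\<forall>v g. has_weak_gradient K v g \<longrightarrow> sq_int (ball p r \<inter> K) v \<le> 2 * t\<^sup>2 * gsq_int K g + 2 * sq_int C v)"
proof -
  have K: "open K" "bounded K" using dom by (auto simp: bounded_lipschitz_domain_def)
  obtain U e \<gamma> L where U: "open U" "p \<in> U" and e: "norm e = 1" and lip: "L-lipschitz_on {z. z \<bullet> e = 0} \<gamma>"
    and UK: "U \<inter> K = {x\<in>U. \<gamma> (x - (x \<bullet> e) *\<^sub>R e) < x \<bullet> e}"
    using dom p unfolding bounded_lipschitz_domain_def lipschitz_boundary_def by blast
  have ee: "e \<bullet> e = 1" using e by (simp add: norm_eq_1)
  \<comment> \<open>The orthogonal projection onto the hyperplane of the graph. It is constant along
    \<open>e\<close>, so a shift in that direction changes only the height above the graph.\<close>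
  define P where "P = (\<lambda>x. x - (x \<bullet> e) *\<^sub>R e)"
  have P0: "P x \<in> {z. z \<bullet> e = 0}" for x by (simp add: P_def inner_diff_left ee)
  have Pt: "P (x + s *\<^sub>R e) = P x" for x s by (simp add: P_def inner_add_left ee algebra_simps)
  have contP: "continuous_on UNIV (\<lambda>x. \<gamma> (P x))"
  proof (rule continuous_on_compose2[OF lipschitz_on_continuous_on[OF lip]])
    show "continuous_on UNIV P" unfolding P_def by (intro continuous_intros)
  qed (use P0 in blast)
  obtain \<rho> where \<rho>: "\<rho> > 0" "ball p \<rho> \<subseteq> U" using U openE by blast
  \<comment> \<open>Half the radius, so that points of the closed ball of radius r stay in the chart
    \<open>U\<close> when shifted by less than r.\<close>
  define r where "r = \<rho> / 2"
  have r: "r > 0" using \<rho> by (simp add: r_def)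
  have near: "x + s *\<^sub>R e \<in> U" if "x \<in> cball p r" "\<bar>s\<bar> < r" for x s
  proof -
    have "dist p (x + s *\<^sub>R e) \<le> dist p x + dist x (x + s *\<^sub>R e)" by (rule dist_triangle)
    also have "\<dots> < r + r" using that e by (intro add_le_less_mono) (auto simp: dist_norm)
    finally show ?thesis using \<rho> by (auto simp: r_def)
  qed
  let ?A = "ball p r \<inter> K"
  have A: "open ?A" "bounded ?A" using K by auto
  then have As: "?A \<in> sets lebesgue" by auto
  have Ks: "K \<in> sets lebesgue" using K by auto
  \<comment> \<open>On the closure the height inequality is only weak. A shift by t > 0 makes it
    strict again, and so moves the closure of the piece, which is compact, into
    \<open>K\<close>.\<close>
  have clA: "y \<in> cball p r \<and> \<gamma> (P y) \<le> y \<bullet> e" if "y \<in> closure ?A" for y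
  proof -
    have "?A \<subseteq> cball p r \<inter> {y. \<gamma> (P y) \<le> y \<bullet> e}"
    proof
      fix x assume x: "x \<in> ?A"
      then have "x \<in> U \<inter> K" using near[of x 0] r by auto
      then show "x \<in> cball p r \<inter> {y. \<gamma> (P y) \<le> y \<bullet> e}" using UK x by (auto simp: P_def)
    qed
    moreover have "closed (cball p r \<inter> {y. \<gamma> (P y) \<le> y \<bullet> e})"
      by (intro closed_Int closed_cball closed_Collect_le contP continuous_intros)
    ultimately show ?thesis using closure_minimal that by blast
  qed
  have "\<exists>C. compact C \<and> C \<subseteq> K \<and> (\<forall>v g. has_weak_gradient K v g \<longrightarrow>
      sq_int ?A v \<le> 2 * t\<^sup>2 * gsq_int K g + 2 * sq_int C v)" if t: "0 < t" "t < r" for t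
  proof (intro exI[of _ "(\<lambda>x. x + t *\<^sub>R e) ` closure ?A"] conjI allI impI)
    let ?z = "t *\<^sub>R e" and ?C = "(\<lambda>x. x + t *\<^sub>R e) ` closure ?A"
    show C: "compact ?C"
      using A(2) compact_translation[of "closure ?A" ?z] by (simp add: compact_closure add.commute)
    show CK: "?C \<subseteq> K"
    proof
      fix y assume "y \<in> ?C"
      then obtain x where x: "x \<in> closure ?A" "y = x + ?z" by blast
      then have "y \<in> U" using near[of x t] clA t by auto
      moreover have "\<gamma> (P y) < y \<bullet> e" using x clA[OF x(1)] t by (simp add: Pt inner_add_left ee)
      ultimately show "y \<in> K" using UK by (auto simp: P_def)
    qed
    fix v g assume hw: "has_weak_gradient K v g"
    have seg: "x + s *\<^sub>R ?z \<in> K" if "x \<in> ?A" "s \<in> {0..1}" for x s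
    proof -
      have "0 \<le> s * t" "s * t \<le> t" using that t by (auto simp: mult_left_le_one_le)
      moreover from this have "\<bar>s * t\<bar> < r" using t by linarith
      ultimately have "x + (s * t) *\<^sub>R e \<in> U" "0 \<le> s * t" using near[of x "s * t"] that by auto
      moreover have "x \<in> U \<inter> K" using near[of x 0] r that by auto
      then have "\<gamma> (P x) < x \<bullet> e" using UK by (auto simp: P_def)
      then have "\<gamma> (P (x + (s * t) *\<^sub>R e)) < (x + (s * t) *\<^sub>R e) \<bullet> e"
        using \<open>0 \<le> s * t\<close> unfolding Pt by (simp add: inner_add_left ee)
      ultimately show ?thesis using UK by (auto simp: P_def)
    qed
    note T = translation_estimate[OF A K hw seg]
    have "(norm ?z)\<^sup>2 = t\<^sup>2" using e by simp
    have AzK: "(\<lambda>x. x + ?z) ` ?A \<subseteq> K" using seg[of _ 1] by auto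
    have Azs: "(\<lambda>x. x + ?z) ` ?A \<in> sets lebesgue"
      using lebesgue_sets_translation[OF As, of ?z] by (simp add: add.commute)
    have Cs: "?C \<in> sets lebesgue" using C by (simp add: lmeasurable_compact fmeasurableD)
    note vL = has_weak_gradientD(1)[OF hw]
    note tr = L2_translate[OF As L2_subset[OF AzK Azs Ks vL]]
    have vA: "v \<in> L2 ?A" by (rule L2_subset[OF Int_lower2 As Ks vL])
    have "sq_int ?A v \<le> 2 * sq_int ?A (\<lambda>x. v x - v (x + ?z)) + 2 * sq_int ?A (\<lambda>x. v (x + ?z))"
      using L2_triangle_square_le[OF vA tr(1) L2_zero] by simp
    also have "sq_int ?A (\<lambda>x. v x - v (x + ?z)) = sq_int ?A (\<lambda>x. v (x + ?z) - v x)"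
      by (simp add: power2_commute)
    also have "\<dots> \<le> t\<^sup>2 * gsq_int K g" using T(2) \<open>(norm ?z)\<^sup>2 = t\<^sup>2\<close> by simp
    also have "sq_int ?A (\<lambda>x. v (x + ?z)) = sq_int ((\<lambda>x. x + ?z) ` ?A) v" by (rule tr(2))
    also have "\<dots> \<le> sq_int ?C v"
      by (rule sq_int_subset[OF image_mono[OF closure_subset] Azs Cs L2_subset[OF CK Cs Ks vL]])
    finally show "sq_int ?A v \<le> 2 * t\<^sup>2 * gsq_int K g + 2 * sq_int ?C v" by simp
  qed
  then show thesis using that[OF r] by blast
qed

text \<open>Finitely many balls from \<open>boundary_shift\<close> cover the compact boundary, and a
  common shift length is used in all of them. What the balls leave of the closure of
  \<open>K\<close> is compact and contained in \<open>K\<close>; together with the shifted pieces it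
  forms \<open>C\<close>.\<close>

lemma compact_part_dominates:
  fixes K :: "(real^'d) set"
  assumes dom: "bounded_lipschitz_domain K" and \<epsilon>: "\<epsilon> > 0"
  obtains C M where "compact C" "C \<subseteq> K" "M > 0"
    "\<And>v g. has_weak_gradient K v g \<Longrightarrow> sq_int K v \<le> \<epsilon> * gsq_int K g + M * sq_int C v"
proof -
  have K: "open K" "bounded K" using dom by (auto simp: bounded_lipschitz_domain_def)
  then have Ks: "K \<in> sets lebesgue" by auto
  have "\<forall>p\<in>frontier K. \<exists>r. r > 0 \<and> (\<forall>t. 0 < t \<longrightarrow> t < r \<longrightarrow> (\<exists>C. compact C \<and> C \<subseteq> K \<and>
    (\<forall>v g. has_weak_gradient K v g \<longrightarrow> sq_int (ball p r \<inter> K) v \<le> 2 * t\<^sup>2 * gsq_int K g + 2 * sq_int C v)))"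
  proof
    fix p assume "p \<in> frontier K"
    then show "\<exists>r. r > 0 \<and> (\<forall>t. 0 < t \<longrightarrow> t < r \<longrightarrow> (\<exists>C. compact C \<and> C \<subseteq> K \<and>
    (\<forall>v g. has_weak_gradient K v g \<longrightarrow> sq_int (ball p r \<inter> K) v \<le> 2 * t\<^sup>2 * gsq_int K g + 2 * sq_int C v)))"
    proof (rule boundary_shift[OF dom])
      fix r :: real assume "r > 0" and r: "\<And>t. 0 < t \<Longrightarrow> t < r \<Longrightarrow> \<exists>C. compact C \<and> C \<subseteq> K \<and>
    (\<forall>v g. has_weak_gradient K v g \<longrightarrow> sq_int (ball p r \<inter> K) v \<le> 2 * t\<^sup>2 * gsq_int K g + 2 * sq_int C v)"
      show "\<exists>r. r > 0 \<and> (\<forall>t. 0 < t \<longrightarrow> t < r \<longrightarrow> (\<exists>C. compact C \<and> C \<subseteq> K \<and>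
    (\<forall>v g. has_weak_gradient K v g \<longrightarrow> sq_int (ball p r \<inter> K) v \<le> 2 * t\<^sup>2 * gsq_int K g + 2 * sq_int C v)))"
        by (intro exI[of _ r] conjI allI impI \<open>r > 0\<close>) (rule r)
    qed
  qed
  from bchoice[OF this] obtain r where r: "\<And>p. p \<in> frontier K \<Longrightarrow> r p > 0"
    "\<And>p t. p \<in> frontier K \<Longrightarrow> 0 < t \<Longrightarrow> t < r p \<Longrightarrow> \<exists>C. compact C \<and> C \<subseteq> K \<and>
    (\<forall>v g. has_weak_gradient K v g \<longrightarrow> sq_int (ball p (r p) \<inter> K) v \<le> 2 * t\<^sup>2 * gsq_int K g + 2 * sq_int C v)"
    by blast
  have "compact (frontier K)" using K(2) by (rule compact_frontier_bounded)
  moreover have "frontier K \<subseteq> (\<Union>p\<in>frontier K. ball p (r p))" using r(1) by auto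
  ultimately obtain D where D: "D \<subseteq> frontier K" "finite D" "frontier K \<subseteq> (\<Union>p\<in>D. ball p (r p))"
    using compactE_image[of "frontier K" "frontier K" "\<lambda>p. ball p (r p)"] by auto
  let ?N = "real (card D)"
  \<comment> \<open>The shift must be shorter than each of the finitely many radii, and every ball
    contributes 2 t^2 to the factor of the gradient integral; hence the last condition. In its
    construction the added 1 guards against an empty \<open>D\<close>.\<close>
  obtain t where t: "t > 0" "\<And>p. p \<in> D \<Longrightarrow> t < r p" "2 * ?N * t\<^sup>2 \<le> \<epsilon>"
  proof -
    define s where "s = Min (insert 1 (r ` D))"
    have s: "s > 0" "s \<le> 1" "\<And>p. p \<in> D \<Longrightarrow> s \<le> r p" using D r(1) by (auto simp: s_def)
    define t where "t = min (s / 2) (\<epsilon> / (2 * (?N + 1)))"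
    have t: "t > 0" "t < s" "t \<le> \<epsilon> / (2 * (?N + 1))" using s \<epsilon> by (auto simp: t_def)
    have "t\<^sup>2 \<le> t" using t s by (simp add: power2_eq_square mult_left_le)
    then have "2 * ?N * t\<^sup>2 \<le> 2 * (?N + 1) * t" using t by (intro mult_mono) auto
    also have "\<dots> \<le> 2 * (?N + 1) * (\<epsilon> / (2 * (?N + 1)))" using t by (intro mult_left_mono) auto
    also have "\<dots> = \<epsilon>" by (simp add: field_simps)
    finally show thesis using that[of t] t s by fastforce
  qed
  have "\<forall>p\<in>D. \<exists>C. compact C \<and> C \<subseteq> K \<and>
    (\<forall>v g. has_weak_gradient K v g \<longrightarrow> sq_int (ball p (r p) \<inter> K) v \<le> 2 * t\<^sup>2 * gsq_int K g + 2 * sq_int C v)"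
    using r(2) D(1) t(1,2) by blast
  from bchoice[OF this] obtain c where c: "\<And>p. p \<in> D \<Longrightarrow> compact (c p)" "\<And>p. p \<in> D \<Longrightarrow> c p \<subseteq> K"
    "\<And>p v g. p \<in> D \<Longrightarrow> has_weak_gradient K v g \<Longrightarrow>
      sq_int (ball p (r p) \<inter> K) v \<le> 2 * t\<^sup>2 * gsq_int K g + 2 * sq_int (c p) v" by blast
  define C0 where "C0 = closure K - (\<Union>p\<in>D. ball p (r p))"
  have C0: "compact C0" "C0 \<subseteq> K"
  proof -
    show "compact C0" unfolding C0_def using K(2) by (intro compact_diff) (auto simp: compact_closure)
    show "C0 \<subseteq> K" unfolding C0_def using D(3) K(1) by (auto simp: frontier_def interior_open)
  qed
  define C where "C = C0 \<union> (\<Union>p\<in>D. c p)"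
  have C: "compact C" "C \<subseteq> K" using C0 c D(2) by (auto simp: C_def intro!: compact_Un compact_UN)
  have ms: "X \<in> sets lebesgue" if "compact X" for X :: "(real^'d) set"
    using that by (simp add: lmeasurable_compact fmeasurableD)
  have "sq_int K v \<le> \<epsilon> * gsq_int K g + (1 + 2 * ?N) * sq_int C v" if hw: "has_weak_gradient K v g" for v g
  proof -
    note vL = has_weak_gradientD(1)[OF hw]
    have vi: "integrable (lebesgue_on K) (\<lambda>x. (v x)\<^sup>2)" using vL by (simp add: L2_def)
    have vC: "v \<in> L2 C" by (rule L2_subset[OF C(2) ms[OF C(1)] Ks vL])
    let ?Q = "\<lambda>i. case i of None \<Rightarrow> C0 | Some p \<Rightarrow> ball p (r p) \<inter> K"
    have "sq_int K v \<le> (\<Sum>i\<in>insert None (Some ` D). sq_int (?Q i) v)"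
    proof (rule integral_le_sum_cover[OF Ks _ _ _ _ vi])
      show "K \<subseteq> (\<Union>i\<in>insert None (Some ` D). ?Q i)"
        using closure_subset[of K] by (auto simp: C0_def)
    qed (use D(2) C0 ms K(1) in \<open>auto split: option.splits\<close>)
    also have "\<dots> = sq_int C0 v + (\<Sum>p\<in>D. sq_int (ball p (r p) \<inter> K) v)"
      using D(2) by (simp add: sum.reindex)
    also have "\<dots> \<le> sq_int C v + (\<Sum>p\<in>D. 2 * t\<^sup>2 * gsq_int K g + 2 * sq_int C v)"
    proof (rule add_mono)
      show "sq_int C0 v \<le> sq_int C v"
        by (rule sq_int_subset[OF _ ms[OF C0(1)] ms[OF C(1)] vC]) (auto simp: C_def)
      have "sq_int (c p) v \<le> sq_int C v" if "p \<in> D" for p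
        by (rule sq_int_subset[OF _ ms[OF c(1)[OF that]] ms[OF C(1)] vC]) (use that in \<open>auto simp: C_def\<close>)
      then show "(\<Sum>p\<in>D. sq_int (ball p (r p) \<inter> K) v) \<le> (\<Sum>p\<in>D. 2 * t\<^sup>2 * gsq_int K g + 2 * sq_int C v)"
        using c(3)[OF _ hw] by (intro sum_mono) (meson add_left_mono mult_left_mono order_trans zero_le_numeral)
    qed
    also have "\<dots> = (2 * ?N * t\<^sup>2) * gsq_int K g + (1 + 2 * ?N) * sq_int C v"
      by (simp add: algebra_simps)
    also have "(2 * ?N * t\<^sup>2) * gsq_int K g \<le> \<epsilon> * gsq_int K g"
      using t(3) by (intro mult_right_mono) auto
    finally show ?thesis by simp
  qed
  then show thesis using that[OF C, of "1 + 2 * ?N"] by simp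
qed

text \<open>This is compactness in quantitative form: up to a small multiple of the gradient, the
  square norm is controlled by finitely many continuous linear functionals. Half of \<epsilon> is
  spent near the boundary, and the interior estimate is applied with \<epsilon> / (2 M) because its
  result is multiplied by \<open>M\<close>.\<close>

lemma finitely_many_functionals:
  fixes K :: "(real^'d) set"
  assumes dom: "bounded_lipschitz_domain K" and \<epsilon>: "\<epsilon> > 0"
  obtains \<Q> M where "finite \<Q>" "\<And>Q. Q \<in> \<Q> \<Longrightarrow> open Q \<and> Q \<subseteq> K" "M \<ge> 0"
    "\<And>v g. has_weak_gradient K v g \<Longrightarrow>
      sq_int K v \<le> \<epsilon> * gsq_int K g + M * (\<Sum>Q\<in>\<Q>. (LINT x|lebesgue_on Q. v x)\<^sup>2)"
proof -
  have K: "open K" "bounded K" using dom by (auto simp: bounded_lipschitz_domain_def)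
  obtain C M where C: "compact C" "C \<subseteq> K" and M: "M > 0" and
    1: "\<And>v g. has_weak_gradient K v g \<Longrightarrow> sq_int K v \<le> (\<epsilon> / 2) * gsq_int K g + M * sq_int C v"
    using compact_part_dominates[OF dom, of "\<epsilon> / 2"] \<epsilon> by (metis half_gt_zero)
  have "\<epsilon> / (2 * M) > 0" using \<epsilon> M by simp
  from interior_functionals[OF K C this] obtain \<Q> N where Q: "finite \<Q>" "\<And>Q. Q \<in> \<Q> \<Longrightarrow> open Q \<and> Q \<subseteq> K" "N \<ge> 0"
    and 2: "\<And>v g. has_weak_gradient K v g \<Longrightarrow>
      sq_int C v \<le> \<epsilon> / (2 * M) * gsq_int K g + N * (\<Sum>Q\<in>\<Q>. (LINT x|lebesgue_on Q. v x)\<^sup>2)" by metis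
  have "sq_int K v \<le> \<epsilon> * gsq_int K g + (M * N) * (\<Sum>Q\<in>\<Q>. (LINT x|lebesgue_on Q. v x)\<^sup>2)"
    if hw: "has_weak_gradient K v g" for v g
  proof -
    have "M * sq_int C v \<le> M * (\<epsilon> / (2 * M) * gsq_int K g + N * (\<Sum>Q\<in>\<Q>. (LINT x|lebesgue_on Q. v x)\<^sup>2))"
      using 2[OF hw] M by (intro mult_left_mono) auto
    also have "\<dots> = (\<epsilon> / 2) * gsq_int K g + (M * N) * (\<Sum>Q\<in>\<Q>. (LINT x|lebesgue_on Q. v x)\<^sup>2)"
      using M by (simp add: distrib_left)
    finally show ?thesis using 1[OF hw] by simp
  qed
  then show thesis using that[OF Q(1,2), of "M * N"] M Q(3) by simp
qed

section \<open>Extraction of Cauchy subsequences\<close>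

lemma finite_common_subseq:
  fixes a :: "'b \<Rightarrow> nat \<Rightarrow> real"
  assumes "finite I" "\<And>i. i \<in> I \<Longrightarrow> bounded (range (a i))"
  shows "\<exists>r. strict_mono (r :: nat \<Rightarrow> nat) \<and> (\<forall>i\<in>I. convergent (a i \<circ> r))"
  using assms
proof (induction I rule: finite_induct)
  case empty
  then show ?case using strict_mono_id by auto
next
  case (insert j F)
  then obtain r where r: "strict_mono (r :: nat \<Rightarrow> nat)" "\<And>i. i \<in> F \<Longrightarrow> convergent (a i \<circ> r)" by blast
  have "bounded (range (a j \<circ> r))" using insert.prems[of j] by (auto intro: bounded_subset)
  then obtain l s where s: "strict_mono (s :: nat \<Rightarrow> nat)" "((a j \<circ> r) \<circ> s) \<longlonglongrightarrow> l"
    using bounded_imp_convergent_subsequence by blast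
  have "convergent (a i \<circ> (r \<circ> s))" if "i \<in> insert j F" for i
  proof (cases "i = j")
    case True
    then show ?thesis using s(2) by (auto simp: convergent_def o_assoc)
  next
    case False
    then show ?thesis using that r(2)[of i] convergent_subseq_convergent[OF _ s(1)] by (auto simp: o_assoc)
  qed
  then show ?case using strict_mono_o[OF r(1) s(1)] by blast
qed

text \<open>For each tolerance 1 / (k + 1) the norms of differences are controlled by finitely many
  bounded functionals, and a subsequence on which these converge meets the tolerance. A diagonal
  subsequence meets all tolerances. The result is stated as a Cauchy property, so that the limit can
  be taken together with the gradients later.\<close>

theorem rellich:
  fixes K :: "(real^'d) set"
  assumes dom: "bounded_lipschitz_domain K" and hw: "\<And>n. has_weak_gradient K (v n) (g n)"
    and bv: "\<And>n. sq_int K (v n) \<le> B" and bg: "\<And>n. gsq_int K (g n) \<le> B"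
  shows "\<exists>r. strict_mono (r :: nat \<Rightarrow> nat) \<and>
    (\<forall>e>0. \<exists>N. \<forall>m\<ge>N. \<forall>n\<ge>N. sq_int K (\<lambda>x. v (r m) x - v (r n) x) < e)"
proof -
  have K: "open K" "bounded K" "K \<in> lmeasurable" "K \<in> sets lebesgue"
    using dom by (auto simp: bounded_lipschitz_domain_def lmeasurable_open)
  have B: "B \<ge> 0" using bv[of 0] sq_int_nonneg[of K "v 0"] by linarith
  note vL = has_weak_gradientD(1)[OF hw]
  have hd: "has_weak_gradient K (\<lambda>x. v m x - v n x) (\<lambda>x. g m x - g n x)" for m n
    using has_weak_gradient_lin[OF K(3) hw hw, of m "-1" n] by simp
  have gd: "gsq_int K (\<lambda>x. g m x - g n x) \<le> 4 * B" for m n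
    using gsq_int_lin_le[OF has_weak_gradientD(2)[OF hw] has_weak_gradientD(2)[OF hw], of m "-1" n] bg[of m] bg[of n]
    by simp
  \<comment> \<open>The property to be secured at stage k of the diagonal construction: the tail of
    the subsequence has pairwise squared distances below 1 / (k + 1).\<close>
  define P where "P = (\<lambda>k (s :: nat \<Rightarrow> nat). \<exists>N. \<forall>m\<ge>N. \<forall>n\<ge>N. sq_int K (\<lambda>x. v (s m) x - v (s n) x) < 1 / real (Suc k))"
  interpret subseqs P
  proof
    fix k and s :: "nat \<Rightarrow> nat" assume s: "strict_mono s"
    \<comment> \<open>Gradients of differences have square integral at most 4 B, so with this
      \<epsilon> the gradient term uses at most half of the tolerance; the added 1 covers B =
      0.\<close>
    define \<epsilon> where "\<epsilon> = 1 / (2 * real (Suc k)) / (4 * B + 1)"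
    have \<epsilon>: "\<epsilon> > 0" using B unfolding \<epsilon>_def by (intro divide_pos_pos) auto
    have \<epsilon>B: "\<epsilon> * (4 * B + 1) = 1 / (2 * real (Suc k))"
      unfolding \<epsilon>_def by (rule nonzero_eq_divide_eq[THEN iffD1, OF _ refl]) (use B in linarith)
    obtain \<Q> M where Q: "finite \<Q>" "\<And>Q. Q \<in> \<Q> \<Longrightarrow> open Q \<and> Q \<subseteq> K" and M: "M \<ge> 0"
      and est: "\<And>v g. has_weak_gradient K v g \<Longrightarrow>
      sq_int K v \<le> \<epsilon> * gsq_int K g + M * (\<Sum>Q\<in>\<Q>. (LINT x|lebesgue_on Q. v x)\<^sup>2)"
      using finitely_many_functionals[OF dom \<epsilon>] by metis
    define a where "a = (\<lambda>Q n. LINT x|lebesgue_on Q. v (s n) x)"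
    have vQi: "integrable (lebesgue_on Q) (v n)" if "Q \<in> \<Q>" for Q n
      using Q(2)[OF that] K by (intro integrable_lebesgue_on_subset[OF _ _ _ L2_integrable[OF K(3) vL]]) auto
    have "bounded (range (a Q))" if "Q \<in> \<Q>" for Q
    proof -
      have Qs: "Q \<subseteq> K" "Q \<in> sets lebesgue" "Q \<in> lmeasurable"
        using Q(2)[OF that] K(2) bounded_subset by (auto intro!: lmeasurable_open)
      have one: "(\<lambda>_. 1) \<in> L2 Q" by (rule L2_bounded[OF Qs(3), of _ 1]) auto
      have "\<bar>a Q n\<bar> \<le> sqrt B * sqrt (sq_int Q (\<lambda>_. 1))" for n
      proof -
        have vQ: "v (s n) \<in> L2 Q" by (rule L2_subset[OF Qs(1,2) K(4) vL])
        have "\<bar>a Q n\<bar> \<le> sqrt (sq_int Q (v (s n))) * sqrt (sq_int Q (\<lambda>_. 1))"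
          using L2_abs_integral_le[OF vQ one] by (simp add: a_def)
        also have "\<dots> \<le> sqrt B * sqrt (sq_int Q (\<lambda>_. 1))"
          using sq_int_subset[OF Qs(1,2) K(4) vL, of "s n"] bv[of "s n"]
          by (intro mult_right_mono real_sqrt_le_mono) auto
        finally show ?thesis .
      qed
      then show ?thesis by (auto simp: bounded_iff)
    qed
    from finite_common_subseq[OF Q(1), of a, OF this] obtain r where r: "strict_mono (r :: nat \<Rightarrow> nat)"
      "\<And>Q. Q \<in> \<Q> \<Longrightarrow> convergent (a Q \<circ> r)" by blast
    have "\<exists>N. \<forall>m\<ge>N. \<forall>n\<ge>N. M * (\<Sum>Q\<in>\<Q>. (a Q (r m) - a Q (r n))\<^sup>2) < 1 / (2 * real (Suc k))"
    proof -
      \<comment> \<open>Chosen so that (M + 1) (card \<Q> + 1) \<eta> is the other half of the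
        tolerance; the added ones avoid vanishing factors and make the comparison strict.\<close>
      define \<eta> where "\<eta> = 1 / (2 * real (Suc k) * (M + 1) * (card \<Q> + 1))"
      have \<eta>: "\<eta> > 0" using M by (simp add: \<eta>_def add_nonneg_pos)
      have "\<forall>Q\<in>\<Q>. \<forall>\<^sub>F N in sequentially. \<forall>m\<ge>N. \<forall>n\<ge>N. (a Q (r m) - a Q (r n))\<^sup>2 < \<eta>"
      proof
        fix Q assume "Q \<in> \<Q>"
        then have "Cauchy (a Q \<circ> r)" using r(2) convergent_Cauchy by blast
        then obtain N where N: "\<And>m n. m \<ge> N \<Longrightarrow> n \<ge> N \<Longrightarrow> \<bar>a Q (r m) - a Q (r n)\<bar> < sqrt \<eta>"
          using \<eta> unfolding Cauchy_def by (auto simp: dist_real_def dest!: spec[of _ "sqrt \<eta>"])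
        have "(a Q (r m) - a Q (r n))\<^sup>2 < \<eta>" if "m \<ge> N" "n \<ge> N" for m n
          using power_strict_mono[OF N[OF that], of 2] \<eta> by simp
        then show "\<forall>\<^sub>F N in sequentially. \<forall>m\<ge>N. \<forall>n\<ge>N. (a Q (r m) - a Q (r n))\<^sup>2 < \<eta>"
          unfolding eventually_sequentially by (intro exI[of _ N]) (meson order_trans)
      qed
      then have "\<forall>\<^sub>F N in sequentially. \<forall>Q\<in>\<Q>. \<forall>m\<ge>N. \<forall>n\<ge>N. (a Q (r m) - a Q (r n))\<^sup>2 < \<eta>"
        using Q(1) by (simp add: eventually_ball_finite_distrib)
      then obtain N where N: "\<And>Q m n. Q \<in> \<Q> \<Longrightarrow> m \<ge> N \<Longrightarrow> n \<ge> N \<Longrightarrow> (a Q (r m) - a Q (r n))\<^sup>2 < \<eta>"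
        unfolding eventually_sequentially by blast
      have "M * (\<Sum>Q\<in>\<Q>. (a Q (r m) - a Q (r n))\<^sup>2) < 1 / (2 * real (Suc k))" if "m \<ge> N" "n \<ge> N" for m n
      proof -
        have "(\<Sum>Q\<in>\<Q>. (a Q (r m) - a Q (r n))\<^sup>2) \<le> (\<Sum>Q\<in>\<Q>. \<eta>)"
          using N[OF _ that] by (intro sum_mono) (simp add: less_imp_le)
        then have "M * (\<Sum>Q\<in>\<Q>. (a Q (r m) - a Q (r n))\<^sup>2) \<le> M * (card \<Q> * \<eta>)" using M by (intro mult_left_mono) auto
        also have "\<dots> < (M + 1) * ((card \<Q> + 1) * \<eta>)"
          by (rule mult_strict_mono) (use M \<eta> in auto)
        also have "\<dots> = 1 / (2 * real (Suc k))" using M by (simp add: \<eta>_def field_simps add_nonneg_eq_0_iff)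
        finally show ?thesis .
      qed
      then show ?thesis by blast
    qed
    then obtain N where N: "\<And>m n. m \<ge> N \<Longrightarrow> n \<ge> N \<Longrightarrow> M * (\<Sum>Q\<in>\<Q>. (a Q (r m) - a Q (r n))\<^sup>2) < 1 / (2 * real (Suc k))"
      by blast
    have "sq_int K (\<lambda>x. v ((s \<circ> r) m) x - v ((s \<circ> r) n) x) < 1 / real (Suc k)" if "m \<ge> N" "n \<ge> N" for m n
    proof -
      have "(\<Sum>Q\<in>\<Q>. (LINT x|lebesgue_on Q. v (s (r m)) x - v (s (r n)) x)\<^sup>2) = (\<Sum>Q\<in>\<Q>. (a Q (r m) - a Q (r n))\<^sup>2)"
        using vQi by (intro sum.cong) (auto simp: a_def)
      then have "sq_int K (\<lambda>x. v (s (r m)) x - v (s (r n)) x) \<le>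
          \<epsilon> * gsq_int K (\<lambda>x. g (s (r m)) x - g (s (r n)) x) + M * (\<Sum>Q\<in>\<Q>. (a Q (r m) - a Q (r n))\<^sup>2)"
        using est[OF hd, of "s (r m)" "s (r n)"] by simp
      also have "\<epsilon> * gsq_int K (\<lambda>x. g (s (r m)) x - g (s (r n)) x) + M * (\<Sum>Q\<in>\<Q>. (a Q (r m) - a Q (r n))\<^sup>2)
          < 1 / (2 * real (Suc k)) + 1 / (2 * real (Suc k))"
        unfolding \<epsilon>B[symmetric]
      proof (rule add_le_less_mono[OF _ N[OF that, folded \<epsilon>B]])
        show "\<epsilon> * gsq_int K (\<lambda>x. g (s (r m)) x - g (s (r n)) x) \<le> \<epsilon> * (4 * B + 1)"
        using gd[of "s (r m)" "s (r n)"] \<epsilon> by (intro mult_left_mono) auto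
      qed
      also have "1 / (2 * real (Suc k)) + 1 / (2 * real (Suc k)) = 1 / real (Suc k)"
        by (simp add: field_simps)
      finally show ?thesis unfolding o_def .
    qed
    then show "\<exists>r'. strict_mono r' \<and> P k (s \<circ> r')" unfolding P_def using r(1) by blast
  qed
  have stable: "P k (s \<circ> r)" if r: "strict_mono r" and Pks: "P k s" for r s k
  proof -
    obtain N where N: "\<And>m n. m \<ge> N \<Longrightarrow> n \<ge> N \<Longrightarrow> sq_int K (\<lambda>x. v (s m) x - v (s n) x) < 1 / real (Suc k)"
      using Pks unfolding P_def by blast
    show ?thesis unfolding P_def
      by (intro exI[of _ N]) (use N seq_suble[OF r] in \<open>auto simp: o_def intro: order_trans\<close>)
  qed
  have "\<exists>N. \<forall>m\<ge>N. \<forall>n\<ge>N. sq_int K (\<lambda>x. v (diagseq m) x - v (diagseq n) x) < e" if "e > 0" for e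
  proof -
    obtain k where k: "1 / real (Suc k) < e" using \<open>e > 0\<close> nat_approx_posE by blast
    \<comment> \<open>From index \<open>Suc k\<close> on, the diagonal sequence is a subsequence of
      the one obtained at stage k, and \<open>stable\<close> says that \<open>P k\<close> survives
      passing to subsequences.\<close>
    have "P k (diagseq \<circ> ((+) (Suc k)))" by (rule diagseq_holds[OF stable])
    then obtain N where N: "\<And>m n. m \<ge> N \<Longrightarrow> n \<ge> N \<Longrightarrow>
        sq_int K (\<lambda>x. v (diagseq (Suc k + m)) x - v (diagseq (Suc k + n)) x) < 1 / real (Suc k)"
      unfolding P_def by auto
    have "sq_int K (\<lambda>x. v (diagseq m) x - v (diagseq n) x) < e" if "m \<ge> Suc k + N" "n \<ge> Suc k + N" for m n
    proof -
      have "m - Suc k \<ge> N" "n - Suc k \<ge> N" using that by linarith+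
      from N[OF this] show ?thesis using that k by simp
    qed
    then show ?thesis by blast
  qed
  then show ?thesis using subseq_diagseq by blast
qed

section \<open>Weighted forms\<close>

text \<open>One locale for every pair of a domain and a coefficient: it is instantiated with
  \<kappa> and with the scaled \<kappa>', on the whole domain and on each element.\<close>

locale weighted_domain =
  fixes S :: "(real^'d) set" and \<kappa> :: "real^'d \<Rightarrow> real" and \<kappa>min \<kappa>max :: real
  assumes S: "open S" "bounded S"
    and \<kappa>_meas: "\<kappa> \<in> borel_measurable (lebesgue_on S)"
    and \<kappa>min: "0 < \<kappa>min"
    and \<kappa>_bounds: "AE x in lebesgue_on S. \<kappa>min \<le> \<kappa> x \<and> \<kappa> x \<le> \<kappa>max"
begin

lemma S_lmeasurable: "S \<in> lmeasurable" and S_sets: "S \<in> sets lebesgue"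
  using S by (auto simp: lmeasurable_open)

lemma \<kappa>_abs: "AE x in lebesgue_on S. \<bar>\<kappa> x\<bar> \<le> \<kappa>max"
  using \<kappa>_bounds by eventually_elim (use \<kappa>min in linarith)

lemma integrable_weight: "u \<in> L2 S \<Longrightarrow> v \<in> L2 S \<Longrightarrow> integrable (lebesgue_on S) (\<lambda>x. \<kappa> x * u x * v x)"
  by (rule L2_integrable_mult_weight[OF _ _ \<kappa>_meas \<kappa>_abs])

sublocale mass: semi_inner "L2 S" "mass_form \<kappa> S"
proof (rule mass_form_semi_inner[OF \<kappa>_meas])
  show "AE x in lebesgue_on S. 0 \<le> \<kappa> x \<and> \<kappa> x \<le> \<kappa>max"
    using \<kappa>_bounds by eventually_elim (use \<kappa>min in linarith)
qed

lemma mass_form_bounds: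
  assumes "v \<in> L2 S"
  shows "\<kappa>min * sq_int S v \<le> mass_form \<kappa> S v v" "mass_form \<kappa> S v v \<le> \<kappa>max * sq_int S v"
proof -
  have i: "integrable (lebesgue_on S) (\<lambda>x. c * (v x)\<^sup>2)" for c using assms by (simp add: L2_def)
  note j = integrable_weight[OF assms assms]
  have "(LINT x|lebesgue_on S. \<kappa>min * (v x)\<^sup>2) \<le> (LINT x|lebesgue_on S. \<kappa> x * v x * v x)"
    by (rule integral_mono_AE[OF i j], use \<kappa>_bounds in eventually_elim)
       (auto simp: power2_eq_square mult.assoc intro!: mult_right_mono)
  then show "\<kappa>min * sq_int S v \<le> mass_form \<kappa> S v v" by (simp add: mass_form_def)
  have "(LINT x|lebesgue_on S. \<kappa> x * v x * v x) \<le> (LINT x|lebesgue_on S. \<kappa>max * (v x)\<^sup>2)"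
    by (rule integral_mono_AE[OF j i], use \<kappa>_bounds in eventually_elim)
       (auto simp: power2_eq_square mult.assoc intro!: mult_right_mono)
  then show "mass_form \<kappa> S v v \<le> \<kappa>max * sq_int S v" by (simp add: mass_form_def)
qed

lemma mass_form_zero:
  assumes "v \<in> L2 S" "mass_form \<kappa> S v v = 0"
  shows "AE x in lebesgue_on S. v x = 0"
proof -
  have "\<kappa>min * sq_int S v \<le> 0" using mass_form_bounds(1)[OF assms(1)] assms(2) by simp
  then have "sq_int S v = 0" using \<kappa>min sq_int_nonneg[of S v] by (simp add: mult_le_0_iff antisym)
  then show ?thesis using sq_int_zero_iff[OF assms(1)] by simp
qed

lemma mass_form_cong_AE:
  assumes "u \<in> L2 S" "v \<in> L2 S" "AE x in lebesgue_on S. u x = u' x" "AE x in lebesgue_on S. v x = v' x"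
  shows "mass_form \<kappa> S u v = mass_form \<kappa> S u' v'"
  unfolding mass_form_def
proof (rule integral_cong_AE)
  have "u' \<in> L2 S" "v' \<in> L2 S" using L2_AE_eq[OF S_sets assms(3,1)] L2_AE_eq[OF S_sets assms(4,2)] .
  then show "(\<lambda>x. \<kappa> x * u' x * v' x) \<in> borel_measurable (lebesgue_on S)" using integrable_weight by blast
  show "(\<lambda>x. \<kappa> x * u x * v x) \<in> borel_measurable (lebesgue_on S)" using integrable_weight assms by blast
  show "AE x in lebesgue_on S. \<kappa> x * u x * v x = \<kappa> x * u' x * v' x"
    using assms(3,4) by eventually_elim simp
qed

text \<open>This frees the form from the selected \<open>weak_gradient\<close>: any weak gradients
  may be inserted. Writing it as a sum of mass forms of the components also transfers linearity,
  positivity and the coefficient bounds from the mass form.\<close>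

lemma grad_form_eq:
  assumes u: "has_weak_gradient S u g" and v: "has_weak_gradient S v h"
  shows "grad_form \<kappa> S u v = (\<Sum>i\<in>UNIV. mass_form \<kappa> S (\<lambda>x. g x $ i) (\<lambda>x. h x $ i))"
proof -
  have i: "integrable (lebesgue_on S) (\<lambda>x. \<kappa> x * (g x $ i * h x $ i))"
    if "has_weak_gradient S u g" "has_weak_gradient S v h" for u v g h i
    using integrable_weight[OF has_weak_gradientD(2)[OF that(1)] has_weak_gradientD(2)[OF that(2)]]
    by (simp add: mult.assoc)
  have m: "(\<lambda>x. \<kappa> x * (g x \<bullet> h x)) \<in> borel_measurable (lebesgue_on S)"
    if "has_weak_gradient S u g" "has_weak_gradient S v h" for u v g h
  proof -
    have "(\<lambda>x. \<Sum>i\<in>UNIV. \<kappa> x * (g x $ i * h x $ i)) \<in> borel_measurable (lebesgue_on S)"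
      by (intro borel_measurable_sum borel_measurable_integrable[OF i[OF that]])
    then show ?thesis by (simp add: inner_vec_def sum_distrib_left)
  qed
  have wu: "has_weak_gradient S u (weak_gradient S u)" and wv: "has_weak_gradient S v (weak_gradient S v)"
    using u v by (auto intro: H1_has_weak_gradient has_weak_gradient_H1)
  have "grad_form \<kappa> S u v = (LINT x|lebesgue_on S. \<kappa> x * (g x \<bullet> h x))"
    unfolding grad_form_def
  proof (rule integral_cong_AE[OF m[OF wu wv] m[OF u v]])
    show "AE x in lebesgue_on S. \<kappa> x * (weak_gradient S u x \<bullet> weak_gradient S v x) = \<kappa> x * (g x \<bullet> h x)"
      using weak_gradient_eq[OF S u] weak_gradient_eq[OF S v] by eventually_elim simp
  qed
  also have "\<dots> = (LINT x|lebesgue_on S. (\<Sum>i\<in>UNIV. \<kappa> x * (g x $ i * h x $ i)))"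
    by (simp add: inner_vec_def sum_distrib_left)
  also have "\<dots> = (\<Sum>i\<in>UNIV. LINT x|lebesgue_on S. \<kappa> x * (g x $ i * h x $ i))"
    by (rule Bochner_Integration.integral_sum[OF i[OF u v]])
  finally show ?thesis by (simp add: mass_form_def mult.assoc)
qed

lemma grad_form_bounds:
  assumes u: "has_weak_gradient S u g"
  shows "\<kappa>min * gsq_int S g \<le> grad_form \<kappa> S u u" "grad_form \<kappa> S u u \<le> \<kappa>max * gsq_int S g"
  unfolding grad_form_eq[OF u u] gsq_int_eq(1)[OF has_weak_gradientD(2)[OF u]] sum_distrib_left
  by (intro sum_mono mass_form_bounds has_weak_gradientD(2)[OF u])+

lemma H1_lin: "u \<in> H1 S \<Longrightarrow> v \<in> H1 S \<Longrightarrow> (\<lambda>x. u x + c * v x) \<in> H1 S"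
  using has_weak_gradient_lin[OF S_lmeasurable H1_has_weak_gradient H1_has_weak_gradient] has_weak_gradient_H1
  by blast

lemma H1_L2: "u \<in> H1 S \<Longrightarrow> u \<in> L2 S"
  using H1_has_weak_gradient has_weak_gradientD(1) by blast

sublocale grad: semi_inner "H1 S" "grad_form \<kappa> S"
proof
  fix u v :: "real^'d \<Rightarrow> real" and c assume "u \<in> H1 S" "v \<in> H1 S"
  then show "(\<lambda>x. u x + c * v x) \<in> H1 S" by (rule H1_lin)
next
  fix u v :: "real^'d \<Rightarrow> real" assume "u \<in> H1 S" "v \<in> H1 S"
  show "grad_form \<kappa> S u v = grad_form \<kappa> S v u" by (simp add: grad_form_def inner_commute)
next
  fix u v w :: "real^'d \<Rightarrow> real" and c assume "u \<in> H1 S" "v \<in> H1 S" "w \<in> H1 S"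
  note h = this[THEN H1_has_weak_gradient]
  have "(\<Sum>i\<in>UNIV. mass_form \<kappa> S (\<lambda>x. (weak_gradient S u x + c *\<^sub>R weak_gradient S v x) $ i) (\<lambda>x. weak_gradient S w x $ i)) =
      (\<Sum>i\<in>UNIV. mass_form \<kappa> S (\<lambda>x. weak_gradient S u x $ i) (\<lambda>x. weak_gradient S w x $ i) +
        c * mass_form \<kappa> S (\<lambda>x. weak_gradient S v x $ i) (\<lambda>x. weak_gradient S w x $ i))"
    using mass.lin[OF has_weak_gradientD(2)[OF h(1)] has_weak_gradientD(2)[OF h(2)] has_weak_gradientD(2)[OF h(3)]]
    by (intro sum.cong) auto
  then show "grad_form \<kappa> S (\<lambda>x. u x + c * v x) w = grad_form \<kappa> S u w + c * grad_form \<kappa> S v w"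
    unfolding grad_form_eq[OF has_weak_gradient_lin[OF S_lmeasurable h(1,2)] h(3)]
      grad_form_eq[OF h(1,3)] grad_form_eq[OF h(2,3)] by (simp add: sum.distrib sum_distrib_left)
next
  fix u :: "real^'d \<Rightarrow> real" assume "u \<in> H1 S"
  note h = this[THEN H1_has_weak_gradient]
  show "grad_form \<kappa> S u u \<ge> 0" unfolding grad_form_eq[OF h h]
    by (intro sum_nonneg mass.nonneg has_weak_gradientD(2)[OF h])
qed

lemma grad_form_cong_AE:
  assumes "u \<in> H1 S" "v \<in> H1 S" "AE x in lebesgue_on S. u x = u' x" "AE x in lebesgue_on S. v x = v' x"
  shows "grad_form \<kappa> S u v = grad_form \<kappa> S u' v'"
  using grad_form_eq[OF assms(1,2)[THEN H1_has_weak_gradient]]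
    grad_form_eq[OF has_weak_gradient_AE_eq[OF S_lmeasurable H1_has_weak_gradient[OF assms(1)] assms(3)]
      has_weak_gradient_AE_eq[OF S_lmeasurable H1_has_weak_gradient[OF assms(2)] assms(4)]] by simp

end

section \<open>Orthogonal projections onto finite dimensional spaces\<close>

lemma aux_space_lin:
  assumes "p \<in> aux_space \<Phi> k" "q \<in> aux_space \<Phi> k"
  shows "(\<lambda>x. p x + a * q x) \<in> aux_space \<Phi> k"
proof -
  obtain c d where "p = (\<lambda>x. \<Sum>i=1..k. c i * \<Phi> i x)" "q = (\<lambda>x. \<Sum>i=1..k. d i * \<Phi> i x)"
    using assms by (auto simp: aux_space_def)
  then have "(\<lambda>x. p x + a * q x) = (\<lambda>x. \<Sum>i=1..k. (c i + a * d i) * \<Phi> i x)"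
    by (simp add: sum_distrib_left sum.distrib algebra_simps)
  then show ?thesis unfolding aux_space_def by (intro CollectI exI[of _ "\<lambda>i. c i + a * d i"]) simp
qed

lemma aux_space_zero: "(\<lambda>x. 0) \<in> aux_space \<Phi> k"
  unfolding aux_space_def by (rule CollectI, rule exI[of _ "\<lambda>_. 0"]) simp

lemma aux_space_basis: "i \<in> {1..k} \<Longrightarrow> \<Phi> i \<in> aux_space \<Phi> k"
proof -
  assume i: "i \<in> {1..k}"
  have "(\<Sum>j=1..k. (if j = i then 1 else 0) * \<Phi> j x) = (\<Sum>j=1..k. if j = i then \<Phi> j x else 0)" for x
    by (intro sum.cong) auto
  then have "\<Phi> i = (\<lambda>x. \<Sum>j=1..k. (if j = i then 1 else 0) * \<Phi> j x)" using i by auto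
  then show ?thesis unfolding aux_space_def by (intro CollectI exI[of _ "\<lambda>j. if j = i then 1 else 0"]) simp
qed

lemma aux_space_Suc:
  "aux_space \<Phi> (Suc k) = {\<lambda>x. p x + a * \<Phi> (Suc k) x | p a. p \<in> aux_space \<Phi> k}" (is "?L = ?R")
proof
  show "?L \<subseteq> ?R"
  proof
    fix q assume "q \<in> ?L"
    then obtain c where "q = (\<lambda>x. \<Sum>i=1..Suc k. c i * \<Phi> i x)" by (auto simp: aux_space_def)
    then have "q = (\<lambda>x. (\<Sum>i=1..k. c i * \<Phi> i x) + c (Suc k) * \<Phi> (Suc k) x)" by simp
    moreover have "(\<lambda>x. \<Sum>i=1..k. c i * \<Phi> i x) \<in> aux_space \<Phi> k" by (auto simp: aux_space_def)
    ultimately show "q \<in> ?R" by (intro CollectI exI conjI)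
  qed
  show "?R \<subseteq> ?L"
  proof
    fix q assume "q \<in> ?R"
    then obtain c a where q: "q = (\<lambda>x. (\<Sum>i=1..k. c i * \<Phi> i x) + a * \<Phi> (Suc k) x)" by (auto simp: aux_space_def)
    have "(\<Sum>i=1..k. (c(Suc k := a)) i * \<Phi> i x) = (\<Sum>i=1..k. c i * \<Phi> i x)" for x
      by (intro sum.cong) auto
    then have "q = (\<lambda>x. \<Sum>i=1..Suc k. (c(Suc k := a)) i * \<Phi> i x)" unfolding q by simp
    then show "q \<in> ?L" unfolding aux_space_def by (intro CollectI exI[of _ "c(Suc k := a)"] conjI TrueI)
  qed
qed

lemma aux_space_SucI:
  "p \<in> aux_space \<Phi> k \<Longrightarrow> (\<lambda>x. p x + a * \<Phi> (Suc k) x) \<in> aux_space \<Phi> (Suc k)"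
  unfolding aux_space_Suc by (rule CollectI, rule exI[of _ p], rule exI[of _ a]) simp

lemma aux_space_subset:
  assumes "semi_inner X B" "w \<in> X" "\<And>i. i \<in> {1..k} \<Longrightarrow> \<Phi> i \<in> X" "p \<in> aux_space \<Phi> k"
  shows "p \<in> X"
  using assms(3,4) semi_inner.sum_closed[OF assms(1,2), of "{1..k}" \<Phi>] by (auto simp: aux_space_def)

lemma orthogonal_aux_space:
  assumes "semi_inner X B" "w \<in> X" "\<And>i. i \<in> {1..k} \<Longrightarrow> \<Phi> i \<in> X" "\<And>i. i \<in> {1..k} \<Longrightarrow> B (\<Phi> i) w = 0" "q \<in> aux_space \<Phi> k"
  shows "B q w = 0"
  using assms(3-5) semi_inner.sum_left[OF assms(1,2), of "{1..k}" \<Phi>] by (auto simp: aux_space_def)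

text \<open>Gram-Schmidt by induction on \<open>k\<close>: the new function minus its projection
  \<open>d\<close> is orthogonal to the old span, and a suitable multiple of this remainder corrects
  the projection found so far.\<close>

lemma projection_exists:
  assumes B: "semi_inner X B" and "\<And>i. i \<in> {1..k} \<Longrightarrow> \<Phi> i \<in> X" "w \<in> X"
  shows "\<exists>p\<in>aux_space \<Phi> k. \<forall>q\<in>aux_space \<Phi> k. B (\<lambda>x. w x - p x) q = 0"
  using assms(2,3)
proof (induction k arbitrary: w)
  case 0
  interpret semi_inner X B by fact
  show ?case
  proof (rule bexI[OF _ aux_space_zero], rule ballI)
    fix q assume "q \<in> aux_space \<Phi> 0"
    then have q: "q = (\<lambda>x. 0)" by (auto simp: aux_space_def)
    have "(\<lambda>x. w x - 0) \<in> X" using 0(2) by simp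
    then show "B (\<lambda>x. w x - 0) q = 0" unfolding q by (rule zero_right)
  qed
next
  case (Suc k)
  interpret semi_inner X B by fact
  have sub: "p \<in> X" if "p \<in> aux_space \<Phi> k" for p by (rule aux_space_subset[OF B Suc.prems(2) Suc.prems(1) that]) auto
  let ?f = "\<Phi> (Suc k)"
  have f: "?f \<in> X" using Suc.prems(1) by simp
  have IH: "\<exists>p\<in>aux_space \<Phi> k. \<forall>q\<in>aux_space \<Phi> k. B (\<lambda>x. w x - p x) q = 0" if "w \<in> X" for w
    by (rule Suc.IH[OF Suc.prems(1) that]) auto
  obtain d where d: "d \<in> aux_space \<Phi> k" "\<And>q. q \<in> aux_space \<Phi> k \<Longrightarrow> B (\<lambda>x. ?f x - d x) q = 0"
    using IH[OF f] by blast
  obtain p where p: "p \<in> aux_space \<Phi> k" "\<And>q. q \<in> aux_space \<Phi> k \<Longrightarrow> B (\<lambda>x. w x - p x) q = 0"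
    using IH[OF Suc.prems(2)] by blast
  define \<psi> where "\<psi> = (\<lambda>x. ?f x - d x)"
  define w' where "w' = (\<lambda>x. w x - p x)"
  have X: "\<psi> \<in> X" "w' \<in> X" unfolding \<psi>_def w'_def using f d p sub Suc.prems(2) by (auto intro: diff_closed)
  \<comment> \<open>If the remainder \<psi> has square 0, the quotient is 0 by the convention on
    division, and this is the right value since B w' \<psi> = 0 by Cauchy-Schwarz.\<close>
  define t where "t = B w' \<psi> / B \<psi> \<psi>"
  have t: "B w' \<psi> = t * B \<psi> \<psi>"
    using cauchy_schwarz[OF X(2,1)] by (cases "B \<psi> \<psi> = 0") (auto simp: t_def)
  define r where "r = (\<lambda>x. (p x + (- t) * d x) + t * ?f x)"
  have r: "r \<in> aux_space \<Phi> (Suc k)" 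
    unfolding r_def by (rule aux_space_SucI[OF aux_space_lin[OF p(1) d(1)]])
  have wr: "(\<lambda>x. w x - r x) = (\<lambda>x. w' x + (- t) * \<psi> x)" by (auto simp: r_def w'_def \<psi>_def algebra_simps)
  have "B (\<lambda>x. w x - r x) q = 0" if Q: "q \<in> aux_space \<Phi> (Suc k)" for q
  proof -
    obtain q0 a where q: "q0 \<in> aux_space \<Phi> k" "q = (\<lambda>x. q0 x + a * ?f x)" 
      using Q unfolding aux_space_Suc by blast
    have o: "B (\<lambda>x. w' x + (- t) * \<psi> x) q' = 0" if "q' \<in> aux_space \<Phi> k" for q'
      using lin[OF X(2,1) sub[OF that], of "- t"] p(2)[OF that] d(2)[OF that] by (simp add: w'_def \<psi>_def)
    have o2: "B (\<lambda>x. w' x + (- t) * \<psi> x) \<psi> = 0"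
      using lin[OF X(2,1,1), of "- t"] t by simp
    have W: "(\<lambda>x. w' x + (- t) * \<psi> x) \<in> X" by (rule lin_closed[OF X(2,1)])
    have fe: "?f = (\<lambda>x. \<psi> x + 1 * d x)" by (simp add: \<psi>_def)
    have "B (\<lambda>x. w' x + (- t) * \<psi> x) (\<lambda>x. \<psi> x + 1 * d x) = 0"
      unfolding lin_right[OF X(1) sub[OF d(1)] W, of 1] o2 o[OF d(1)] by simp
    then have "B (\<lambda>x. w' x + (- t) * \<psi> x) ?f = 0" unfolding fe .
    then show ?thesis unfolding wr q(2) using lin_right[OF sub[OF q(1)] f W, of a] o[OF q(1)] by simp
  qed
  then show ?case using r by blast
qed

section \<open>The spectral gap\<close>

locale eigen_domain = W: weighted_domain K \<kappa> \<kappa>min \<kappa>max + M: weighted_domain K \<kappa>' \<kappa>min' \<kappa>max'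
  for K :: "(real^'d) set" and \<kappa> \<kappa>min \<kappa>max \<kappa>' \<kappa>min' \<kappa>max' +
  fixes lam :: "nat \<Rightarrow> real" and \<Phi> :: "nat \<Rightarrow> real^'d \<Rightarrow> real"
  assumes dom: "bounded_lipschitz_domain K" and eig: "eigensystem \<kappa> \<kappa>' K lam \<Phi>"
begin

abbreviation "A \<equiv> grad_form \<kappa> K"
abbreviation "s \<equiv> mass_form \<kappa>' K"

lemma \<Phi>_H1: "i \<ge> 1 \<Longrightarrow> \<Phi> i \<in> H1 K" and \<Phi>_L2: "i \<ge> 1 \<Longrightarrow> \<Phi> i \<in> L2 K"
  and \<Phi>_eq: "i \<ge> 1 \<Longrightarrow> v \<in> H1 K \<Longrightarrow> A (\<Phi> i) v = lam i * s (\<Phi> i) v"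
  using eig W.H1_L2 by (auto simp: eigensystem_def eigenpair_def)

lemma lam_mono:
  assumes "1 \<le> i" "i \<le> j"
  shows "lam i \<le> lam j"
  using assms(2)
proof (induction rule: dec_induct)
  case (step n)
  have "lam n \<le> lam (Suc n)" using eig assms(1) step(1) by (simp add: eigensystem_def)
  then show ?case using step by simp
qed simp

lemma eig_independent:
  assumes "AE x in lebesgue_on K. (\<Sum>i=1..n. c i * \<Phi> i x) = 0"
  shows "\<forall>i\<in>{1..n}. c i = 0"
proof -
  have "\<forall>n c. (AE x in lebesgue_on K. (\<Sum>i=1..n. c i * \<Phi> i x) = 0) \<longrightarrow> (\<forall>i\<in>{1..n}. c i = 0)"
    using eig unfolding eigensystem_def by (elim conjE)
  then show ?thesis using assms by (elim allE impE)
qed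

lemma eig_listed:
  assumes "eigenpair \<kappa> \<kappa>' K \<mu> \<phi>"
  shows "\<exists>n c. AE x in lebesgue_on K. \<phi> x = (\<Sum>i\<in>{i\<in>{1..n}. lam i = \<mu>}. c i * \<Phi> i x)"
proof -
  have "\<forall>\<mu> \<phi>. eigenpair \<kappa> \<kappa>' K \<mu> \<phi> \<longrightarrow>
      (\<exists>n c. AE x in lebesgue_on K. \<phi> x = (\<Sum>i\<in>{i\<in>{1..n}. lam i = \<mu>}. c i * \<Phi> i x))"
    using eig unfolding eigensystem_def by (elim conjE)
  then show ?thesis using assms by (elim allE impE)
qed

lemma aux_space_L2: "p \<in> aux_space \<Phi> k \<Longrightarrow> p \<in> L2 K"
  by (rule aux_space_subset[OF M.mass.semi_inner_axioms L2_zero]) (auto intro: \<Phi>_L2)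

text \<open>A minimizing sequence of the Rayleigh quotient on the orthogonal complement of the first \<open>k\<close>
  eigenfunctions is compact in \<open>L\<^sup>2\<close>; by the parallelogram identity it converges in \<open>H\<^sup>1\<close>, and its
  limit is an eigenfunction that would have to be listed among the first \<open>k\<close>.\<close>

theorem spectral_gap:
  assumes v: "v \<in> H1 K" and orth: "\<And>i. i \<in> {1..k} \<Longrightarrow> s (\<Phi> i) v = 0"
  shows "lam (k + 1) * s v v \<le> A v v"
proof (rule ccontr)
  assume neg: "\<not> ?thesis"
  define Y where "Y = {w \<in> H1 K. \<forall>i\<in>{1..k}. s (\<Phi> i) w = 0}"
  have Y1: "w \<in> H1 K" "w \<in> L2 K" if "w \<in> Y" for w using that W.H1_L2 by (auto simp: Y_def)
  have Y_lin: "(\<lambda>x. u x + c * w x) \<in> Y" if u: "u \<in> Y" and w: "w \<in> Y" for u w c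
  proof -
    have "s (\<Phi> i) (\<lambda>x. u x + c * w x) = 0" if i: "i \<in> {1..k}" for i
    proof -
      have "\<Phi> i \<in> L2 K" using i by (intro \<Phi>_L2) simp
      from M.mass.lin_right[OF Y1(2)[OF u] Y1(2)[OF w] this, of c] show ?thesis using u w i by (simp add: Y_def)
    qed
    then show ?thesis using W.H1_lin[OF Y1(1)[OF u] Y1(1)[OF w]] by (simp add: Y_def)
  qed
  have Y_diff: "(\<lambda>x. u x - w x) \<in> Y" if "u \<in> Y" "w \<in> Y" for u w
    using Y_lin[OF that, of "-1"] by simp
  define Y' where "Y' = {w \<in> Y. s w w = 1}"
  have scale: "(\<lambda>x. (1 / sqrt (s w w)) * w x) \<in> Y'"
    "A (\<lambda>x. (1 / sqrt (s w w)) * w x) (\<lambda>x. (1 / sqrt (s w w)) * w x) = A w w / s w w"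
    if w: "w \<in> Y" "s w w > 0" for w
  proof -
    define c where "c = 1 / sqrt (s w w)"
    have c: "c * (c * z) = z / s w w" for z using w(2) by (simp add: c_def field_simps)
    have z: "(\<lambda>x. 0 + c * w x) \<in> Y" using Y_lin[OF Y_diff[OF w(1) w(1)] w(1), of c] by simp
    then have cw: "(\<lambda>x. c * w x) \<in> Y" by simp
    have "s (\<lambda>x. c * w x) (\<lambda>x. c * w x) = c * (c * s w w)"
      using M.mass.scale_left[OF Y1(2)[OF w(1)] Y1(2)[OF cw], of c] M.mass.sym[OF Y1(2)[OF w(1)] Y1(2)[OF cw]]
        M.mass.scale_left[OF Y1(2)[OF w(1)] Y1(2)[OF w(1)], of c] by simp
    then show "(\<lambda>x. (1 / sqrt (s w w)) * w x) \<in> Y'" using cw w(2) by (simp add: Y'_def c flip: c_def)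
    have "A (\<lambda>x. c * w x) (\<lambda>x. c * w x) = c * (c * A w w)"
      using W.grad.scale_left[OF Y1(1)[OF w(1)] Y1(1)[OF cw], of c] W.grad.sym[OF Y1(1)[OF w(1)] Y1(1)[OF cw]]
        W.grad.scale_left[OF Y1(1)[OF w(1)] Y1(1)[OF w(1)], of c] by simp
    then show "A (\<lambda>x. (1 / sqrt (s w w)) * w x) (\<lambda>x. (1 / sqrt (s w w)) * w x) = A w w / s w w"
      by (simp add: c flip: c_def)
  qed
  have vY: "v \<in> Y" using v orth by (simp add: Y_def)
  have sv: "s v v > 0"
  proof (rule ccontr)
    assume "\<not> s v v > 0"
    then have "s v v = 0" using M.mass.nonneg[OF Y1(2)[OF vY]] by simp
    then show False using neg W.grad.nonneg[OF v] by simp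
  qed
  \<comment> \<open>The infimum of the Rayleigh quotient on the orthogonal complement. The supposed
    counterexample \<open>v\<close>, once normalised, shows both that \<open>Y'\<close> is nonempty
    and that \<mu> lies strictly below lam (k + 1).\<close>
  define \<mu> where "\<mu> = (INF w\<in>Y'. A w w)"
  have bb: "bdd_below ((\<lambda>w. A w w) ` Y')"
    using W.grad.nonneg Y1 by (intro bdd_belowI[of _ 0]) (auto simp: Y'_def)
  have ne: "Y' \<noteq> {}" using scale(1)[OF vY sv] by blast
  have "\<mu> \<le> A v v / s v v"
    using cINF_lower[OF bb scale(1)[OF vY sv]] scale(2)[OF vY sv] by (simp add: \<mu>_def)
  also have "\<dots> < lam (k + 1)" using neg sv by (simp add: field_simps)
  finally have \<mu>_lt: "\<mu> < lam (k + 1)" .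
  have \<mu>_nn: "\<mu> \<ge> 0" unfolding \<mu>_def
    by (rule cINF_greatest[OF ne]) (use W.grad.nonneg Y1 in \<open>auto simp: Y'_def\<close>)
  have low: "\<mu> * s w w \<le> A w w" if w: "w \<in> Y" for w
  proof (cases "s w w > 0")
    case True
    then have "\<mu> \<le> A w w / s w w"
      using cINF_lower[OF bb scale(1)[OF w True]] scale(2)[OF w True] by (simp add: \<mu>_def)
    then show ?thesis using True by (simp add: field_simps)
  next
    case False
    then have "s w w = 0" using M.mass.nonneg[OF Y1(2)[OF w]] by simp
    then show ?thesis using W.grad.nonneg[OF Y1(1)[OF w]] by simp
  qed
  have "\<forall>n. \<exists>w. w \<in> Y' \<and> A w w < \<mu> + 1 / real (Suc n)"
  proof
    fix n
    have "\<mu> < \<mu> + 1 / real (Suc n)" by simp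
    then show "\<exists>w. w \<in> Y' \<and> A w w < \<mu> + 1 / real (Suc n)"
      unfolding \<mu>_def cINF_less_iff[OF ne bb] by blast
  qed
  from choice[OF this] obtain w where w: "\<And>n. w n \<in> Y'" "\<And>n. A (w n) (w n) < \<mu> + 1 / real (Suc n)" by blast
  have wY: "w n \<in> Y" "s (w n) (w n) = 1" for n using w(1)[of n] by (auto simp: Y'_def)
  have hw: "has_weak_gradient K (w n) (weak_gradient K (w n))" for n
    by (rule H1_has_weak_gradient[OF Y1(1)[OF wY(1)]])
  define R where "R = max (1 / \<kappa>min') ((\<mu> + 1) / \<kappa>min)"
  have R1: "sq_int K (w n) \<le> R" for n
  proof -
    have "sq_int K (w n) \<le> 1 / \<kappa>min'"
      using M.mass_form_bounds(1)[OF Y1(2)[OF wY(1)], of n] wY(2)[of n] M.\<kappa>min by (simp add: field_simps)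
    then show ?thesis by (simp add: R_def)
  qed
  have R2: "gsq_int K (weak_gradient K (w n)) \<le> R" for n
  proof -
    have "1 / real (Suc n) \<le> 1" by simp
    then have "A (w n) (w n) \<le> \<mu> + 1" using w(2)[of n] by linarith
    then have "\<kappa>min * gsq_int K (weak_gradient K (w n)) \<le> \<mu> + 1"
      using W.grad_form_bounds(1)[OF hw, of n] by linarith
    then have "gsq_int K (weak_gradient K (w n)) \<le> (\<mu> + 1) / \<kappa>min" using W.\<kappa>min by (simp add: field_simps)
    then show ?thesis by (simp add: R_def)
  qed
  obtain r where r: "strict_mono (r :: nat \<Rightarrow> nat)"
    and cauchy: "\<And>e. e > 0 \<Longrightarrow> \<exists>N. \<forall>m\<ge>N. \<forall>n\<ge>N. sq_int K (\<lambda>x. w (r m) x - w (r n) x) < e"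
  proof -
    from rellich[of K w "\<lambda>n. weak_gradient K (w n)" R, OF dom hw R1 R2] obtain r where r: "strict_mono (r :: nat \<Rightarrow> nat)"
      and c: "\<forall>e>0. \<exists>N. \<forall>m\<ge>N. \<forall>n\<ge>N. sq_int K (\<lambda>x. w (r m) x - w (r n) x) < e" by (elim exE conjE)
    show thesis by (rule that[OF r c[THEN spec, THEN mp]])
  qed
  define u where "u = (\<lambda>n. w (r n))"
  have uY: "u n \<in> Y" "s (u n) (u n) = 1" for n using wY by (auto simp: u_def)
  have uA: "A (u n) (u n) < \<mu> + 1 / real (Suc n)" for n
  proof -
    have "1 / real (Suc (r n)) \<le> 1 / real (Suc n)" using seq_suble[OF r, of n] by (intro divide_left_mono) auto
    then show ?thesis using w(2)[of "r n"] by (simp add: u_def)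
  qed
  have hu: "has_weak_gradient K (u n) (weak_gradient K (u n))" for n by (rule H1_has_weak_gradient[OF Y1(1)[OF uY(1)]])
  have hud: "has_weak_gradient K (\<lambda>x. u m x - u n x) (\<lambda>x. weak_gradient K (u m) x - weak_gradient K (u n) x)" for m n
    using has_weak_gradient_lin[OF W.S_lmeasurable hu hu, of m "-1" n] by simp
  \<comment> \<open>Parallelogram identity for \<open>A\<close> and for \<open>s\<close>: the sum of
    two normalised members has s-square 4 minus that of the difference, and \<open>low\<close>
    bounds its energy below by \<mu> times this. The energy of the difference is thus controlled by
    the excesses over \<mu> and the distance in the square mean, which rellich makes small.\<close>
  have par: "A (\<lambda>x. u m x - u n x) (\<lambda>x. u m x - u n x) \<le>
      2 * (1 / real (Suc m)) + 2 * (1 / real (Suc n)) + \<mu> * (\<kappa>max' * sq_int K (\<lambda>x. u m x - u n x))" for m n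
  proof -
    let ?d = "\<lambda>x. u m x - u n x" and ?p = "\<lambda>x. u m x + 1 * u n x"
    have d: "?d \<in> Y" by (rule Y_diff[OF uY(1) uY(1)])
    have p: "?p \<in> Y" by (rule Y_lin[OF uY(1) uY(1)])
    have 1: "A ?d ?d = 2 * A (u m) (u m) + 2 * A (u n) (u n) - A ?p ?p"
      using W.grad.expand_diff[OF Y1(1)[OF uY(1)] Y1(1)[OF uY(1)], of m n]
        W.grad.expand[OF Y1(1)[OF uY(1)] Y1(1)[OF uY(1)], of m 1 n] by simp
    have 2: "s ?p ?p = 4 - s ?d ?d"
      using M.mass.expand_diff[OF Y1(2)[OF uY(1)] Y1(2)[OF uY(1)], of m n]
        M.mass.expand[OF Y1(2)[OF uY(1)] Y1(2)[OF uY(1)], of m 1 n] uY(2) by simp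
    have "\<mu> * s ?p ?p = 4 * \<mu> - \<mu> * s ?d ?d" unfolding 2 by (simp add: algebra_simps)
    moreover have "\<mu> * s ?p ?p \<le> A ?p ?p" by (rule low[OF p])
    moreover have "\<mu> * s ?d ?d \<le> \<mu> * (\<kappa>max' * sq_int K ?d)"
      by (intro mult_left_mono M.mass_form_bounds(2) Y1(2)[OF d] \<mu>_nn)
    ultimately show ?thesis using 1 uA[of m] uA[of n] by linarith
  qed
  have cg: "\<exists>N. \<forall>m\<ge>N. \<forall>n\<ge>N. gsq_int K (\<lambda>x. weak_gradient K (u m) x - weak_gradient K (u n) x) < e" if e: "e > 0" for e
  proof -
    \<comment> \<open>A positive bound for \<mu> \<open>\<kappa>max'\<close>; the added 1 permits
      division by it.\<close>
    define b where "b = \<bar>\<mu> * \<kappa>max'\<bar> + 1"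
    have b: "b > 0" by (simp add: b_def)
    define d where "d = \<kappa>min * e / 4"
    have d: "d > 0" using e W.\<kappa>min by (simp add: d_def)
    obtain N1 where N1: "2 * (1 / real (Suc n)) < d" if "n \<ge> N1" for n
    proof -
      obtain N where N: "1 / real (Suc N) < d / 2" using nat_approx_posE[of "d / 2"] d by auto
      have "2 * (1 / real (Suc n)) < d" if "n \<ge> N" for n
      proof -
        have "1 / real (Suc n) \<le> 1 / real (Suc N)" using that by (intro divide_left_mono) auto
        then show ?thesis using N by linarith
      qed
      then show thesis using that by blast
    qed
    obtain N2 where N2: "sq_int K (\<lambda>x. u m x - u n x) < d / b" if "m \<ge> N2" "n \<ge> N2" for m n
      using cauchy[of "d / b"] d b unfolding u_def by auto
    have "gsq_int K (\<lambda>x. weak_gradient K (u m) x - weak_gradient K (u n) x) < e" if "m \<ge> max N1 N2" "n \<ge> max N1 N2" for m n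
    proof -
      let ?q = "sq_int K (\<lambda>x. u m x - u n x)"
      have "\<mu> * \<kappa>max' * ?q \<le> b * ?q" by (intro mult_right_mono) (auto simp: b_def)
      also have "\<dots> < d" using N2[of m n] that b by (simp add: field_simps)
      finally have "\<mu> * (\<kappa>max' * ?q) < d" by simp
      then have "A (\<lambda>x. u m x - u n x) (\<lambda>x. u m x - u n x) < 4 * d"
        using par[of m n] N1[of m] N1[of n] that d by simp
      then have "\<kappa>min * gsq_int K (\<lambda>x. weak_gradient K (u m) x - weak_gradient K (u n) x) < \<kappa>min * e"
        using W.grad_form_bounds(1)[OF hud, of m n] by (simp add: d_def)
      then show ?thesis using W.\<kappa>min by simp
    qed
    then show ?thesis by blast
  qed
  obtain y h where y: "has_weak_gradient K y h" "(\<lambda>n. sq_int K (\<lambda>x. u n x - y x)) \<longlonglongrightarrow> 0"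
    "(\<lambda>n. gsq_int K (\<lambda>x. weak_gradient K (u n) x - h x)) \<longlonglongrightarrow> 0"
  proof -
    have cu: "\<exists>N. \<forall>m\<ge>N. \<forall>n\<ge>N. sq_int K (\<lambda>x. u m x - u n x) < e" if "e > 0" for e
      using cauchy[OF that] unfolding u_def .
    have "\<exists>y h. has_weak_gradient K y h \<and> (\<lambda>n. sq_int K (\<lambda>x. u n x - y x)) \<longlonglongrightarrow> 0 \<and>
        (\<lambda>n. gsq_int K (\<lambda>x. weak_gradient K (u n) x - h x)) \<longlonglongrightarrow> 0"
      by (rule has_weak_gradient_complete[OF W.S_lmeasurable hu]) (erule cu, erule cg)
    then show thesis by (elim exE conjE) (rule that)
  qed
  have yH: "y \<in> H1 K" "y \<in> L2 K" using has_weak_gradient_H1[OF y(1)] has_weak_gradientD(1)[OF y(1)] by auto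
  have uL: "u n \<in> L2 K" "u n \<in> H1 K" for n using Y1 uY by auto
  have sd: "(\<lambda>n. s (\<lambda>x. u n x - y x) (\<lambda>x. u n x - y x)) \<longlonglongrightarrow> 0"
  proof (rule tendsto_sandwich[OF _ _ tendsto_const tendsto_mult_right_zero[OF y(2), of \<kappa>max']])
    show "\<forall>\<^sub>F n in sequentially. 0 \<le> s (\<lambda>x. u n x - y x) (\<lambda>x. u n x - y x)"
      by (intro always_eventually allI M.mass.nonneg L2_diff uL yH)
    show "\<forall>\<^sub>F n in sequentially. s (\<lambda>x. u n x - y x) (\<lambda>x. u n x - y x) \<le> \<kappa>max' * sq_int K (\<lambda>x. u n x - y x)"
      by (intro always_eventually allI M.mass_form_bounds(2) L2_diff uL yH)
  qed
  have hd: "has_weak_gradient K (\<lambda>x. u n x - y x) (\<lambda>x. weak_gradient K (u n) x - h x)" for n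
    using has_weak_gradient_lin[OF W.S_lmeasurable hu y(1), of n "-1"] by simp
  have ad: "(\<lambda>n. A (\<lambda>x. u n x - y x) (\<lambda>x. u n x - y x)) \<longlonglongrightarrow> 0"
  proof (rule tendsto_sandwich[OF _ _ tendsto_const tendsto_mult_right_zero[OF y(3), of \<kappa>max]])
    show "\<forall>\<^sub>F n in sequentially. 0 \<le> A (\<lambda>x. u n x - y x) (\<lambda>x. u n x - y x)"
      by (intro always_eventually allI W.grad.nonneg W.grad.diff_closed uL yH)
    show "\<forall>\<^sub>F n in sequentially. A (\<lambda>x. u n x - y x) (\<lambda>x. u n x - y x) \<le> \<kappa>max * gsq_int K (\<lambda>x. weak_gradient K (u n) x - h x)"
      by (intro always_eventually allI W.grad_form_bounds(2) hd)
  qed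
  \<comment> \<open>Convergence in the square mean preserves the normalisation; this is what keeps
    the limit of the minimizing sequence from vanishing.\<close>
  have sy: "s y y = 1"
    using LIMSEQ_unique[OF M.mass.tendsto_square[OF uL(1) yH(2) sd]] uY(2) by simp
  have "A y y \<le> \<mu>"
  proof (rule LIMSEQ_le[OF W.grad.tendsto_square[OF uL(2) yH(1) ad]])
    show "(\<lambda>n. \<mu> + 1 / real (Suc n)) \<longlonglongrightarrow> \<mu>"
      using tendsto_add[OF tendsto_const LIMSEQ_Suc[OF lim_1_over_n], of \<mu>] by simp
  qed (use uA less_imp_le in blast)
  have yY: "y \<in> Y"
  proof -
    have "s (\<Phi> i) y = 0" if "i \<in> {1..k}" for i
    proof -
      have P: "\<Phi> i \<in> L2 K" using that by (intro \<Phi>_L2) auto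
      have "s (u n) (\<Phi> i) = 0" for n using uY(1)[of n] that M.mass.sym[OF uL(1) P] by (simp add: Y_def)
      then have "s y (\<Phi> i) = 0" using LIMSEQ_unique[OF M.mass.tendsto_left[OF uL(1) yH(2) P sd]] by simp
      then show ?thesis using M.mass.sym[OF yH(2) P] by simp
    qed
    then show ?thesis using yH by (simp add: Y_def)
  qed
  have Ay: "A y y = \<mu> * s y y" using \<open>A y y \<le> \<mu>\<close> low[OF yY] sy by simp
  \<comment> \<open>The form A - \<mu> s is positive semidefinite on \<open>Y\<close> by
    \<open>low\<close> and takes the value 0 at \<open>y\<close>; its Cauchy-Schwarz inequality
    gives the eigenvalue equation for all test functions in \<open>Y\<close>.\<close>
  interpret B: semi_inner Y "\<lambda>u v. A u v - \<mu> * s u v"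
  proof
    show "A u v - \<mu> * s u v = A v u - \<mu> * s v u" if "u \<in> Y" "v \<in> Y" for u v
      using W.grad.sym[OF Y1(1)[OF that(1)] Y1(1)[OF that(2)]] M.mass.sym[OF Y1(2)[OF that(1)] Y1(2)[OF that(2)]] by simp
    show "A (\<lambda>x. u x + c * v x) w - \<mu> * s (\<lambda>x. u x + c * v x) w = A u w - \<mu> * s u w + c * (A v w - \<mu> * s v w)"
      if "u \<in> Y" "v \<in> Y" "w \<in> Y" for u v w c
      using W.grad.lin[OF that[THEN Y1(1)], of c] M.mass.lin[OF that[THEN Y1(2)], of c] by (simp add: algebra_simps)
  qed (use Y_lin low in auto)
  have orthY: "A y z = \<mu> * s y z" if "z \<in> Y" for z
    using B.cauchy_schwarz[OF yY that] Ay by simp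
  \<comment> \<open>A general \<open>z\<close> is split into its projection \<open>p\<close> onto
    the first \<open>k\<close> eigenfunctions and a rest in \<open>Y\<close>. The minimiser is
    s-orthogonal to those eigenfunctions and, by their own equation, also A-orthogonal to them, so
    \<open>p\<close> contributes nothing to either side.\<close>
  have all: "A y z = \<mu> * s y z" if z: "z \<in> H1 K" for z
  proof -
    have PH: "\<Phi> i \<in> L2 K" "\<Phi> i \<in> H1 K" if "i \<in> {1..k}" for i using that \<Phi>_L2 \<Phi>_H1 by auto
    obtain p where p: "p \<in> aux_space \<Phi> k" "\<And>q. q \<in> aux_space \<Phi> k \<Longrightarrow> s (\<lambda>x. z x - p x) q = 0"
    proof -
      have "\<exists>p\<in>aux_space \<Phi> k. \<forall>q\<in>aux_space \<Phi> k. s (\<lambda>x. z x - p x) q = 0"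
        by (rule projection_exists[OF M.mass.semi_inner_axioms _ W.H1_L2[OF z]]) (erule PH)
      then show thesis using that by blast
    qed
    have pH: "p \<in> H1 K" by (rule aux_space_subset[OF W.grad.semi_inner_axioms z _ p(1)]) (erule PH)
    have pL: "p \<in> L2 K" by (rule W.H1_L2[OF pH])
    have dH: "(\<lambda>x. z x - p x) \<in> H1 K" by (rule W.grad.diff_closed[OF z pH])
    have "s (\<Phi> i) (\<lambda>x. z x - p x) = 0" if "i \<in> {1..k}" for i
      using p(2)[OF aux_space_basis[OF that]] M.mass.sym[OF W.H1_L2[OF dH] PH(1)[OF that]] by simp
    then have "(\<lambda>x. z x - p x) \<in> Y" using dH by (simp add: Y_def)
    from orthY[OF this] have "A y z - A y p = \<mu> * (s y z - s y p)"
      using W.grad.diff_right[OF z pH yH(1)] M.mass.diff_right[OF W.H1_L2[OF z] pL yH(2)] by simp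
    moreover have sP: "s (\<Phi> i) y = 0" if "i \<in> {1..k}" for i using yY that by (simp add: Y_def)
    have "s p y = 0" 
      by (rule orthogonal_aux_space[OF M.mass.semi_inner_axioms yH(2) _ _ p(1)]) (erule PH, erule sP)
    moreover have aP: "A (\<Phi> i) y = 0" if "i \<in> {1..k}" for i using \<Phi>_eq[of i y] sP[OF that] that yH by simp
    have "A p y = 0"
      by (rule orthogonal_aux_space[OF W.grad.semi_inner_axioms yH(1) _ _ p(1)]) (erule PH, erule aP)
    ultimately show ?thesis using W.grad.sym[OF pH yH(1)] M.mass.sym[OF pL yH(2)] by simp
  qed
  have "\<not> (AE x in lebesgue_on K. y x = 0)"
    using M.mass_form_cong_AE[OF yH(2) yH(2), of "\<lambda>_. 0" "\<lambda>_. 0"] sy by (auto simp: mass_form_def)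
  then have "eigenpair \<kappa> \<kappa>' K \<mu> y" using yH all by (simp add: eigenpair_def)
  from eig_listed[OF this] obtain n c where yc: "AE x in lebesgue_on K. y x = (\<Sum>i\<in>{i\<in>{1..n}. lam i = \<mu>}. c i * \<Phi> i x)"
    by (elim exE)
  let ?I = "{i\<in>{1..n}. lam i = \<mu>}"
  \<comment> \<open>The eigenvalue \<mu> is below lam (k + 1), so by monotonicity it is listed only
    with indices up to \<open>k\<close>. Hence \<open>y\<close> is a combination of functions to
    which it is orthogonal, which contradicts s y y = 1.\<close>
  have Ik: "i \<in> {1..k}" if "i \<in> ?I" for i
  proof (rule ccontr)
    assume "i \<notin> {1..k}"
    then have "lam (k + 1) \<le> lam i" using that by (intro lam_mono) auto
    then show False using that \<mu>_lt by simp
  qed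
  have "s y y = s (\<lambda>x. \<Sum>i\<in>?I. c i * \<Phi> i x) y"
    by (rule M.mass_form_cong_AE[OF yH(2) yH(2) yc]) simp
  also have "\<dots> = (\<Sum>i\<in>?I. c i * s (\<Phi> i) y)"
    by (rule M.mass.sum_left[OF yH(2)]) (auto intro: \<Phi>_L2)
  also have "\<dots> = 0" using Ik yY by (intro sum.neutral) (auto simp: Y_def)
  finally show False using sy by simp
qed

text \<open>If lam (k + 1) were 0, then so would be lam 2. Both of the first two eigenfunctions
  would have zero gradient and be constant on the connected element, contrary to their
  independence.\<close>

lemma lam_pos:
  assumes "k \<ge> 1"
  shows "lam (k + 1) > 0"
proof (rule ccontr)
  assume "\<not> lam (k + 1) > 0"
  moreover have "lam 1 = 0" using eig by (simp add: eigensystem_def)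
  moreover have "lam 1 \<le> lam 2" "lam 2 \<le> lam (k + 1)" using assms by (auto intro: lam_mono)
  ultimately have l: "lam 1 = 0" "lam 2 = 0" by auto
  have const: "\<exists>c. AE x in lebesgue_on K. \<Phi> i x = c" if i: "i \<ge> 1" "lam i = 0" for i
  proof -
    have hw: "has_weak_gradient K (\<Phi> i) (weak_gradient K (\<Phi> i))" by (rule H1_has_weak_gradient[OF \<Phi>_H1[OF i(1)]])
    have "A (\<Phi> i) (\<Phi> i) = 0" using \<Phi>_eq[OF i(1) \<Phi>_H1[OF i(1)]] i(2) by simp
    then have "\<kappa>min * gsq_int K (weak_gradient K (\<Phi> i)) \<le> 0" using W.grad_form_bounds(1)[OF hw] by simp
    then have "gsq_int K (weak_gradient K (\<Phi> i)) \<le> 0" using W.\<kappa>min by (simp add: mult_le_0_iff)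
    then have "gsq_int K (weak_gradient K (\<Phi> i)) = 0" by (simp add: antisym)
    then show ?thesis
      using zero_gradient_const[OF W.S _ hw] dom by (simp add: bounded_lipschitz_domain_def)
  qed
  obtain a where a: "AE x in lebesgue_on K. \<Phi> 1 x = a" using const[of 1] l by auto
  obtain b where b: "AE x in lebesgue_on K. \<Phi> 2 x = b" using const[of 2] l by auto
  \<comment> \<open>The relation b \<Phi> 1 - a \<Phi> 2 = 0 between two constants. Independence
    forces a = 0, so \<Phi> 1 would vanish almost everywhere, which an eigenpair excludes.\<close>
  define c where "c = (\<lambda>i::nat. if i = 1 then b else - a)"
  have "AE x in lebesgue_on K. (\<Sum>i=1..2. c i * \<Phi> i x) = 0"
    using a b by eventually_elim (simp add: c_def numeral_2_eq_2)
  then have "\<forall>i\<in>{1..2}. c i = 0" by (rule eig_independent)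
  then have "c 2 = 0" by simp
  then have "a = 0" by (simp add: c_def)
  then show False using a eig by (auto simp: eigensystem_def eigenpair_def)
qed

section \<open>The local projection\<close>

text \<open>The definite description must be justified by equality of functions, not just almost
  everywhere. Two candidates differ by a combination that is s-orthogonal to itself, hence zero
  almost everywhere; independence of the eigenfunctions makes all its coefficients vanish, and so
  the difference is zero at every point.\<close>

lemma local_proj:
  assumes v: "v \<in> L2 K"
  shows "local_proj \<kappa>' K \<Phi> k v \<in> aux_space \<Phi> k"
    and "q \<in> aux_space \<Phi> k \<Longrightarrow> s (\<lambda>x. v x - local_proj \<kappa>' K \<Phi> k v x) q = 0"
    and "p \<in> aux_space \<Phi> k \<Longrightarrow> (\<And>q. q \<in> aux_space \<Phi> k \<Longrightarrow> s (\<lambda>x. v x - p x) q = 0) \<Longrightarrow>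
      local_proj \<kappa>' K \<Phi> k v = p"
proof -
  let ?P = "\<lambda>p. p \<in> aux_space \<Phi> k \<and> (\<forall>q\<in>aux_space \<Phi> k. s (\<lambda>x. v x - p x) q = 0)"
  have ex: "\<exists>p. ?P p"
  proof -
    have "\<exists>p\<in>aux_space \<Phi> k. \<forall>q\<in>aux_space \<Phi> k. s (\<lambda>x. v x - p x) q = 0"
      by (rule projection_exists[OF M.mass.semi_inner_axioms _ v]) (simp add: \<Phi>_L2)
    then show ?thesis by blast
  qed
  have uniq: "p = p'" if "?P p" "?P p'" for p p'
  proof -
    have L: "p \<in> L2 K" "p' \<in> L2 K" using that aux_space_L2 by auto
    have d: "(\<lambda>x. p x - p' x) \<in> aux_space \<Phi> k" using aux_space_lin[of p \<Phi> k p' "-1"] that by simp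
    have dL: "(\<lambda>x. p x - p' x) \<in> L2 K" by (rule L2_diff[OF L])
    have "s p (\<lambda>x. p x - p' x) = s v (\<lambda>x. p x - p' x)" "s p' (\<lambda>x. p x - p' x) = s v (\<lambda>x. p x - p' x)"
      using that d M.mass.diff_left[OF v L(1) dL] M.mass.diff_left[OF v L(2) dL] by auto
    then have "s (\<lambda>x. p x - p' x) (\<lambda>x. p x - p' x) = 0" using M.mass.diff_left[OF L dL] by simp
    then have z: "AE x in lebesgue_on K. p x - p' x = 0" by (rule M.mass_form_zero[OF dL])
    obtain c where c: "(\<lambda>x. p x - p' x) = (\<lambda>x. \<Sum>i=1..k. c i * \<Phi> i x)" using d by (auto simp: aux_space_def)
    have "AE x in lebesgue_on K. (\<Sum>i=1..k. c i * \<Phi> i x) = 0" using z unfolding c[unfolded fun_eq_iff, rule_format] .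
    then have "\<forall>i\<in>{1..k}. c i = 0" by (rule eig_independent)
    then have "p x - p' x = 0" for x using c[unfolded fun_eq_iff, rule_format, of x] by simp
    then show ?thesis by (auto simp: fun_eq_iff)
  qed
  have "\<exists>!p. ?P p" by (rule ex_ex1I[OF ex uniq])
  from theI'[OF this] have P: "?P (local_proj \<kappa>' K \<Phi> k v)" unfolding local_proj_def .
  then show "local_proj \<kappa>' K \<Phi> k v \<in> aux_space \<Phi> k" by (rule conjunct1)
  show "s (\<lambda>x. v x - local_proj \<kappa>' K \<Phi> k v x) q = 0" if "q \<in> aux_space \<Phi> k"
    by (rule bspec[OF conjunct2[OF P] that])
  show "local_proj \<kappa>' K \<Phi> k v = p" if p: "p \<in> aux_space \<Phi> k" "\<And>q. q \<in> aux_space \<Phi> k \<Longrightarrow> s (\<lambda>x. v x - p x) q = 0"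
    by (rule uniq[OF P]) (intro conjI ballI p)
qed

lemma local_proj_L2: "v \<in> L2 K \<Longrightarrow> local_proj \<kappa>' K \<Phi> k v \<in> L2 K"
  by (rule aux_space_L2[OF local_proj(1)])

lemma local_proj_form:
  assumes "v \<in> L2 K" "q \<in> aux_space \<Phi> k"
  shows "s (local_proj \<kappa>' K \<Phi> k v) q = s v q"
  using local_proj(2)[OF assms] M.mass.diff_left[OF assms(1) local_proj_L2[OF assms(1)] aux_space_L2[OF assms(2)]]
  by simp

lemma local_proj_lin:
  assumes "u \<in> L2 K" "v \<in> L2 K"
  shows "local_proj \<kappa>' K \<Phi> k (\<lambda>x. u x + c * v x) =
    (\<lambda>x. local_proj \<kappa>' K \<Phi> k u x + c * local_proj \<kappa>' K \<Phi> k v x)"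
proof (rule local_proj(3)[OF L2_lin[OF assms] aux_space_lin[OF local_proj(1)[OF assms(1)] local_proj(1)[OF assms(2)]]])
  fix q assume q: "q \<in> aux_space \<Phi> k"
  have "(\<lambda>x. (u x + c * v x) - (local_proj \<kappa>' K \<Phi> k u x + c * local_proj \<kappa>' K \<Phi> k v x)) =
      (\<lambda>x. (u x - local_proj \<kappa>' K \<Phi> k u x) + c * (v x - local_proj \<kappa>' K \<Phi> k v x))"
    by (auto simp: algebra_simps)
  then show "s (\<lambda>x. (u x + c * v x) - (local_proj \<kappa>' K \<Phi> k u x + c * local_proj \<kappa>' K \<Phi> k v x)) q = 0"
    using M.mass.lin[OF L2_diff[OF assms(1) local_proj_L2[OF assms(1)]] L2_diff[OF assms(2) local_proj_L2[OF assms(2)]]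
        aux_space_L2[OF q], of k c k] local_proj(2)[OF assms(1) q] local_proj(2)[OF assms(2) q] by simp
qed

text \<open>The orthogonality that characterises the projection sees only classes modulo null sets.
  By uniqueness in \<open>aux_space\<close> the two projections then coincide everywhere, which
  allows rewriting with the equation.\<close>

lemma local_proj_cong_AE:
  assumes "u \<in> L2 K" "AE x in lebesgue_on K. u x = v x"
  shows "local_proj \<kappa>' K \<Phi> k v = local_proj \<kappa>' K \<Phi> k u"
proof -
  have v: "v \<in> L2 K" by (rule L2_AE_eq[OF W.S_sets assms(2,1)])
  show ?thesis
  proof (rule local_proj(3)[OF v local_proj(1)[OF assms(1)]])
    fix q assume q: "q \<in> aux_space \<Phi> k"
    have "s (\<lambda>x. u x - local_proj \<kappa>' K \<Phi> k u x) q = s (\<lambda>x. v x - local_proj \<kappa>' K \<Phi> k u x) q"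
    proof (rule M.mass_form_cong_AE[OF L2_diff[OF assms(1) local_proj_L2[OF assms(1)]] aux_space_L2[OF q]])
      show "AE x in lebesgue_on K. u x - local_proj \<kappa>' K \<Phi> k u x = v x - local_proj \<kappa>' K \<Phi> k u x"
        using assms(2) by eventually_elim simp
    qed simp
    then show "s (\<lambda>x. v x - local_proj \<kappa>' K \<Phi> k u x) q = 0" using local_proj(2)[OF assms(1) q] by simp
  qed
qed

text \<open>Pythagoras: the projection is s-orthogonal to the remainder v - p.\<close>

lemma local_proj_contraction:
  assumes "v \<in> L2 K"
  shows "s (local_proj \<kappa>' K \<Phi> k v) (local_proj \<kappa>' K \<Phi> k v) \<le> s v v"
proof -
  let ?p = "local_proj \<kappa>' K \<Phi> k v"
  have "s v ?p = s ?p ?p" using local_proj_form[OF assms local_proj(1)[OF assms]] by simp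
  then show ?thesis
    using M.mass.expand_diff[OF assms local_proj_L2[OF assms], of k] M.mass.nonneg[OF L2_diff[OF assms local_proj_L2[OF assms]], of k]
    by simp
qed

text \<open>A projection of zero norm means, by Cauchy-Schwarz and \<open>local_proj_form\<close>,
  that \<open>v\<close> is orthogonal to the first \<open>k\<close> eigenfunctions, so the spectral
  gap applies.\<close>

lemma local_gap:
  assumes v: "v \<in> H1 K" and z: "s (local_proj \<kappa>' K \<Phi> k v) (local_proj \<kappa>' K \<Phi> k v) = 0"
  shows "lam (k + 1) * s v v \<le> A v v"
proof (rule spectral_gap[OF v])
  fix i assume i: "i \<in> {1..k}"
  note vL = W.H1_L2[OF v]
  have P: "\<Phi> i \<in> L2 K" using i by (intro \<Phi>_L2) auto
  have "s v (\<Phi> i) = s (local_proj \<kappa>' K \<Phi> k v) (\<Phi> i)" using local_proj_form[OF vL aux_space_basis[OF i]] by simp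
  also have "\<dots> = 0" using M.mass.cauchy_schwarz[OF local_proj_L2[OF vL] P, of k] z by simp
  finally show "s (\<Phi> i) v = 0" using M.mass.sym[OF vL P] by simp
qed

end

section \<open>The multiscale space\<close>

lemma L2_extend_zero:
  assumes T: "T \<subseteq> S" "T \<in> sets lebesgue" "S \<in> sets lebesgue" and v: "v \<in> L2 T"
  shows "(\<lambda>x. if x \<in> T then v x else 0) \<in> L2 S"
proof -
  have vm: "v \<in> borel_measurable (lebesgue_on T)" and vi: "integrable (lebesgue_on T) (\<lambda>x. (v x)\<^sup>2)"
    using v by (auto simp: L2_def)
  have "(\<lambda>x. indicator T x *\<^sub>R v x) \<in> borel_measurable lebesgue"
    using vm borel_measurable_restrict_space_iff[of T lebesgue v] T(2) by simp
  moreover have "(\<lambda>x. indicator T x *\<^sub>R v x) = (\<lambda>x. if x \<in> T then v x else 0)" by (auto simp: indicator_def)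
  ultimately have m: "(\<lambda>x. if x \<in> T then v x else 0) \<in> borel_measurable (lebesgue_on S)"
    by (intro measurable_restrict_space1) simp
  have "integrable lebesgue (\<lambda>x. if x \<in> T then (v x)\<^sup>2 else 0)"
    using vi T(2) by (simp add: Lebesgue_Measure.integrable_restrict_UNIV)
  moreover have "(\<lambda>x. if x \<in> S then (if x \<in> T then v x else 0)\<^sup>2 else 0) = (\<lambda>x. if x \<in> T then (v x)\<^sup>2 else 0)"
  proof
    fix x show "(if x \<in> S then (if x \<in> T then v x else 0)\<^sup>2 else 0) = (if x \<in> T then (v x)\<^sup>2 else 0)"
      using T(1) by (cases "x \<in> T") auto
  qed
  ultimately have "integrable (lebesgue_on S) (\<lambda>x. (if x \<in> T then v x else 0)\<^sup>2)"
    using Lebesgue_Measure.integrable_restrict_UNIV[OF T(3), of "\<lambda>x. (if x \<in> T then v x else 0)\<^sup>2"] by simp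
  with m show ?thesis by (simp add: L2_def)
qed

lemma integral_negligible_diff:
  fixes f :: "'a::euclidean_space \<Rightarrow> real"
  assumes T: "T \<subseteq> S" "T \<in> sets lebesgue" "S \<in> sets lebesgue" and "negligible (S - T)"
    and f: "integrable (lebesgue_on S) f"
  shows "(LINT x|lebesgue_on S. f x) = (LINT x|lebesgue_on T. f x)"
proof -
  have "(LINT x|lebesgue. (if x \<in> S then f x else 0)) = (LINT x|lebesgue. (if x \<in> T then f x else 0))"
  proof (rule integral_cong_AE)
    show "(\<lambda>x. if x \<in> S then f x else 0) \<in> borel_measurable lebesgue"
      using f T(3) by (intro borel_measurable_integrable) (simp add: Lebesgue_Measure.integrable_restrict_UNIV)
    show "(\<lambda>x. if x \<in> T then f x else 0) \<in> borel_measurable lebesgue"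
      using integrable_lebesgue_on_subset[OF T f] T(2)
      by (intro borel_measurable_integrable) (simp add: Lebesgue_Measure.integrable_restrict_UNIV)
    have "AE x in lebesgue. x \<notin> S - T"
      by (rule AE_not_in) (use assms(4) in \<open>simp add: negligible_iff_null_sets\<close>)
    then show "AE x in lebesgue. (if x \<in> S then f x else 0) = (if x \<in> T then f x else 0)"
      by eventually_elim (use T(1) in auto)
  qed
  then show ?thesis using T by (simp add: Lebesgue_Measure.integral_restrict_UNIV)
qed

text \<open>A supremum of reals is meaningful only for a nonempty set that is bounded above.
  Boundedness follows from Cauchy-Schwarz and the lower bound \<open>m\<close> of the weight;
  nonzero constants show that the set is nonempty, because a nonempty open set is not a null
  set.\<close>

lemma dual_mass_norm_bound:
  fixes S :: "(real^'d) set"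
  assumes W: "weighted_domain S \<rho> m M" and ne: "S \<noteq> {}" and f: "f \<in> L2 S"
  shows "dual_mass_norm \<rho> S f \<ge> 0"
    and "v \<in> L2 S \<Longrightarrow> (LINT x|lebesgue_on S. f x * v x) \<le> dual_mass_norm \<rho> S f * mass_norm \<rho> S v"
proof -
  interpret weighted_domain S \<rho> m M by fact
  let ?V = "{v \<in> L2 S. \<not> (AE x in lebesgue_on S. v x = 0)}"
  let ?q = "\<lambda>v. (LINT x|lebesgue_on S. f x * v x) / mass_norm \<rho> S v"
  have pos: "mass_norm \<rho> S v > 0" if "v \<in> ?V" for v
    using that mass_form_zero[of v] mass.nonneg[of v] by (auto simp: mass_norm_def less_le)
  have "?q v \<le> sqrt (sq_int S f) / sqrt m" if v: "v \<in> ?V" for v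
  proof -
    have vL: "v \<in> L2 S" using v by simp
    have "sqrt m * sqrt (sq_int S v) \<le> mass_norm \<rho> S v"
      using mass_form_bounds(1)[OF vL] unfolding mass_norm_def real_sqrt_mult[symmetric]
      by (rule real_sqrt_le_mono)
    then have "sqrt (sq_int S v) \<le> mass_norm \<rho> S v / sqrt m" using \<kappa>min by (simp add: field_simps)
    then have "sqrt (sq_int S f) * sqrt (sq_int S v) \<le> sqrt (sq_int S f) * (mass_norm \<rho> S v / sqrt m)"
      by (intro mult_left_mono) auto
    then have "(LINT x|lebesgue_on S. f x * v x) \<le> sqrt (sq_int S f) / sqrt m * mass_norm \<rho> S v"
      using L2_abs_integral_le[OF f vL] by simp
    then show ?thesis using pos[OF v] by (simp add: divide_le_eq)
  qed
  then have bdd: "bdd_above (?q ` ?V)" by (auto simp: bdd_above_def)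
  have up: "?q v \<le> dual_mass_norm \<rho> S f" if "v \<in> ?V" for v
    unfolding dual_mass_norm_def by (rule cSUP_upper[OF that bdd])
  have const: "(\<lambda>_. a) \<in> ?V" if "a \<noteq> 0" for a
  proof -
    have "(\<lambda>_. a) \<in> L2 S" by (rule L2_bounded[OF S_lmeasurable, of _ "\<bar>a\<bar>"]) auto
    moreover have "\<not> negligible S" using open_not_negligible[OF S(1) ne] .
    then have "\<not> (AE x in lebesgue_on S. a = 0)"
      using that by (simp add: AE_lebesgue_on_iff_negligible[OF S_sets])
    ultimately show ?thesis by simp
  qed
  \<comment> \<open>The constants 1 and -1 have opposite quotients, so one of the two is nonnegative
    and the supremum is as well.\<close>
  have "mass_norm \<rho> S (\<lambda>_. 1) = mass_norm \<rho> S (\<lambda>_. -1)" by (simp add: mass_norm_def mass_form_def)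
  then have "?q (\<lambda>_. -1) = - ?q (\<lambda>_. 1)" by simp
  then show "dual_mass_norm \<rho> S f \<ge> 0" using up[OF const[of 1]] up[OF const[of "-1"]] by linarith
  show "(LINT x|lebesgue_on S. f x * v x) \<le> dual_mass_norm \<rho> S f * mass_norm \<rho> S v" if vL: "v \<in> L2 S"
  proof (cases "v \<in> ?V")
    case True
    then show ?thesis using up[OF True] pos[OF True] by (simp add: divide_le_eq)
  next
    case False
    then have z: "AE x in lebesgue_on S. v x = 0" using vL by simp
    then have "AE x in lebesgue_on S. f x * v x = 0" by eventually_elim simp
    then have "(LINT x|lebesgue_on S. f x * v x) = 0" by (rule integral_eq_zero_AE)
    moreover have "mass_norm \<rho> S v \<ge> 0" using mass.nonneg[OF vL] by (simp add: mass_norm_def)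
    ultimately show ?thesis using \<open>dual_mass_norm \<rho> S f \<ge> 0\<close> by simp
  qed
qed

section \<open>Splitting over the mesh and the projection onto the auxiliary space\<close>

locale multiscale = W: weighted_domain \<Omega> \<kappa> \<kappa>min \<kappa>max + M: weighted_domain \<Omega> \<kappa>' \<kappa>min' \<kappa>max'
  for \<Omega> :: "(real^'d) set" and \<kappa> \<kappa>min \<kappa>max \<kappa>' \<kappa>min' \<kappa>max' +
  fixes J :: "'j set" and K :: "'j \<Rightarrow> (real^'d) set"
    and lam :: "'j \<Rightarrow> nat \<Rightarrow> real" and \<Phi> :: "'j \<Rightarrow> nat \<Rightarrow> real^'d \<Rightarrow> real" and k :: nat
  assumes mesh: "coarse_mesh \<Omega> J K"
    and eigs: "\<And>j. j \<in> J \<Longrightarrow> eigensystem \<kappa> \<kappa>' (K j) (lam j) (\<Phi> j)"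
begin

abbreviation "a \<equiv> grad_form \<kappa> \<Omega>"
abbreviation "s \<equiv> mass_form \<kappa>' \<Omega>"
abbreviation "\<pi> \<equiv> aux_proj \<kappa>' J K \<Phi> k"
abbreviation "p j v \<equiv> local_proj \<kappa>' (K j) (\<Phi> j) k v"

lemma finite_J: "finite J" and K_sub: "j \<in> J \<Longrightarrow> K j \<subseteq> \<Omega>" and disj: "disjoint_family_on K J"
  and K_dom: "j \<in> J \<Longrightarrow> bounded_lipschitz_domain (K j)" and negl: "negligible (\<Omega> - (\<Union>j\<in>J. K j))"
  using mesh by (auto simp: coarse_mesh_def)

lemma K_open: "j \<in> J \<Longrightarrow> open (K j)" and K_bounded: "j \<in> J \<Longrightarrow> bounded (K j)"
  and K_sets: "j \<in> J \<Longrightarrow> K j \<in> sets lebesgue"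
  using K_dom by (auto simp: bounded_lipschitz_domain_def)

lemma weighted_subdomain:
  assumes "weighted_domain \<Omega> \<rho> m M" "j \<in> J"
  shows "weighted_domain (K j) \<rho> m M"
proof -
  interpret X: weighted_domain \<Omega> \<rho> m M by fact
  note sub = K_sub[OF assms(2)] K_sets[OF assms(2)] X.S_sets
  show ?thesis
    by unfold_locales (use K_open[OF assms(2)] K_bounded[OF assms(2)] X.\<kappa>min
      lebesgue_on_measurable_subset[OF sub X.\<kappa>_meas] AE_lebesgue_on_subset[OF sub X.\<kappa>_bounds] in auto)
qed

lemma eigen_domain:
  assumes "j \<in> J"
  shows "eigen_domain (K j) \<kappa> \<kappa>min \<kappa>max \<kappa>' \<kappa>min' \<kappa>max' (lam j) (\<Phi> j)"
  by (intro eigen_domain.intro eigen_domain_axioms.intro K_dom eigs weighted_subdomain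
      W.weighted_domain_axioms M.weighted_domain_axioms assms)

lemma integral_split:
  fixes f :: "real^'d \<Rightarrow> real"
  assumes f: "integrable (lebesgue_on \<Omega>) f"
  shows "(LINT x|lebesgue_on \<Omega>. f x) = (\<Sum>j\<in>J. LINT x|lebesgue_on (K j). f x)"
proof -
  have U: "(\<Union>j\<in>J. K j) \<subseteq> \<Omega>" "(\<Union>j\<in>J. K j) \<in> sets lebesgue"
    using K_sub K_sets finite_J by auto
  have "(LINT x|lebesgue_on \<Omega>. f x) = (LINT x|lebesgue_on (\<Union>j\<in>J. K j). f x)"
    by (rule integral_negligible_diff[OF U W.S_sets negl f])
  also have "\<dots> = (\<Sum>j\<in>J. LINT x|lebesgue_on (K j). f x)"
    by (rule integral_disjoint_UN[OF finite_J disj K_sets integrable_lebesgue_on_subset[OF K_sub K_sets W.S_sets f]])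
  finally show ?thesis .
qed

lemma mass_form_split:
  assumes "weighted_domain \<Omega> \<rho> m M" "u \<in> L2 \<Omega>" "v \<in> L2 \<Omega>"
  shows "mass_form \<rho> \<Omega> u v = (\<Sum>j\<in>J. mass_form \<rho> (K j) u v)"
  unfolding mass_form_def by (rule integral_split[OF weighted_domain.integrable_weight[OF assms]])

lemma H1_restrict:
  assumes "j \<in> J" "has_weak_gradient \<Omega> u g"
  shows "has_weak_gradient (K j) u g"
  by (rule has_weak_gradient_subset[OF K_sub[OF assms(1)] K_sets[OF assms(1)] W.S_sets assms(2)])

text \<open>The form on an element uses the gradient selected there, which may differ from the
  selected global one on a null set. By \<open>grad_form_eq\<close> the restriction of the global
  gradient may be used instead, and then the integral splits.\<close>

lemma grad_form_split:
  assumes "u \<in> H1 \<Omega>"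
  shows "a u u = (\<Sum>j\<in>J. grad_form \<kappa> (K j) u u)"
proof -
  let ?g = "weak_gradient \<Omega> u"
  have h: "has_weak_gradient \<Omega> u ?g" by (rule H1_has_weak_gradient[OF assms])
  have "a u u = (\<Sum>i\<in>UNIV. \<Sum>j\<in>J. mass_form \<kappa> (K j) (\<lambda>x. ?g x $ i) (\<lambda>x. ?g x $ i))"
    unfolding W.grad_form_eq[OF h h]
    by (intro sum.cong refl mass_form_split[OF W.weighted_domain_axioms] has_weak_gradientD(2)[OF h])
  also have "\<dots> = (\<Sum>j\<in>J. \<Sum>i\<in>UNIV. mass_form \<kappa> (K j) (\<lambda>x. ?g x $ i) (\<lambda>x. ?g x $ i))"
    by (rule sum.swap)
  also have "\<dots> = (\<Sum>j\<in>J. grad_form \<kappa> (K j) u u)"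
    using weighted_domain.grad_form_eq[OF weighted_subdomain[OF W.weighted_domain_axioms] H1_restrict[OF _ h] H1_restrict[OF _ h]]
    by (intro sum.cong) auto
  finally show ?thesis .
qed

lemma L2_restrict: "j \<in> J \<Longrightarrow> v \<in> L2 \<Omega> \<Longrightarrow> v \<in> L2 (K j)"
  by (rule L2_subset[OF K_sub K_sets W.S_sets])

lemma p_L2: "j \<in> J \<Longrightarrow> v \<in> L2 \<Omega> \<Longrightarrow> p j v \<in> L2 (K j)"
  by (rule eigen_domain.local_proj_L2[OF eigen_domain L2_restrict])

lemma \<pi>_eq:
  assumes "j \<in> J" "x \<in> K j"
  shows "\<pi> v x = p j v x"
proof -
  have "x \<notin> K i" if "i \<in> J" "i \<noteq> j" for i
    using disj that assms by (auto simp: disjoint_family_on_def)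
  then have "\<pi> v x = (\<Sum>i\<in>J. if i = j then p j v x else 0)"
    unfolding aux_proj_def using assms by (intro sum.cong) auto
  then show ?thesis using assms finite_J by simp
qed

lemma \<pi>_L2: "v \<in> L2 \<Omega> \<Longrightarrow> \<pi> v \<in> L2 \<Omega>"
  using L2_sum[OF finite_J, of "\<lambda>j x. if x \<in> K j then p j v x else 0" \<Omega>]
    L2_extend_zero[OF K_sub K_sets W.S_sets p_L2] by (simp add: aux_proj_def[abs_def])

lemma \<pi>_lin:
  assumes "u \<in> L2 \<Omega>" "v \<in> L2 \<Omega>"
  shows "\<pi> (\<lambda>x. u x + c * v x) = (\<lambda>x. \<pi> u x + c * \<pi> v x)"
proof
  fix x
  have "(\<Sum>j\<in>J. if x \<in> K j then p j (\<lambda>x. u x + c * v x) x else 0) =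
      (\<Sum>j\<in>J. (if x \<in> K j then p j u x else 0) + c * (if x \<in> K j then p j v x else 0))"
  proof (rule sum.cong[OF refl])
    fix j assume j: "j \<in> J"
    show "(if x \<in> K j then p j (\<lambda>x. u x + c * v x) x else 0) =
      (if x \<in> K j then p j u x else 0) + c * (if x \<in> K j then p j v x else 0)"
      unfolding eigen_domain.local_proj_lin[OF eigen_domain[OF j] L2_restrict[OF j assms(1)] L2_restrict[OF j assms(2)]]
      by simp
  qed
  then show "\<pi> (\<lambda>x. u x + c * v x) x = \<pi> u x + c * \<pi> v x"
    by (simp add: aux_proj_def sum.distrib sum_distrib_left)
qed

lemma \<pi>_cong_AE:
  assumes "u \<in> L2 \<Omega>" "AE x in lebesgue_on \<Omega>. u x = v x"
  shows "\<pi> v = \<pi> u"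
proof
  fix x
  have "p j v = p j u" if "j \<in> J" for j
    by (rule eigen_domain.local_proj_cong_AE[OF eigen_domain[OF that] L2_restrict[OF that assms(1)]
        AE_lebesgue_on_subset[OF K_sub[OF that] K_sets[OF that] W.S_sets assms(2)]])
  then show "\<pi> v x = \<pi> u x" unfolding aux_proj_def by (intro sum.cong) auto
qed

lemma s_\<pi>_split:
  assumes "v \<in> L2 \<Omega>"
  shows "s (\<pi> v) (\<pi> v) = (\<Sum>j\<in>J. mass_form \<kappa>' (K j) (p j v) (p j v))"
proof -
  have "mass_form \<kappa>' (K j) (\<pi> v) (\<pi> v) = mass_form \<kappa>' (K j) (p j v) (p j v)" if "j \<in> J" for j
    unfolding mass_form_def by (rule Bochner_Integration.integral_cong) (use \<pi>_eq[OF that] in auto)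
  then show ?thesis
    unfolding mass_form_split[OF M.weighted_domain_axioms \<pi>_L2[OF assms] \<pi>_L2[OF assms]] by (intro sum.cong) auto
qed

lemma s_\<pi>_le:
  assumes "v \<in> L2 \<Omega>"
  shows "s (\<pi> v) (\<pi> v) \<le> s v v"
  unfolding s_\<pi>_split[OF assms] mass_form_split[OF M.weighted_domain_axioms assms assms]
  by (intro sum_mono eigen_domain.local_proj_contraction[OF eigen_domain] L2_restrict assms)

text \<open>The squared norm of \<pi> e is a sum of nonnegative local terms, so each local
  projection has norm zero and \<open>local_gap\<close> applies on every element; \<Lambda> is a
  common lower bound of the local constants.\<close>

lemma gap:
  assumes e: "e \<in> H1 \<Omega>" and z: "s (\<pi> e) (\<pi> e) = 0" and l: "\<And>j. j \<in> J \<Longrightarrow> \<Lambda> \<le> lam j (k + 1)"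
  shows "\<Lambda> * s e e \<le> a e e"
proof -
  have eL: "e \<in> L2 \<Omega>" by (rule W.H1_L2[OF e])
  have nn: "0 \<le> mass_form \<kappa>' (K j) (p j e) (p j e)" if "j \<in> J" for j
  proof -
    interpret E: eigen_domain "K j" \<kappa> \<kappa>min \<kappa>max \<kappa>' \<kappa>min' \<kappa>max' "lam j" "\<Phi> j" by (rule eigen_domain[OF that])
    show ?thesis by (rule E.M.mass.nonneg[OF p_L2[OF that eL]])
  qed
  have pz: "mass_form \<kappa>' (K j) (p j e) (p j e) = 0" if "j \<in> J" for j
    using z sum_nonneg_eq_0_iff[OF finite_J nn] that unfolding s_\<pi>_split[OF eL] by simp
  have "\<Lambda> * mass_form \<kappa>' (K j) e e \<le> grad_form \<kappa> (K j) e e" if j: "j \<in> J" for j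
  proof -
    interpret E: eigen_domain "K j" \<kappa> \<kappa>min \<kappa>max \<kappa>' \<kappa>min' \<kappa>max' "lam j" "\<Phi> j" by (rule eigen_domain[OF j])
    have "e \<in> H1 (K j)" by (rule has_weak_gradient_H1[OF H1_restrict[OF j H1_has_weak_gradient[OF e]]])
    from E.local_gap[OF this pz[OF j]] have "lam j (k + 1) * mass_form \<kappa>' (K j) e e \<le> grad_form \<kappa> (K j) e e" .
    moreover have "\<Lambda> * mass_form \<kappa>' (K j) e e \<le> lam j (k + 1) * mass_form \<kappa>' (K j) e e"
      by (rule mult_right_mono[OF l[OF j] E.M.mass.nonneg[OF L2_restrict[OF j eL]]])
    ultimately show ?thesis by linarith
  qed
  then show ?thesis
    unfolding grad_form_split[OF e] mass_form_split[OF M.weighted_domain_axioms eL eL] sum_distrib_left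
    by (rule sum_mono)
qed

section \<open>Solvability of the corrector problem\<close>

sublocale P: semi_inner "L2 \<Omega>" "\<lambda>u v. s (\<pi> u) (\<pi> v)"
proof
  show "s (\<pi> u) (\<pi> v) = s (\<pi> v) (\<pi> u)" if "u \<in> L2 \<Omega>" "v \<in> L2 \<Omega>" for u v
    by (rule M.mass.sym[OF \<pi>_L2[OF that(1)] \<pi>_L2[OF that(2)]])
  show "s (\<pi> (\<lambda>x. u x + c * v x)) (\<pi> w) = s (\<pi> u) (\<pi> w) + c * s (\<pi> v) (\<pi> w)"
    if "u \<in> L2 \<Omega>" "v \<in> L2 \<Omega>" "w \<in> L2 \<Omega>" for u v w c
    unfolding \<pi>_lin[OF that(1,2)] by (rule M.mass.lin[OF that[THEN \<pi>_L2]])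
  show "s (\<pi> u) (\<pi> u) \<ge> 0" if "u \<in> L2 \<Omega>" for u by (rule M.mass.nonneg[OF \<pi>_L2[OF that]])
qed (rule L2_lin)

lemma H10_L2: "v \<in> H10 \<Omega> \<Longrightarrow> v \<in> L2 \<Omega>"
  using W.H1_L2 H10_H1 by blast

text \<open>The form on the left-hand side of the corrector problem, to which Riesz representation
  is applied on \<open>H10\<close>.\<close>

definition B where "B u v = a u v + s (\<pi> u) (\<pi> v)"

sublocale B: semi_inner "H10 \<Omega>" B
proof
  fix u v :: "real^'d \<Rightarrow> real" and c assume "u \<in> H10 \<Omega>" "v \<in> H10 \<Omega>"
  then show "(\<lambda>x. u x + c * v x) \<in> H10 \<Omega>" by (rule H10_lin[OF W.S])
next
  fix u v :: "real^'d \<Rightarrow> real" assume uv: "u \<in> H10 \<Omega>" "v \<in> H10 \<Omega>"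
  show "B u v = B v u"
    unfolding B_def using W.grad.sym[OF uv[THEN H10_H1]] P.sym[OF uv[THEN H10_L2]] by simp
next
  fix u v w :: "real^'d \<Rightarrow> real" and c assume uv: "u \<in> H10 \<Omega>" "v \<in> H10 \<Omega>" "w \<in> H10 \<Omega>"
  show "B (\<lambda>x. u x + c * v x) w = B u w + c * B v w"
    unfolding B_def W.grad.lin[OF uv[THEN H10_H1]] P.lin[OF uv[THEN H10_L2]] by (simp add: algebra_simps)
next
  fix u :: "real^'d \<Rightarrow> real" assume u: "u \<in> H10 \<Omega>"
  show "B u u \<ge> 0" unfolding B_def
    using W.grad.nonneg[OF H10_H1[OF u]] P.nonneg[OF H10_L2[OF u]] by simp
qed

lemma grad_form_le_B: "u \<in> H10 \<Omega> \<Longrightarrow> a u u \<le> B u u"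
  unfolding B_def using P.nonneg[OF H10_L2] by simp

lemma coercive: "\<exists>C>0. \<forall>v\<in>H10 \<Omega>. sq_int \<Omega> v \<le> C * a v v"
proof -
  obtain C where C: "C > 0" "\<And>v. v \<in> H10 \<Omega> \<Longrightarrow> sq_int \<Omega> v \<le> C * gsq_int \<Omega> (weak_gradient \<Omega> v)"
    using friedrichs[OF W.S] by blast
  have "sq_int \<Omega> v \<le> (C / \<kappa>min) * a v v" if v: "v \<in> H10 \<Omega>" for v
  proof -
    have "gsq_int \<Omega> (weak_gradient \<Omega> v) \<le> a v v / \<kappa>min"
      using W.grad_form_bounds(1)[OF H1_has_weak_gradient[OF H10_H1[OF v]]] W.\<kappa>min by (simp add: field_simps)
    then have "C * gsq_int \<Omega> (weak_gradient \<Omega> v) \<le> C * (a v v / \<kappa>min)" using C(1) by (intro mult_left_mono) auto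
    then show ?thesis using C(2)[OF v] by simp
  qed
  then show ?thesis using C(1) W.\<kappa>min by (intro exI[of _ "C / \<kappa>min"]) simp
qed

text \<open>\<open>B\<close> dominates the gradient integral, and through the Friedrichs inequality
  also the square integral, so a sequence that is Cauchy for \<open>B\<close> has a limit with a
  weak gradient, and this limit stays in \<open>H10\<close>. Conversely \<open>B\<close> is bounded
  by both integrals, because \<pi> is a contraction for \<open>s\<close>, which turns the
  convergence back into one for \<open>B\<close>.\<close>

lemma H10_complete:
  assumes u: "\<And>n. u n \<in> H10 \<Omega>"
    and cauchy: "\<And>e. e > 0 \<Longrightarrow> \<exists>N. \<forall>m\<ge>N. \<forall>n\<ge>N. B (\<lambda>x. u m x - u n x) (\<lambda>x. u m x - u n x) < e"
  shows "\<exists>v\<in>H10 \<Omega>. (\<lambda>n. B (\<lambda>x. u n x - v x) (\<lambda>x. u n x - v x)) \<longlonglongrightarrow> 0"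
proof -
  obtain C where C: "C > 0" "\<And>v. v \<in> H10 \<Omega> \<Longrightarrow> sq_int \<Omega> v \<le> C * a v v" using coercive by blast
  have hu: "has_weak_gradient \<Omega> (u n) (weak_gradient \<Omega> (u n))" for n by (rule H1_has_weak_gradient[OF H10_H1[OF u]])
  have hud: "has_weak_gradient \<Omega> (\<lambda>x. u m x - u n x) (\<lambda>x. weak_gradient \<Omega> (u m) x - weak_gradient \<Omega> (u n) x)" for m n
    using has_weak_gradient_lin[OF W.S_lmeasurable hu hu, of m "-1" n] by simp
  have ud: "(\<lambda>x. u m x - u n x) \<in> H10 \<Omega>" for m n by (rule B.diff_closed[OF u u])
  have cv: "\<exists>N. \<forall>m\<ge>N. \<forall>n\<ge>N. sq_int \<Omega> (\<lambda>x. u m x - u n x) < e" if "e > 0" for e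
  proof -
    have "e / C > 0" using that C by simp
    from cauchy[OF this] obtain N where N: "\<forall>m\<ge>N. \<forall>n\<ge>N. B (\<lambda>x. u m x - u n x) (\<lambda>x. u m x - u n x) < e / C" by (elim exE)
    have "sq_int \<Omega> (\<lambda>x. u m x - u n x) < e" if "m \<ge> N" "n \<ge> N" for m n
    proof -
      have "a (\<lambda>x. u m x - u n x) (\<lambda>x. u m x - u n x) < e / C"
        using grad_form_le_B[OF ud, of m n] N[THEN spec, THEN mp, OF that(1), THEN spec, THEN mp, OF that(2)] by linarith
      then have "C * a (\<lambda>x. u m x - u n x) (\<lambda>x. u m x - u n x) < e" using C(1) by (simp add: field_simps)
      then show ?thesis using C(2)[OF ud, of m n] by linarith
    qed
    then show ?thesis by (intro exI[of _ N] allI impI)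
  qed
  have cg: "\<exists>N. \<forall>m\<ge>N. \<forall>n\<ge>N. gsq_int \<Omega> (\<lambda>x. weak_gradient \<Omega> (u m) x - weak_gradient \<Omega> (u n) x) < e" if "e > 0" for e
  proof -
    have "\<kappa>min * e > 0" using that W.\<kappa>min by simp
    from cauchy[OF this] obtain N where N: "\<forall>m\<ge>N. \<forall>n\<ge>N. B (\<lambda>x. u m x - u n x) (\<lambda>x. u m x - u n x) < \<kappa>min * e" by (elim exE)
    have "gsq_int \<Omega> (\<lambda>x. weak_gradient \<Omega> (u m) x - weak_gradient \<Omega> (u n) x) < e" if "m \<ge> N" "n \<ge> N" for m n
    proof -
      have "\<kappa>min * gsq_int \<Omega> (\<lambda>x. weak_gradient \<Omega> (u m) x - weak_gradient \<Omega> (u n) x) < \<kappa>min * e"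
        using W.grad_form_bounds(1)[OF hud, of m n] grad_form_le_B[OF ud, of m n]
          N[THEN spec, THEN mp, OF that(1), THEN spec, THEN mp, OF that(2)] by linarith
      then show ?thesis using W.\<kappa>min by simp
    qed
    then show ?thesis by (intro exI[of _ N] allI impI)
  qed
  have "\<exists>v h. has_weak_gradient \<Omega> v h \<and> (\<lambda>n. sq_int \<Omega> (\<lambda>x. u n x - v x)) \<longlonglongrightarrow> 0 \<and>
      (\<lambda>n. gsq_int \<Omega> (\<lambda>x. weak_gradient \<Omega> (u n) x - h x)) \<longlonglongrightarrow> 0"
    by (rule has_weak_gradient_complete[OF W.S_lmeasurable hu]) (erule cv, erule cg)
  then obtain v h where v: "has_weak_gradient \<Omega> v h" "(\<lambda>n. sq_int \<Omega> (\<lambda>x. u n x - v x)) \<longlonglongrightarrow> 0"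
    "(\<lambda>n. gsq_int \<Omega> (\<lambda>x. weak_gradient \<Omega> (u n) x - h x)) \<longlonglongrightarrow> 0" by (elim exE conjE)
  have vH: "v \<in> H10 \<Omega>" by (rule H10_closed[OF W.S u v])
  have hd: "has_weak_gradient \<Omega> (\<lambda>x. u n x - v x) (\<lambda>x. weak_gradient \<Omega> (u n) x - h x)" for n
    using has_weak_gradient_lin[OF W.S_lmeasurable hu v(1), of n "-1"] by simp
  have dH: "(\<lambda>x. u n x - v x) \<in> H10 \<Omega>" for n by (rule B.diff_closed[OF u vH])
  let ?b = "\<lambda>n. \<kappa>max * gsq_int \<Omega> (\<lambda>x. weak_gradient \<Omega> (u n) x - h x) + \<kappa>max' * sq_int \<Omega> (\<lambda>x. u n x - v x)"
  have "(\<lambda>n. B (\<lambda>x. u n x - v x) (\<lambda>x. u n x - v x)) \<longlonglongrightarrow> 0"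
  proof (rule tendsto_sandwich[of "\<lambda>_. 0" _ _ ?b])
    show "\<forall>\<^sub>F n in sequentially. 0 \<le> B (\<lambda>x. u n x - v x) (\<lambda>x. u n x - v x)"
      by (intro always_eventually allI B.nonneg dH)
    show "\<forall>\<^sub>F n in sequentially. B (\<lambda>x. u n x - v x) (\<lambda>x. u n x - v x) \<le> ?b n"
    proof (intro always_eventually allI)
      fix n
      show "B (\<lambda>x. u n x - v x) (\<lambda>x. u n x - v x) \<le> ?b n"
        unfolding B_def using W.grad_form_bounds(2)[OF hd, of n] s_\<pi>_le[OF H10_L2[OF dH], of n]
          M.mass_form_bounds(2)[OF H10_L2[OF dH], of n] by linarith
    qed
    show "?b \<longlonglongrightarrow> 0"
      using tendsto_add[OF tendsto_mult_right_zero[OF v(3), of \<kappa>max] tendsto_mult_right_zero[OF v(2), of \<kappa>max']] by simp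
  qed simp
  then show ?thesis by (rule bexI[OF _ vH])
qed

text \<open>The functional s(\<pi> v, \<pi> w) is bounded for \<open>B\<close> by Cauchy-Schwarz,
  since \<open>B\<close> contains the square s(\<pi> w, \<pi> w) as a summand. Existence is what
  gives the correctors, chosen by \<open>SOME\<close>, their defining property.\<close>

lemma corrector_exists:
  assumes v: "v \<in> L2 \<Omega>"
  shows "\<exists>g. corrector_problem \<kappa> \<kappa>' \<Omega> \<pi> v g"
proof -
  have "\<exists>g\<in>H10 \<Omega>. \<forall>w\<in>H10 \<Omega>. B g w = s (\<pi> v) (\<pi> w)"
  proof (rule B.riesz[where C = "s (\<pi> v) (\<pi> v)"])
    show "H10 \<Omega> \<noteq> {}" using test_function_H10[OF W.S test_functions_zero] by blast
    show "s (\<pi> v) (\<pi> (\<lambda>x. u x + c * w x)) = s (\<pi> v) (\<pi> u) + c * s (\<pi> v) (\<pi> w)"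
      if "u \<in> H10 \<Omega>" "w \<in> H10 \<Omega>" for u w c
      by (rule P.lin_right[OF that[THEN H10_L2] v])
    show "(s (\<pi> v) (\<pi> u))\<^sup>2 \<le> s (\<pi> v) (\<pi> v) * B u u" if u: "u \<in> H10 \<Omega>" for u
    proof -
      have "(s (\<pi> v) (\<pi> u))\<^sup>2 \<le> s (\<pi> v) (\<pi> v) * s (\<pi> u) (\<pi> u)" by (rule P.cauchy_schwarz[OF v H10_L2[OF u]])
      also have "\<dots> \<le> s (\<pi> v) (\<pi> v) * B u u"
        using W.grad.nonneg[OF H10_H1[OF u]] by (intro mult_left_mono P.nonneg[OF v]) (simp add: B_def)
      finally show ?thesis .
    qed
  qed (rule H10_complete)
  then show ?thesis unfolding corrector_problem_def B_def by blast
qed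

text \<open>The local problems share the same form, so their solutions add up to a solution for the
  sum of the restrictions of \<open>v\<close>. That sum agrees with \<open>v\<close> off the
  skeleton, a null set, which \<pi> does not see. In this way the sum over elements is replaced by a
  single problem for \<open>v\<close>.\<close>

lemma global_corrector:
  assumes v: "v \<in> L2 \<Omega>"
  defines "G \<equiv> global_corrector \<kappa> \<kappa>' \<Omega> \<pi> J K v"
  shows "G \<in> H10 \<Omega>" and "w \<in> H10 \<Omega> \<Longrightarrow> a G w + s (\<pi> G) (\<pi> w) = s (\<pi> v) (\<pi> w)"
proof -
  define vj where "vj = (\<lambda>j x. if x \<in> K j then v x else 0)"
  define L where "L = (\<lambda>j. local_corrector \<kappa> \<kappa>' \<Omega> \<pi> (K j) v)"
  have vj: "vj j \<in> L2 \<Omega>" if "j \<in> J" for j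
    unfolding vj_def by (rule L2_extend_zero[OF K_sub[OF that] K_sets[OF that] W.S_sets L2_restrict[OF that v]])
  have "corrector_problem \<kappa> \<kappa>' \<Omega> \<pi> (vj j) (L j)" if "j \<in> J" for j
    using someI_ex[OF corrector_exists[OF vj[OF that]]] unfolding L_def local_corrector_def vj_def .
  then have L: "L j \<in> H10 \<Omega>" "w \<in> H10 \<Omega> \<Longrightarrow> B (L j) w = s (\<pi> (vj j)) (\<pi> w)" if "j \<in> J" for j w
    using that by (auto simp: corrector_problem_def B_def)
  have G: "G = (\<lambda>x. \<Sum>j\<in>J. 1 * L j x)" by (simp add: G_def global_corrector_def[abs_def] L_def)
  have zero: "(\<lambda>x. 0) \<in> H10 \<Omega>" by (rule test_function_H10[OF W.S test_functions_zero])
  show "G \<in> H10 \<Omega>" unfolding G by (rule B.sum_closed[OF zero]) (rule L(1))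
  have sum_v: "AE x in lebesgue_on \<Omega>. v x = (\<Sum>j\<in>J. 1 * vj j x)"
  proof -
    have "v x = (\<Sum>j\<in>J. 1 * vj j x)" if x: "x \<in> (\<Union>j\<in>J. K j)" for x
    proof -
      obtain j where j: "j \<in> J" "x \<in> K j" using x by blast
      have "x \<notin> K i" if "i \<in> J" "i \<noteq> j" for i using disj that j by (auto simp: disjoint_family_on_def)
      then have "(\<Sum>i\<in>J. 1 * vj i x) = (\<Sum>i\<in>J. if i = j then v x else 0)"
        using j by (intro sum.cong) (auto simp: vj_def)
      then show ?thesis using j finite_J by simp
    qed
    then have "{x\<in>\<Omega>. \<not> v x = (\<Sum>j\<in>J. 1 * vj j x)} \<subseteq> \<Omega> - (\<Union>j\<in>J. K j)" by blast
    from negligible_subset[OF negl this] show ?thesis unfolding AE_lebesgue_on_iff_negligible[OF W.S_sets] .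
  qed
  show "a G w + s (\<pi> G) (\<pi> w) = s (\<pi> v) (\<pi> w)" if w: "w \<in> H10 \<Omega>"
  proof -
    have "B G w = (\<Sum>j\<in>J. 1 * B (L j) w)" unfolding G by (rule B.sum_left[OF w]) (rule L(1))
    also have "\<dots> = (\<Sum>j\<in>J. 1 * s (\<pi> (vj j)) (\<pi> w))" using L(2)[OF _ w] by (intro sum.cong) auto
    also have "\<dots> = s (\<pi> (\<lambda>x. \<Sum>j\<in>J. 1 * vj j x)) (\<pi> w)" by (rule P.sum_left[OF H10_L2[OF w], symmetric]) (rule vj)
    also have "\<pi> (\<lambda>x. \<Sum>j\<in>J. 1 * vj j x) = \<pi> v" by (rule \<pi>_cong_AE[OF v sum_v])
    finally show ?thesis unfolding B_def .
  qed
qed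

section \<open>The error estimate\<close>

theorem energy_error:
  assumes f: "f \<in> L2 \<Omega>" and ne: "\<Omega> \<noteq> {}"
    and u: "solves_variational \<kappa> \<Omega> (H10 \<Omega>) f u"
    and ums: "solves_variational \<kappa> \<Omega> (multiscale_space \<kappa> \<kappa>' \<Omega> \<pi> J K) f ums"
    and \<Lambda>: "\<Lambda> > 0" "\<And>j. j \<in> J \<Longrightarrow> \<Lambda> \<le> lam j (k + 1)"
  shows "energy_norm \<kappa> \<Omega> (\<lambda>x. u x - ums x) \<le> 1 / sqrt \<Lambda> * dual_mass_norm \<kappa>' \<Omega> f"
proof -
  let ?G = "global_corrector \<kappa> \<kappa>' \<Omega> \<pi> J K"
  define e where "e = (\<lambda>x. u x - ums x)"
  have uH: "u \<in> H10 \<Omega>" and ueq: "\<And>w. w \<in> H10 \<Omega> \<Longrightarrow> a u w = (LINT x|lebesgue_on \<Omega>. f x * w x)"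
    using u by (auto simp: solves_variational_def)
  obtain v where v: "v \<in> L2 \<Omega>" and vG: "AE x in lebesgue_on \<Omega>. ums x = ?G v x"
    using ums by (auto simp: solves_variational_def multiscale_space_def)
  have Gv: "?G v \<in> H10 \<Omega>" by (rule global_corrector(1)[OF v])
  have vG': "AE x in lebesgue_on \<Omega>. ?G v x = ums x" using vG by eventually_elim simp
  have umsH: "ums \<in> H10 \<Omega>" by (rule H10_AE_eq[OF W.S Gv vG'])
  have eH: "e \<in> H10 \<Omega>" unfolding e_def by (rule B.diff_closed[OF uH umsH])
  have eL: "e \<in> L2 \<Omega>" by (rule H10_L2[OF eH])
  define w where "w = ?G e"
  have wH: "w \<in> H10 \<Omega>" unfolding w_def by (rule global_corrector(1)[OF eL])
  have wL: "w \<in> L2 \<Omega>" by (rule H10_L2[OF wH])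
  have weq: "a w z + s (\<pi> w) (\<pi> z) = s (\<pi> e) (\<pi> z)" if "z \<in> H10 \<Omega>" for z
    unfolding w_def by (rule global_corrector(2)[OF eL that])
  \<comment> \<open>The error lies in \<open>L2\<close>, so its corrector belongs to the multiscale
    space and may be used as a test function in the Galerkin equation as well as in the weak
    formulation.\<close>
  have "w \<in> multiscale_space \<kappa> \<kappa>' \<Omega> \<pi> J K"
    unfolding multiscale_space_def w_def by (rule CollectI, rule bexI[OF _ eL]) simp
  then have "a ums w = (LINT x|lebesgue_on \<Omega>. f x * w x)" using ums by (simp add: solves_variational_def)
  then have "a e w = 0"
    unfolding e_def W.grad.diff_left[OF H10_H1[OF uH] H10_H1[OF umsH] H10_H1[OF wH]] ueq[OF wH] by simp
  then have "a w e = 0" using W.grad.sym[OF H10_H1[OF eH] H10_H1[OF wH]] by simp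
  then have we: "s (\<pi> w) (\<pi> e) = s (\<pi> e) (\<pi> e)" using weq[OF eH] by simp
  then have ww: "a w w + s (\<pi> w) (\<pi> w) = s (\<pi> e) (\<pi> e)" using weq[OF wH] P.sym[OF wL eL] by simp
  have aw: "a w w = 0"
    using P.expand_diff[OF wL eL] P.nonneg[OF L2_diff[OF wL eL]] W.grad.nonneg[OF H10_H1[OF wH]] we ww by linarith
  \<comment> \<open>Zero energy makes \<open>w\<close> vanish almost everywhere by the Friedrichs
    inequality, hence \<pi> w has norm zero, and \<open>ww\<close> passes this on to \<pi>
    e.\<close>
  obtain C where C: "C > 0" "\<And>v. v \<in> H10 \<Omega> \<Longrightarrow> sq_int \<Omega> v \<le> C * a v v" using coercive by blast
  have "sq_int \<Omega> w \<le> 0" using C(2)[OF wH] aw by simp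
  then have "sq_int \<Omega> w = 0" using sq_int_nonneg[of \<Omega> w] by linarith
  then have "s w w \<le> 0" using M.mass_form_bounds(2)[OF wL] by simp
  then have pe: "s (\<pi> e) (\<pi> e) = 0"
    using s_\<pi>_le[OF wL] P.nonneg[OF wL] ww aw by linarith
  \<comment> \<open>The multiscale solution agrees with a corrector almost everywhere. By the
    corrector equation its product with \<open>e\<close> is expressed through \<pi> e alone, whose
    norm is zero.\<close>
  have "a ums e = a (?G v) e"
    by (rule W.grad_form_cong_AE[OF H10_H1[OF umsH] H10_H1[OF eH] vG]) simp
  also have "\<dots> = s (\<pi> v) (\<pi> e) - s (\<pi> (?G v)) (\<pi> e)" using global_corrector(2)[OF v eH] by simp
  also have "\<dots> = 0"
    using P.cauchy_schwarz[OF v eL] P.cauchy_schwarz[OF H10_L2[OF Gv] eL] pe by simp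
  finally have "a ums e = 0" .
  have "a e e = a u e - a ums e"
    unfolding e_def by (rule W.grad.diff_left[OF H10_H1[OF uH] H10_H1[OF umsH] H10_H1[OF eH], unfolded e_def])
  then have ae: "a e e = (LINT x|lebesgue_on \<Omega>. f x * e x)" using \<open>a ums e = 0\<close> ueq[OF eH] by simp
  let ?N = "dual_mass_norm \<kappa>' \<Omega> f"
  note dual = dual_mass_norm_bound[OF M.weighted_domain_axioms ne f]
  have "a e e \<le> ?N * sqrt (s e e)" using dual(2)[OF eL] ae by (simp add: mass_norm_def)
  moreover have "\<Lambda> * s e e \<le> a e e" by (rule gap[OF H10_H1[OF eH] pe \<Lambda>(2)])
  then have "sqrt (s e e) \<le> sqrt (a e e) / sqrt \<Lambda>"
    using \<Lambda>(1) by (simp add: real_sqrt_divide[symmetric] field_simps)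
  then have "?N * sqrt (s e e) \<le> ?N * (sqrt (a e e) / sqrt \<Lambda>)" using dual(1) by (rule mult_left_mono)
  ultimately have main: "a e e \<le> (?N / sqrt \<Lambda>) * sqrt (a e e)" by simp
  have "sqrt (a e e) \<le> ?N / sqrt \<Lambda>"
  \<comment> \<open>The inequality \<open>main\<close> is divided by sqrt (a e e), so vanishing
    energy is treated apart.\<close>
  proof (cases "a e e = 0")
    case True
    then show ?thesis using dual(1) \<Lambda>(1) by simp
  next
    case False
    then have p: "a e e > 0" using W.grad.nonneg[OF H10_H1[OF eH]] by simp
    then have "sqrt (a e e) * sqrt (a e e) \<le> (?N / sqrt \<Lambda>) * sqrt (a e e)" using main by simp
    then show ?thesis using p by (simp only: mult_le_cancel_right_pos real_sqrt_gt_zero)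
  qed
  then show ?thesis by (simp add: energy_norm_def e_def)
qed

end

text \<open>Each element contains a ball and so has positive diameter. This is needed for the
  scaling factor: with mesh size 0 the power \<open>powi (-2)\<close> would be 0 and the weight of
  \<open>s\<close> would vanish.\<close>

lemma mesh_size_pos:
  assumes mesh: "coarse_mesh \<Omega> J K" and "J \<noteq> {}"
  shows "mesh_size J K > 0"
proof -
  have fin: "finite J" using mesh by (simp add: coarse_mesh_def)
  obtain j where j: "j \<in> J" using assms(2) by blast
  have "bounded_lipschitz_domain (K j)" using mesh j by (simp add: coarse_mesh_def)
  then have K: "open (K j)" "bounded (K j)" "K j \<noteq> {}" by (auto simp: bounded_lipschitz_domain_def)
  then obtain x where "x \<in> K j" by blast
  then obtain r where r: "r > 0" "cball x r \<subseteq> K j" using K(1) open_contains_cball by blast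
  define y where "y = x + r *\<^sub>R axis undefined 1"
  have d: "dist x y = r" using r(1) by (simp add: y_def dist_norm norm_axis_1)
  then have "x \<in> K j" "y \<in> K j" using r by auto
  from diameter_bounded_bound[OF K(2) this] have "0 < diameter (K j)" using d r(1) by simp
  also have "\<dots> \<le> mesh_size J K" unfolding mesh_size_def using fin j by (intro Max_ge) auto
  finally show ?thesis .
qed

theorem theorem3p2:
  fixes \<Omega> :: "(real^'d) set"
    and \<kappa> :: "real^'d \<Rightarrow> real" and \<kappa>min \<kappa>max C\<^sub>m\<^sub>s\<^sub>h :: real
    and J :: "'j set" and K :: "'j \<Rightarrow> (real^'d) set"
    and lam :: "'j \<Rightarrow> nat \<Rightarrow> real" and \<Phi> :: "'j \<Rightarrow> nat \<Rightarrow> real^'d \<Rightarrow> real" and k :: nat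
    and f u u\<^sub>m\<^sub>s :: "real^'d \<Rightarrow> real"
  defines "\<kappa>' \<equiv> scaled_coeff C\<^sub>m\<^sub>s\<^sub>h (mesh_size J K) \<kappa>"
    and "\<pi> \<equiv> aux_proj (scaled_coeff C\<^sub>m\<^sub>s\<^sub>h (mesh_size J K) \<kappa>) J K \<Phi> k"
    and "\<Lambda> \<equiv> (MIN j\<in>J. lam j (k + 1))"
  assumes "CARD('d) \<in> {2, 3}"
    and "bounded_lipschitz_domain \<Omega>"
    and "\<kappa> \<in> borel_measurable (lebesgue_on \<Omega>)"
    and "0 < \<kappa>min" and "AE x in lebesgue_on \<Omega>. \<kappa>min \<le> \<kappa> x \<and> \<kappa> x \<le> \<kappa>max"
    and "coarse_mesh \<Omega> J K"
    and "0 < C\<^sub>m\<^sub>s\<^sub>h"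
    and "\<And>j. j \<in> J \<Longrightarrow> eigensystem \<kappa> \<kappa>' (K j) (lam j) (\<Phi> j)"
    and "1 \<le> k"
    and "f \<in> L2 \<Omega>"
    and "solves_variational \<kappa> \<Omega> (H10 \<Omega>) f u"
    and "solves_variational \<kappa> \<Omega> (multiscale_space \<kappa> \<kappa>' \<Omega> \<pi> J K) f u\<^sub>m\<^sub>s"
  shows "energy_norm \<kappa> \<Omega> (\<lambda>x. u x - u\<^sub>m\<^sub>s x) \<le> 1 / sqrt \<Lambda> * dual_mass_norm \<kappa>' \<Omega> f"
proof -
  have \<Omega>: "open \<Omega>" "bounded \<Omega>" "\<Omega> \<noteq> {}" using assms(5) by (auto simp: bounded_lipschitz_domain_def)
  \<comment> \<open>The maximum in the mesh size and the minimum \<Lambda> have their meaning only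
    over a nonempty index set. Without elements the whole domain would be a null set, although it is
    open and nonempty.\<close>
  have J: "J \<noteq> {}"
  proof
    assume "J = {}"
    then have "negligible \<Omega>" using assms(9) by (simp add: coarse_mesh_def)
    then show False using open_not_negligible[OF \<Omega>(1,3)] by simp
  qed
  have fin: "finite J" using assms(9) by (simp add: coarse_mesh_def)
  define c where "c = C\<^sub>m\<^sub>s\<^sub>h * mesh_size J K powi (-2)"
  have c: "c > 0" using assms(10) mesh_size_pos[OF assms(9) J] by (simp add: c_def)
  have \<kappa>': "\<kappa>' = (\<lambda>x. c * \<kappa> x)" by (simp add: \<kappa>'_def scaled_coeff_def c_def fun_eq_iff)
  interpret W: weighted_domain \<Omega> \<kappa> \<kappa>min \<kappa>max by unfold_locales (use \<Omega> assms(6-8) in auto)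
  interpret M: weighted_domain \<Omega> \<kappa>' "c * \<kappa>min" "c * \<kappa>max"
  proof
    show "AE x in lebesgue_on \<Omega>. c * \<kappa>min \<le> \<kappa>' x \<and> \<kappa>' x \<le> c * \<kappa>max"
      using assms(8) by eventually_elim (use c in \<open>simp add: \<kappa>'\<close>)
  qed (use \<Omega> assms(6,7) c in \<open>auto simp: \<kappa>'\<close>)
  interpret multiscale \<Omega> \<kappa> \<kappa>min \<kappa>max \<kappa>' "c * \<kappa>min" "c * \<kappa>max" J K lam \<Phi> k
    by unfold_locales (rule assms(9), rule assms(11))
  have \<pi>: "\<pi> = aux_proj \<kappa>' J K \<Phi> k" by (simp add: \<pi>_def \<kappa>'_def)
  \<comment> \<open>The hypothesis 1 \<le> k enters here: the eigenvalue next after the first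
    \<open>k\<close> is positive on each of the finitely many elements, so the minimum is
    positive.\<close>
  have \<Lambda>: "\<Lambda> > 0" unfolding \<Lambda>_def
    using fin J eigen_domain.lam_pos[OF eigen_domain assms(12)] by (subst Min_gr_iff) auto
  have "\<Lambda> \<le> lam j (k + 1)" if "j \<in> J" for j unfolding \<Lambda>_def using fin that by (intro Min_le) auto
  from energy_error[OF assms(13) \<Omega>(3) assms(14) assms(15)[unfolded \<pi>] \<Lambda> this] show ?thesis .
qed

end
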